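(* Let $a,b>0$ be constants with $a+b<\tfrac12$. There exists $\varepsilon_0>0$ such that for every fixed $0<\varepsilon<\varepsilon_0$ the following holds. Consider data $m,n,s,t,J,K,H$ with $m,n\to\infty$, where all $s_j=s$ and all $t_k=t$, and $H$ has no edges outside $\{u_1,\dots,u_J\}\times\{v_1,\dots,v_K\}$, such that uniformly $x_j,y_k=O(n^{1/2+\varepsilon})$; $X=O(n^{1+2\varepsilon})$; $J,K=O(n^{1/2+\varepsilon})$; $n=o(m^{1+\varepsilon})$, $m=o(n^{1+\varepsilon})$; and $\frac{(1-2\lambda)^2}{8A}\bigl(1+\frac{5m}{6n}+\frac{5n}{6m}\bigr)\le a\log n$. Let $G$ be uniformly random in $\mathcal{B}(\boldsymbol{s},\boldsymbol{t})$. Then the probability that the subgraph of $G$ induced by $\{u_1,\dots,u_J\}\cup\{v_1,\dots,v_K\}$ equals $H_{J,K}$ is \[ \lambda^X(1-\lambda)^{JK-X}\exp\Bigl(\Bigl(\frac{JK}{2}+\frac{(1-2\lambda)\omega_1}{4A}\Bigr)\Bigl(\frac1m+\frac1n\Bigr)-\frac{\omega_1^2}{4Amn}-\frac{(n+K)\omega_2}{4An^2}-\frac{(m+J)\omega_2'}{4Am^2}-\frac{1-2\lambda}{24A^2}\Bigl(\frac{\omega_3}{n^2}+\frac{\omega_3'}{m^2}\Bigr)+O(n^{-b})\Bigr). \]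
   Context: $\mathcal{B}(\boldsymbol{s},\boldsymbol{t})$ is the set of simple bipartite graphs on $\{u_1,\dots,u_m\}\cup\{v_1,\dots,v_n\}$ (edges only between $u$'s and $v$'s) with $\deg u_j=s_j$, $\deg v_k=t_k$; here $\boldsymbol{s}=(s,\dots,s)$ and $\boldsymbol{t}=(t,\dots,t)$ are constant positive integer vectors with $ms=nt$. $\lambda=s/n=t/m$, $A=\tfrac12\lambda(1-\lambda)$. $H$ is a fixed bipartite graph on the same vertex set with degrees $x_j$ of $u_j$ and $y_k$ of $v_k$, $X$ its number of edges, and $H_{J,K}$ its subgraph induced by $\{u_1,\dots,u_J\}\cup\{v_1,\dots,v_K\}$. For $\ell=1,2,3$, $\omega_\ell=\sum_{j=1}^J(x_j-\lambda K)^\ell$ and $\omega'_\ell=\sum_{k=1}^K(y_k-\lambda J)^\ell$. Asymptotic notation refers to $m,n\to\infty$. *)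

theory Defs
  imports Complex_Main "HOL-Library.Landau_Symbols"
begin

text \<open>A simple bipartite graph on \<open>{u_1..u_m} \<union> {v_1..v_n}\<close> is represented by its
  edge set: a set of pairs \<open>(j,k)\<close> with \<open>1 \<le> j \<le> m\<close>, \<open>1 \<le> k \<le> n\<close>, the pair \<open>(j,k)\<close>
  standing for the edge \<open>u_j v_k\<close>.\<close>

definition degU :: "(nat \<times> nat) set \<Rightarrow> nat \<Rightarrow> nat" where
  "degU G j = card {k. (j, k) \<in> G}"

definition degV :: "(nat \<times> nat) set \<Rightarrow> nat \<Rightarrow> nat" where
  "degV G k = card {j. (j, k) \<in> G}"

definition bip_graphs :: "nat \<Rightarrow> nat \<Rightarrow> nat \<Rightarrow> nat \<Rightarrow> (nat \<times> nat) set set" where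
  "bip_graphs m n s t =
     {G. G \<subseteq> {1..m} \<times> {1..n} \<and> (\<forall>j\<in>{1..m}. degU G j = s) \<and> (\<forall>k\<in>{1..n}. degV G k = t)}"

definition induced :: "(nat \<times> nat) set \<Rightarrow> nat \<Rightarrow> nat \<Rightarrow> (nat \<times> nat) set" where
  "induced G J K = G \<inter> ({1..J} \<times> {1..K})"

definition prob_induced :: "nat \<Rightarrow> nat \<Rightarrow> nat \<Rightarrow> nat \<Rightarrow> nat \<Rightarrow> nat \<Rightarrow> (nat \<times> nat) set \<Rightarrow> real" where
  "prob_induced m n s t J K H =
     real (card {G \<in> bip_graphs m n s t. induced G J K = induced H J K}) / real (card (bip_graphs m n s t))"

definition lam :: "nat \<Rightarrow> nat \<Rightarrow> real" where
  "lam n s = real s / real n"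

definition Acoef :: "nat \<Rightarrow> nat \<Rightarrow> real" where
  "Acoef n s = lam n s * (1 - lam n s) / 2"

definition omega :: "(nat \<times> nat) set \<Rightarrow> real \<Rightarrow> nat \<Rightarrow> nat \<Rightarrow> nat \<Rightarrow> real" where
  "omega H l J K e = (\<Sum>j = 1..J. (real (degU H j) - l * real K) ^ e)"

definition omega' :: "(nat \<times> nat) set \<Rightarrow> real \<Rightarrow> nat \<Rightarrow> nat \<Rightarrow> nat \<Rightarrow> real" where
  "omega' H l J K e = (\<Sum>k = 1..K. (real (degV H k) - l * real J) ^ e)"

end

theory Submission
  imports Defs "HOL-Combinatorics.Transposition"
begin

text \<open>
  Write \<open>\<Omega>(H)\<close> for the set of graphs \<open>G\<close> of the regular model whose restriction to the corner
  \<open>{1..J} \<times> {1..K}\<close> is \<open>H\<close>. The proof compares \<open>\<Omega>(H)\<close> with \<open>\<Omega>(H \<union> {(j,k)})\<close>: flipping an alternating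
  rectangle with corners \<open>(j,k)\<close> and \<open>(r,c)\<close>, where \<open>r > J\<close> and \<open>c > K\<close>, shows that the ratio of the two
  cardinalities is a quotient of two mean numbers of switchings. With centred indicators these means
  reduce to covariances in one column and one row and to a single triple correlation. All of them are
  controlled by one exact fact: given all other rows and the set of columns where two full rows
  differ, the way these two rows share that set is a uniformly random balanced splitting.
  This determines each ratio up to a relative error of order \<open>n\<close> to the power \<open>-3/2 + O(\<epsilon>)\<close>.
  As at most \<open>JK = O(n\<close> to the power \<open>1 + 2\<epsilon>)\<close> steps lead from one \<open>H\<close> to another, the claimed formula
  \<open>B(H) exp (Q(H))\<close>, with \<open>B\<close> the Bernoulli weight, is correct up to a factor independent of \<open>H\<close>.
  That factor is near 1: both probability distributions have total mass 1, and \<open>exp x \<ge> 1 + x\<close>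
  turns this into bounds by the means of \<open>Q\<close> under the Bernoulli and the regular model, where only
  second moments are needed.
\<close>

text \<open>What has to be overcome is that nothing is known in advance about a random regular graph
  with a prescribed corner, not even that one exists. Centring the indicators at the exact densities
  of the blocks outside the corner makes every sum of a single indicator, and of the product of the
  row and the column indicator, vanish identically. The correlations that remain are reached by
  exchanging parts of two full rows: two signs have covariance -1/(d-1), with d the number of
  disagreements, and d is usually near 2nv, where v = lambda(1-lambda). The hypothesis on (1-2
  lambda)^2/(8A) enters as the lower bound 1/v = O(log n), so that 1/v is dominated by a small power
  of n. The expansion of a ratio is written with factors such as 1 - K/n that look redundant; with
  them it equals the increment of Q exactly, and no error of order 1/n is left to accumulate.
  Finally, the constant term JK/2 (1/m + 1/n) of Q cancels, to leading order, the means of the terms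
  in \<open>omega\<close> and \<open>omega'\<close> with exponent 2; hence Q has small mean under
  both models.\<close>

declare One_nat_def [simp del]

section \<open>Entries as indicators, degrees as sums, transposition of graphs\<close>

definition ent :: "(nat \<times> nat) set \<Rightarrow> nat \<Rightarrow> nat \<Rightarrow> real" where
  "ent G r c = of_bool ((r, c) \<in> G)"

lemma ent_range: "0 \<le> ent G r c" "ent G r c \<le> 1"
  by (auto simp: ent_def)

lemma ent_idem: "ent G r c * ent G r c = ent G r c" "(ent G r c)\<^sup>2 = ent G r c"
  by (auto simp: ent_def)

lemma degU_eq_sum:
  assumes "G \<subseteq> {1..m} \<times> {1..n}"
  shows "real (degU G r) = (\<Sum>c = 1..n. ent G r c)"
proof -
  have "{k. (r, k) \<in> G} = {c \<in> {1..n}. (r, c) \<in> G}"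
    using assms by auto
  then show ?thesis
    by (auto simp: degU_def ent_def Int_def intro!: arg_cong[where f = card])
qed

lemma degV_converse: "degV (G\<inverse>) r = degU G r" and degU_converse: "degU (G\<inverse>) r = degV G r"
  by (auto simp: degU_def degV_def)

lemma ent_converse: "ent (G\<inverse>) r c = ent G c r"
  by (simp add: ent_def)

lemma degV_eq_sum:
  assumes "G \<subseteq> {1..m} \<times> {1..n}"
  shows "real (degV G c) = (\<Sum>r = 1..m. ent G r c)"
proof -
  have "G\<inverse> \<subseteq> {1..n} \<times> {1..m}" using assms by auto
  from degU_eq_sum[OF this, of c] show ?thesis
    by (simp add: degU_converse ent_converse)
qed

lemma bip_graphs_converse:
  "G\<inverse> \<in> bip_graphs n m t s \<longleftrightarrow> G \<in> bip_graphs m n s t"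
  unfolding bip_graphs_def mem_Collect_eq degV_converse degU_converse by auto

lemma finite_bip_graphs: "finite (bip_graphs m n s t)"
  by (rule finite_subset[of _ "Pow ({1..m} \<times> {1..n})"]) (auto simp: bip_graphs_def)

lemma bip_graphs_iff_sums:
  "G \<in> bip_graphs m n s t \<longleftrightarrow> G \<subseteq> {1..m} \<times> {1..n} \<and>
     (\<forall>r\<in>{1..m}. (\<Sum>c = 1..n. ent G r c) = real s) \<and> (\<forall>c\<in>{1..n}. (\<Sum>r = 1..m. ent G r c) = real t)"
  unfolding bip_graphs_def mem_Collect_eq
  by (metis (no_types, lifting) degU_eq_sum degV_eq_sum of_nat_eq_iff)

section \<open>Alternating rectangles and pairs of full rows\<close>

definition flip :: "nat \<Rightarrow> nat \<Rightarrow> nat \<Rightarrow> nat \<Rightarrow> (nat \<times> nat) set \<Rightarrow> (nat \<times> nat) set" where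
  "flip r r' c c' G = sym_diff G ({r, r'} \<times> {c, c'})"

text \<open>The three inequalities force the fourth, so the corners form one of the two 2 by 2
  permutation matrices. Degenerate rectangles, with \<open>r = r'\<close> or \<open>c = c'\<close>,
  are never alternating.\<close>

definition alternating :: "nat \<Rightarrow> nat \<Rightarrow> nat \<Rightarrow> nat \<Rightarrow> (nat \<times> nat) set \<Rightarrow> bool" where
  "alternating r r' c c' G \<longleftrightarrow> ((r, c) \<in> G) \<noteq> ((r', c) \<in> G) \<and> ((r, c') \<in> G) \<noteq> ((r', c') \<in> G) \<and>
     ((r, c) \<in> G) \<noteq> ((r, c') \<in> G)"

lemma mem_flip: "(x, y) \<in> flip r r' c c' G \<longleftrightarrow> ((x, y) \<in> G) \<noteq> ((x = r \<or> x = r') \<and> (y = c \<or> y = c'))"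
  by (auto simp: flip_def)

lemma flip_flip [simp]: "flip r r' c c' (flip r r' c c' G) = G"
  by (auto simp: flip_def)

lemma alternating_flip [simp]: "alternating r r' c c' (flip r r' c c' G) = alternating r r' c c' G"
  unfolding alternating_def mem_flip by auto

text \<open>Complementing a 2 by 2 permutation matrix is the same as swapping its columns, or its
  rows. Flips therefore preserve degrees by mere reindexing of the sums.\<close>

lemma ent_flip_row:
  assumes "alternating r r' c c' G" and "x = r \<or> x = r'"
  shows "ent (flip r r' c c' G) x y = ent G x (transpose c c' y)"
  using assms unfolding alternating_def ent_def mem_flip transpose_def by auto

lemma ent_flip_col:
  assumes "alternating r r' c c' G" and "y = c \<or> y = c'"
  shows "ent (flip r r' c c' G) x y = ent G (transpose r r' x) y"
  using assms unfolding alternating_def ent_def mem_flip transpose_def by auto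

lemma sum_transpose:
  fixes f :: "nat \<Rightarrow> real"
  assumes "a \<in> A" "b \<in> A"
  shows "(\<Sum>x\<in>A. f (transpose a b x)) = sum f A"
  by (rule sum.reindex_bij_witness[of _ "transpose a b" "transpose a b"])
     (use assms in \<open>auto simp: transpose_def\<close>)

lemma flip_bip_graphs:
  assumes G: "G \<in> bip_graphs m n s t" and alt: "alternating r r' c c' G"
    and mem: "r \<in> {1..m}" "r' \<in> {1..m}" "c \<in> {1..n}" "c' \<in> {1..n}"
  shows "flip r r' c c' G \<in> bip_graphs m n s t"
  unfolding bip_graphs_iff_sums
proof (intro conjI ballI)
  show "flip r r' c c' G \<subseteq> {1..m} \<times> {1..n}"
    using G mem by (auto simp: flip_def bip_graphs_def)
next
  fix x assume x: "x \<in> {1..m}"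
  have "(\<Sum>y = 1..n. ent (flip r r' c c' G) x y) = (\<Sum>y = 1..n. ent G x y)"
  proof (cases "x = r \<or> x = r'")
    case True
    show ?thesis
      unfolding ent_flip_row[OF alt True] using sum_transpose[OF mem(3,4)] .
  next
    case False
    then show ?thesis by (auto simp: ent_def mem_flip)
  qed
  with G x show "(\<Sum>y = 1..n. ent (flip r r' c c' G) x y) = real s"
    by (simp add: bip_graphs_iff_sums)
next
  fix y assume y: "y \<in> {1..n}"
  have "(\<Sum>x = 1..m. ent (flip r r' c c' G) x y) = (\<Sum>x = 1..m. ent G x y)"
  proof (cases "y = c \<or> y = c'")
    case True
    show ?thesis
      unfolding ent_flip_col[OF alt True] using sum_transpose[OF mem(1,2)] .
  next
    case False
    then show ?thesis by (auto simp: ent_def mem_flip)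
  qed
  with G y show "(\<Sum>x = 1..m. ent (flip r r' c c' G) x y) = real t"
    by (simp add: bip_graphs_iff_sums)
qed

text \<open>Stands in for measurability with respect to the rows other than \<open>r\<close> and
  \<open>r'\<close>: statements conditional on those rows are expressed by testing against all such
  \<open>F\<close>.\<close>

definition off_rows :: "nat \<Rightarrow> nat \<Rightarrow> ((nat \<times> nat) set \<Rightarrow> real) \<Rightarrow> bool" where
  "off_rows r r' F \<longleftrightarrow> (\<forall>G G'. (\<forall>x y. x \<noteq> r \<longrightarrow> x \<noteq> r' \<longrightarrow> ((x, y) \<in> G \<longleftrightarrow> (x, y) \<in> G')) \<longrightarrow> F G = F G')"

lemma off_rows_flip: "off_rows r r' F \<Longrightarrow> F (flip r r' c c' G) = F G"
  unfolding off_rows_def by (meson mem_flip)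

definition sg :: "nat \<Rightarrow> nat \<Rightarrow> (nat \<times> nat) set \<Rightarrow> nat \<Rightarrow> real" where
  "sg r r' G c = ent G r c - ent G r' c"

lemma sg_cases: "sg r r' G c = 0 \<or> sg r r' G c = 1 \<or> sg r r' G c = -1"
  by (auto simp: sg_def ent_def)

section \<open>Graphs with a prescribed corner, and exchanges between two full rows\<close>

locale bip_ext =
  fixes m n s t J K :: nat and H :: "(nat \<times> nat) set"
  assumes J_less: "J < m" and K_less: "K < n" and H_sub: "H \<subseteq> {1..J} \<times> {1..K}"
begin

definition Om :: "(nat \<times> nat) set set" where
  "Om = {G \<in> bip_graphs m n s t. induced G J K = H}"

abbreviation M :: real where "M \<equiv> real (card Om)"

text \<open>As \<open>sg\<close> has the values -1, 0 and 1, this is the number of columns in which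
  the two rows disagree.\<close>

definition dd :: "nat \<Rightarrow> nat \<Rightarrow> (nat \<times> nat) set \<Rightarrow> real" where
  "dd r r' G = (\<Sum>c = 1..n. (sg r r' G c)\<^sup>2)"

lemma finite_Om: "finite Om"
  using finite_bip_graphs by (simp add: Om_def)

lemma row_sum: "G \<in> Om \<Longrightarrow> r \<in> {1..m} \<Longrightarrow> (\<Sum>c = 1..n. ent G r c) = real s"
  and col_sum: "G \<in> Om \<Longrightarrow> c \<in> {1..n} \<Longrightarrow> (\<Sum>r = 1..m. ent G r c) = real t"
  by (auto simp: Om_def bip_graphs_iff_sums)

lemma flip_Om:
  assumes "G \<in> Om" "alternating r r' c c' G" "r \<in> {J<..m}" "r' \<in> {J<..m}" "c \<in> {1..n}" "c' \<in> {1..n}"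
  shows "flip r r' c c' G \<in> Om"
  using assms flip_bip_graphs[of G m n s t r r' c c'] by (auto simp: Om_def induced_def mem_flip)

text \<open>Completing the flip by the identity gives an involution of all of \<open>Om\<close> for
  full rows, so that sums over \<open>Om\<close> can be reindexed without separating the alternating
  graphs.\<close>

definition rswap :: "nat \<Rightarrow> nat \<Rightarrow> nat \<Rightarrow> nat \<Rightarrow> (nat \<times> nat) set \<Rightarrow> (nat \<times> nat) set" where
  "rswap r r' c c' G = (if alternating r r' c c' G then flip r r' c c' G else G)"

lemma rswap_rswap: "rswap r r' c c' (rswap r r' c c' G) = G"
  by (simp add: rswap_def)

lemma sg_rswap_sq: "(sg r r' (rswap r r' c c' G) x)\<^sup>2 = (sg r r' G x)\<^sup>2"
  by (cases "alternating r r' c c' G") (auto simp: rswap_def sg_def ent_def mem_flip alternating_def)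

lemma dd_rswap: "dd r r' (rswap r r' c c' G) = dd r r' G"
  by (simp add: dd_def sg_rswap_sq)

lemma sg_rswap_other: "x \<noteq> c \<Longrightarrow> x \<noteq> c' \<Longrightarrow> sg r r' (rswap r r' c c' G) x = sg r r' G x"
  by (cases "alternating r r' c c' G") (auto simp: rswap_def sg_def ent_def mem_flip)

text \<open>Equal nonzero signs mean that the rectangle is not alternating and nothing has to move;
  opposite signs are exchanged by the flip.\<close>

lemma sg_rswap_exchange:
  "sg r r' G c \<noteq> 0 \<Longrightarrow> sg r r' G c' \<noteq> 0 \<Longrightarrow> sg r r' (rswap r r' c c' G) c = sg r r' G c'"
  by (cases "alternating r r' c c' G") (auto simp: rswap_def sg_def ent_def mem_flip alternating_def split: if_splits)

lemma sum_rswap: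
  assumes "r \<in> {J<..m}" "r' \<in> {J<..m}" "c \<in> {1..n}" "c' \<in> {1..n}"
  shows "(\<Sum>G\<in>Om. X (rswap r r' c c' G)) = (\<Sum>G\<in>Om. X G :: real)"
  by (rule sum.reindex_bij_witness[of _ "rswap r r' c c'" "rswap r r' c c'"])
     (use assms flip_Om in \<open>auto simp: rswap_rswap\<close>, auto simp: rswap_def)

lemma off_rows_rswap: "off_rows r r' F \<Longrightarrow> F (rswap r r' c c' G) = F G"
  by (simp add: rswap_def off_rows_flip)

lemma sg_sum: "G \<in> Om \<Longrightarrow> r \<in> {J<..m} \<Longrightarrow> r' \<in> {J<..m} \<Longrightarrow> (\<Sum>c = 1..n. sg r r' G c) = 0"
  by (simp add: sg_def sum_subtractf row_sum)

text \<open>Both rows have \<open>s\<close> entries, so the signs sum to zero and a nonzero sign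
  cannot be alone. This makes \<open>dd r r' G - 1\<close> a legitimate denominator wherever it
  matters.\<close>

lemma dd_ge_2:
  assumes "G \<in> Om" "r \<in> {J<..m}" "r' \<in> {J<..m}" "k \<in> {1..n}" "sg r r' G k \<noteq> 0"
  shows "2 \<le> dd r r' G"
proof -
  have "(\<Sum>c = 1..n. sg r r' G c) = sg r r' G k + (\<Sum>c\<in>{1..n} - {k}. sg r r' G c)"
    using assms by (simp add: sum.remove)
  then have "\<bar>\<Sum>c\<in>{1..n} - {k}. sg r r' G c\<bar> = 1"
    using sg_sum[OF assms(1-3)] assms(5) sg_cases[of r r' G k] by auto
  moreover have "\<bar>\<Sum>c\<in>{1..n} - {k}. sg r r' G c\<bar> \<le> (\<Sum>c\<in>{1..n} - {k}. (sg r r' G c)\<^sup>2)"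
    by (rule order_trans[OF sum_abs sum_mono]) (metis abs_0 abs_1 abs_minus_cancel order_refl power2_minus power_one sg_cases zero_eq_power2)
  moreover have "dd r r' G = (sg r r' G k)\<^sup>2 + (\<Sum>c\<in>{1..n} - {k}. (sg r r' G c)\<^sup>2)"
    unfolding dd_def using assms by (simp add: sum.remove)
  moreover have "(sg r r' G k)\<^sup>2 = 1" using assms(5) sg_cases[of r r' G k] by auto
  ultimately show ?thesis by linarith
qed

text \<open>Given the other rows and the set of columns in which two full rows differ, the signs on that
  set are a uniformly random balanced vector.\<close>

lemma sum_sg_sg:
  assumes r: "r \<in> {J<..m}" "r' \<in> {J<..m}" and kl: "k \<in> {1..n}" "l \<in> {1..n}" "k \<noteq> l"
    and F: "off_rows r r' F"
  shows "(\<Sum>G\<in>Om. sg r r' G k * sg r r' G l * F G)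
       = - (\<Sum>G\<in>Om. (sg r r' G k)\<^sup>2 * (sg r r' G l)\<^sup>2 * F G / (dd r r' G - 1))"
proof -
  let ?s = "sg r r'"
  define F' where "F' G = F G / (dd r r' G - 1)" for G
  \<comment> \<open>Exchanging the signs in the columns \<open>l\<close> and \<open>x\<close>
    interchanges their roles. The factor \<open>F'\<close> is not affected, because the exchange
    preserves \<open>dd\<close> and all other rows.\<close>
  have step: "(\<Sum>G\<in>Om. ?s G k * ?s G l * (?s G x)\<^sup>2 * F' G) = (\<Sum>G\<in>Om. ?s G k * ?s G x * (?s G l)\<^sup>2 * F' G)"
    if x: "x \<in> {1..n} - {k}" for x
  proof (cases "x = l")
    case False
    have "(\<Sum>G\<in>Om. ?s G k * ?s G l * (?s G x)\<^sup>2 * F' G)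
        = (\<Sum>G\<in>Om. (\<lambda>G. ?s G k * ?s G l * (?s G x)\<^sup>2 * F' G) (rswap r r' l x G))"
      by (rule sum_rswap[OF r kl(2), symmetric]) (use x in auto)
    also have "\<dots> = (\<Sum>G\<in>Om. ?s G k * ?s G x * (?s G l)\<^sup>2 * F' G)"
    proof (rule sum.cong[OF refl])
      fix G assume "G \<in> Om"
      have 1: "?s (rswap r r' l x G) k = ?s G k" using kl x by (intro sg_rswap_other) auto
      have 2: "F' (rswap r r' l x G) = F' G"
        by (simp add: F'_def dd_rswap off_rows_rswap[OF F])
      have 3: "?s (rswap r r' l x G) l * (?s G x)\<^sup>2 = ?s G x * (?s G l)\<^sup>2"
      proof (cases "?s G l = 0 \<or> ?s G x = 0")
        case True
        then show ?thesis using sg_rswap_sq[of r r' l x G l] by auto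
      next
        case False
        then have "?s (rswap r r' l x G) l = ?s G x" by (intro sg_rswap_exchange) auto
        moreover have "(?s G l)\<^sup>2 = 1" "(?s G x)\<^sup>2 = 1"
          using False sg_cases[of r r' G l] sg_cases[of r r' G x] by auto
        ultimately show ?thesis by simp
      qed
      show "(\<lambda>G. ?s G k * ?s G l * (?s G x)\<^sup>2 * F' G) (rswap r r' l x G) = ?s G k * ?s G x * (?s G l)\<^sup>2 * F' G"
        unfolding 1 2 sg_rswap_sq using 3 by (metis (no_types, opaque_lifting) mult.assoc)
    qed
    finally show ?thesis .
  qed (simp add: algebra_simps)
  \<comment> \<open>Average over the column exchanged with \<open>l\<close>: if the rows disagree in
    \<open>k\<close>, there are exactly \<open>dd r r' G - 1\<close> further disagreements
    \<open>x\<close>.\<close>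
  have "(\<Sum>G\<in>Om. ?s G k * ?s G l * F G) = (\<Sum>G\<in>Om. \<Sum>x\<in>{1..n} - {k}. ?s G k * ?s G l * (?s G x)\<^sup>2 * F' G)"
  proof (rule sum.cong[OF refl])
    fix G assume G: "G \<in> Om"
    show "?s G k * ?s G l * F G = (\<Sum>x\<in>{1..n} - {k}. ?s G k * ?s G l * (?s G x)\<^sup>2 * F' G)"
    proof (cases "?s G k = 0")
      case False
      have "dd r r' G = (?s G k)\<^sup>2 + (\<Sum>x\<in>{1..n} - {k}. (?s G x)\<^sup>2)"
        unfolding dd_def using kl by (simp add: sum.remove)
      moreover have "(?s G k)\<^sup>2 = 1" using False sg_cases[of r r' G k] by auto
      ultimately have d: "(\<Sum>x\<in>{1..n} - {k}. (?s G x)\<^sup>2) = dd r r' G - 1" by simp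
      have "dd r r' G - 1 \<noteq> 0" using dd_ge_2[OF G r kl(1) False] by simp
      then have "F G = (\<Sum>x\<in>{1..n} - {k}. (?s G x)\<^sup>2) * F' G" unfolding d F'_def by simp
      then show ?thesis
        by (simp only: sum_distrib_left sum_distrib_right mult.assoc)
    qed simp
  qed
  also have "\<dots> = (\<Sum>x\<in>{1..n} - {k}. \<Sum>G\<in>Om. ?s G k * ?s G l * (?s G x)\<^sup>2 * F' G)"
    by (rule sum.swap)
  also have "\<dots> = (\<Sum>x\<in>{1..n} - {k}. \<Sum>G\<in>Om. ?s G k * ?s G x * (?s G l)\<^sup>2 * F' G)"
    by (rule sum.cong[OF refl step])
  also have "\<dots> = (\<Sum>G\<in>Om. \<Sum>x\<in>{1..n} - {k}. ?s G k * ?s G x * (?s G l)\<^sup>2 * F' G)"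
    by (rule sum.swap)
  also have "\<dots> = (\<Sum>G\<in>Om. - ((?s G k)\<^sup>2 * (?s G l)\<^sup>2 * F G / (dd r r' G - 1)))"
  proof (rule sum.cong[OF refl])
    fix G assume G: "G \<in> Om"
    \<comment> \<open>The signs sum to zero, so those outside \<open>k\<close> sum to minus the sign
      at \<open>k\<close>. This is the source of the negative covariance.\<close>
    have "(\<Sum>x\<in>{1..n} - {k}. ?s G x) = - ?s G k"
      using sg_sum[OF G r] kl by (simp add: sum.remove)
    moreover have "(\<Sum>x\<in>{1..n} - {k}. ?s G k * ?s G x * (?s G l)\<^sup>2 * F' G)
        = ?s G k * (?s G l)\<^sup>2 * F' G * (\<Sum>x\<in>{1..n} - {k}. ?s G x)"
      by (simp add: sum_distrib_left mult_ac)
    ultimately show "(\<Sum>x\<in>{1..n} - {k}. ?s G k * ?s G x * (?s G l)\<^sup>2 * F' G)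
        = - ((?s G k)\<^sup>2 * (?s G l)\<^sup>2 * F G / (dd r r' G - 1))"
      by (simp add: F'_def power2_eq_square)
  qed
  finally show ?thesis by (simp add: sum_negf)
qed

end

section \<open>Second moments\<close>

lemma square_sum_off_diagonal:
  fixes a :: "nat \<Rightarrow> real"
  assumes "finite A"
  shows "(\<Sum>x\<in>A. a x)\<^sup>2 = (\<Sum>x\<in>A. (a x)\<^sup>2) + (\<Sum>x\<in>A. \<Sum>y\<in>A - {x}. a x * a y)"
proof -
  have "(\<Sum>x\<in>A. a x)\<^sup>2 = (\<Sum>x\<in>A. \<Sum>y\<in>A. a x * a y)"
    by (simp add: power2_eq_square sum_product)
  also have "\<dots> = (\<Sum>x\<in>A. (a x)\<^sup>2 + (\<Sum>y\<in>A - {x}. a x * a y))"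
    by (rule sum.cong[OF refl]) (use assms in \<open>simp add: sum.remove power2_eq_square\<close>)
  finally show ?thesis by (simp add: sum.distrib)
qed

lemma sum_sum_diff_mult:
  fixes a b :: "nat \<Rightarrow> real"
  shows "(\<Sum>x\<in>A. \<Sum>y\<in>A. (a x - a y) * (b x - b y))
    = 2 * real (card A) * (\<Sum>x\<in>A. a x * b x) - 2 * (\<Sum>x\<in>A. a x) * (\<Sum>x\<in>A. b x)"
proof -
  have "(\<Sum>x\<in>A. \<Sum>y\<in>A. (a x - a y) * (b x - b y))
    = (\<Sum>x\<in>A. \<Sum>y\<in>A. a x * b x) + (\<Sum>x\<in>A. \<Sum>y\<in>A. a y * b y)
      - (\<Sum>x\<in>A. \<Sum>y\<in>A. a x * b y) - (\<Sum>x\<in>A. \<Sum>y\<in>A. a y * b x)"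
    by (simp add: algebra_simps sum.distrib sum_subtractf)
  moreover have "(\<Sum>x\<in>A. \<Sum>y\<in>A. a x * b y) = (\<Sum>x\<in>A. a x) * (\<Sum>x\<in>A. b x)"
    by (simp add: sum_product)
  moreover have "(\<Sum>x\<in>A. \<Sum>y\<in>A. a y * b x) = (\<Sum>x\<in>A. a x) * (\<Sum>x\<in>A. b x)"
    by (subst sum.swap) (simp add: sum_product)
  ultimately show ?thesis by (simp add: sum_distrib_left[symmetric])
qed

lemma sum_swap3:
  "(\<Sum>G\<in>U. \<Sum>x\<in>A. \<Sum>y\<in>B x. f G x y) = (\<Sum>x\<in>A. \<Sum>y\<in>B x. \<Sum>G\<in>U. f G x y :: real)"
  by (subst sum.swap, rule sum.cong[OF refl], rule sum.swap)

lemma sum_split_interval: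
  fixes f :: "nat \<Rightarrow> real"
  assumes "k < l"
  shows "sum f {1..l} = sum f {1..k} + sum f {k<..l}"
proof -
  have "{1..l} = {1..k} \<union> {k<..l}" using assms by auto
  moreover have "sum f ({1..k} \<union> {k<..l}) = sum f {1..k} + sum f {k<..l}"
    by (rule sum.union_disjoint) auto
  ultimately show ?thesis by metis
qed

context bip_ext
begin

text \<open>The diagonal of the expanded square contributes at most \<open>n\<close>. Off the
  diagonal, \<open>sum_sg_sg\<close> produces minus a square divided by d-1, which may be dropped,
  plus a compensation for the missing diagonal of at most \<open>n\<close>.\<close>

lemma second_moment_sg:
  assumes r: "r \<in> {J<..m}" "r' \<in> {J<..m}"
    and w: "\<And>c. off_rows r r' (\<lambda>G. w G c)" and w1: "\<And>G c. G \<in> Om \<Longrightarrow> \<bar>w G c\<bar> \<le> 1"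
  shows "(\<Sum>G\<in>Om. (\<Sum>c = 1..n. w G c * sg r r' G c)\<^sup>2) \<le> 2 * real n * M"
proof -
  let ?s = "sg r r'" and ?d = "dd r r'"
  have ww: "off_rows r r' (\<lambda>G. w G c * w G c')" for c c'
    using w[of c] w[of c'] unfolding off_rows_def by metis
  have "(\<Sum>G\<in>Om. (\<Sum>c = 1..n. w G c * ?s G c)\<^sup>2)
     = (\<Sum>G\<in>Om. \<Sum>c = 1..n. (w G c * ?s G c)\<^sup>2)
       + (\<Sum>G\<in>Om. \<Sum>c = 1..n. \<Sum>c'\<in>{1..n} - {c}. ?s G c * ?s G c' * (w G c * w G c'))"
    by (subst square_sum_off_diagonal) (simp_all add: sum.distrib mult_ac)
  also have "(\<Sum>G\<in>Om. \<Sum>c = 1..n. \<Sum>c'\<in>{1..n} - {c}. ?s G c * ?s G c' * (w G c * w G c'))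
     = (\<Sum>c = 1..n. \<Sum>c'\<in>{1..n} - {c}. \<Sum>G\<in>Om. ?s G c * ?s G c' * (w G c * w G c'))"
    by (rule sum_swap3)
  also have "\<dots> = (\<Sum>c = 1..n. \<Sum>c'\<in>{1..n} - {c}. \<Sum>G\<in>Om.
       - ((?s G c)\<^sup>2 * (?s G c')\<^sup>2 * (w G c * w G c') / (?d G - 1)))"
  proof (rule sum.cong[OF refl], rule sum.cong[OF refl])
    fix c c' assume c: "c \<in> {1..n}" "c' \<in> {1..n} - {c}"
    then show "(\<Sum>G\<in>Om. ?s G c * ?s G c' * (w G c * w G c'))
       = (\<Sum>G\<in>Om. - ((?s G c)\<^sup>2 * (?s G c')\<^sup>2 * (w G c * w G c') / (?d G - 1)))"
      using sum_sg_sg[OF r _ _ _ ww[of c c']] by (simp add: sum_negf)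
  qed
  also have "\<dots> = (\<Sum>G\<in>Om. \<Sum>c = 1..n. \<Sum>c'\<in>{1..n} - {c}.
       - ((?s G c)\<^sup>2 * (?s G c')\<^sup>2 * (w G c * w G c') / (?d G - 1)))"
    by (rule sum_swap3[symmetric])
  also have "(\<Sum>G\<in>Om. \<Sum>c = 1..n. (w G c * ?s G c)\<^sup>2) + \<dots>
     = (\<Sum>G\<in>Om. (\<Sum>c = 1..n. (w G c * ?s G c)\<^sup>2) + (\<Sum>c = 1..n. \<Sum>c'\<in>{1..n} - {c}.
       - ((?s G c)\<^sup>2 * (?s G c')\<^sup>2 * (w G c * w G c') / (?d G - 1))))"
    by (rule sum.distrib[symmetric])
  also have "\<dots> \<le> (\<Sum>G\<in>Om. 2 * real n)"
  proof (rule sum_mono)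
    fix G assume G: "G \<in> Om"
    define q where "q = (\<Sum>c = 1..n. (w G c * (?s G c)\<^sup>2)\<^sup>2)"
    have bound: "(w G c * ?s G c)\<^sup>2 \<le> 1 \<and> (w G c * (?s G c)\<^sup>2)\<^sup>2 \<le> 1" for c
      using sg_cases[of r r' G c] w1[OF G, of c] by (auto simp: abs_square_le_1)
    have q: "0 \<le> q" "q \<le> real n" unfolding q_def
      using sum_mono[of "{1..n}" "\<lambda>c. (w G c * (?s G c)\<^sup>2)\<^sup>2" "\<lambda>_. 1"] bound by (auto intro!: sum_nonneg)
    have p: "(\<Sum>c = 1..n. (w G c * ?s G c)\<^sup>2) \<le> real n"
      using sum_mono[of "{1..n}" "\<lambda>c. (w G c * ?s G c)\<^sup>2" "\<lambda>_. 1"] bound by auto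
    have e: "(\<Sum>c = 1..n. \<Sum>c'\<in>{1..n} - {c}. - ((?s G c)\<^sup>2 * (?s G c')\<^sup>2 * (w G c * w G c') / (?d G - 1)))
       = - (((\<Sum>c = 1..n. w G c * (?s G c)\<^sup>2)\<^sup>2 - q) / (?d G - 1))"
      unfolding q_def
      by (subst square_sum_off_diagonal) (simp_all add: sum_negf sum_divide_distrib mult_ac)
    show "(\<Sum>c = 1..n. (w G c * ?s G c)\<^sup>2) + (\<Sum>c = 1..n. \<Sum>c'\<in>{1..n} - {c}.
       - ((?s G c)\<^sup>2 * (?s G c')\<^sup>2 * (w G c * w G c') / (?d G - 1))) \<le> 2 * real n"
    proof (cases "\<exists>k\<in>{1..n}. ?s G k \<noteq> 0")
      case True
      then have d: "2 \<le> ?d G" using dd_ge_2[OF G r] by blast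
      have "- (((\<Sum>c = 1..n. w G c * (?s G c)\<^sup>2)\<^sup>2 - q) / (?d G - 1)) \<le> q / (?d G - 1)"
        using d by (simp add: diff_divide_distrib)
      also have "\<dots> \<le> q / 1" using d q by (intro divide_left_mono) auto
      finally show ?thesis using p q e by linarith
    next
      case False
      then have z: "\<And>c. c \<in> {1..n} \<Longrightarrow> ?s G c = 0" by auto
      show ?thesis using p unfolding e q_def by (simp add: z)
    qed
  qed
  finally show ?thesis by (simp add: mult_ac)
qed

text \<open>The squared distance to \<open>B\<close> splits into the squared differences between
  pairs of rows, bounded by \<open>second_moment_sg\<close>, and the squared error of the average
  over rows. In the applications that average is almost determined by the column sums.\<close>

lemma concentration_rows:
  fixes w :: "(nat \<times> nat) set \<Rightarrow> nat \<Rightarrow> real" and B :: "(nat \<times> nat) set \<Rightarrow> real"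
  assumes R': "R' \<subseteq> {J<..m}" "R' \<noteq> {}"
    and w: "\<And>r r' c. r \<in> R' \<Longrightarrow> r' \<in> R' \<Longrightarrow> off_rows r r' (\<lambda>G. w G c)"
    and w1: "\<And>G c. G \<in> Om \<Longrightarrow> \<bar>w G c\<bar> \<le> 1"
  defines "A \<equiv> \<lambda>G r. \<Sum>c = 1..n. w G c * ent G r c"
  shows "(\<Sum>r\<in>R'. \<Sum>G\<in>Om. (A G r - B G)\<^sup>2)
    \<le> 2 * real (card R') * real n * M + 2 * real (card R') * (\<Sum>G\<in>Om. ((\<Sum>r\<in>R'. A G r) / real (card R') - B G)\<^sup>2)"
proof -
  let ?N = "real (card R')"
  have fin: "finite R'" using R' finite_subset by blast
  then have N: "?N > 0" using R' by (simp add: card_gt_0_iff)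
  have pair: "(\<Sum>G\<in>Om. (A G r - A G r')\<^sup>2) \<le> 2 * real n * M" if "r \<in> R'" "r' \<in> R'" for r r'
  proof -
    have "A G r - A G r' = (\<Sum>c = 1..n. w G c * sg r r' G c)" for G
      by (simp add: A_def sg_def algebra_simps sum_subtractf)
    moreover have "r \<in> {J<..m}" "r' \<in> {J<..m}" using that R' by blast+
    ultimately show ?thesis using second_moment_sg[of r r' w] w[OF that] w1 by simp
  qed
  have dev: "?N * (\<Sum>r\<in>R'. (A G r - B G)\<^sup>2)
    \<le> (\<Sum>r\<in>R'. \<Sum>r'\<in>R'. (A G r - A G r')\<^sup>2) + 2 * ?N\<^sup>2 * ((\<Sum>r\<in>R'. A G r) / ?N - B G)\<^sup>2" for G
  proof -
    define a where "a r = A G r - B G" for r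
    define \<sigma> where "\<sigma> = (\<Sum>r\<in>R'. a r)"
    have "(\<Sum>r\<in>R'. A G r) = \<sigma> + ?N * B G" by (simp add: \<sigma>_def a_def sum_subtractf)
    then have 1: "(\<Sum>r\<in>R'. A G r) / ?N - B G = \<sigma> / ?N" using N by (simp add: field_simps)
    have "(\<Sum>r\<in>R'. \<Sum>r'\<in>R'. (A G r - A G r')\<^sup>2) = (\<Sum>r\<in>R'. \<Sum>r'\<in>R'. (a r - a r') * (a r - a r'))"
      by (simp add: a_def power2_eq_square)
    also have "\<dots> = 2 * ?N * (\<Sum>r\<in>R'. (a r)\<^sup>2) - 2 * \<sigma>\<^sup>2"
      unfolding sum_sum_diff_mult \<sigma>_def by (simp add: power2_eq_square)
    finally have 2: "(\<Sum>r\<in>R'. \<Sum>r'\<in>R'. (A G r - A G r')\<^sup>2) = 2 * ?N * (\<Sum>r\<in>R'. (a r)\<^sup>2) - 2 * \<sigma>\<^sup>2" .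
    have 3: "2 * ?N\<^sup>2 * (\<sigma> / ?N)\<^sup>2 = 2 * \<sigma>\<^sup>2" using N by (simp add: power_divide)
    have "0 \<le> ?N * (\<Sum>r\<in>R'. (a r)\<^sup>2)" by (simp add: sum_nonneg)
    then show ?thesis unfolding 1 2 3 a_def[symmetric] by simp
  qed
  have "?N * (\<Sum>r\<in>R'. \<Sum>G\<in>Om. (A G r - B G)\<^sup>2) = (\<Sum>G\<in>Om. ?N * (\<Sum>r\<in>R'. (A G r - B G)\<^sup>2))"
    by (subst sum.swap) (simp add: sum_distrib_left)
  also have "\<dots> \<le> (\<Sum>G\<in>Om. (\<Sum>r\<in>R'. \<Sum>r'\<in>R'. (A G r - A G r')\<^sup>2) + 2 * ?N\<^sup>2 * ((\<Sum>r\<in>R'. A G r) / ?N - B G)\<^sup>2)"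
    by (rule sum_mono[OF dev])
  also have "\<dots> = (\<Sum>r\<in>R'. \<Sum>r'\<in>R'. \<Sum>G\<in>Om. (A G r - A G r')\<^sup>2) + 2 * ?N\<^sup>2 * (\<Sum>G\<in>Om. ((\<Sum>r\<in>R'. A G r) / ?N - B G)\<^sup>2)"
    by (simp only: sum.distrib sum_distrib_left sum_swap3[of _ "\<lambda>_. R'" R' Om])
  also have "(\<Sum>r\<in>R'. \<Sum>r'\<in>R'. \<Sum>G\<in>Om. (A G r - A G r')\<^sup>2) \<le> (\<Sum>r\<in>R'. \<Sum>r'\<in>R'. 2 * real n * M)"
    by (intro sum_mono pair)
  also have "\<dots> = ?N * (2 * ?N * real n * M)" by simp
  finally have "?N * (\<Sum>r\<in>R'. \<Sum>G\<in>Om. (A G r - B G)\<^sup>2)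
    \<le> ?N * (2 * ?N * real n * M + 2 * ?N * (\<Sum>G\<in>Om. ((\<Sum>r\<in>R'. A G r) / ?N - B G)\<^sup>2))"
    by (simp add: algebra_simps power2_eq_square)
  then show ?thesis using N by simp
qed

section \<open>Exact densities of the blocks outside the corner, and centred entries\<close>

definition p :: "nat \<Rightarrow> real" where "p k = (real t - real (degV H k)) / (real m - real J)"
definition q :: "nat \<Rightarrow> real" where "q j = (real s - real (degU H j)) / (real n - real K)"
text \<open>The density of the block of rows > \<open>J\<close> and columns > \<open>K\<close>. Its
  numerator is the number of all edges minus those in the first \<open>J\<close> rows and the first
  \<open>K\<close> columns, with the corner, subtracted twice, added back.\<close>

definition rho :: real where
  "rho = (real m * real s - real J * real s - real K * real t + real (card H)) / ((real m - real J) * (real n - real K))"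
text \<open>The block densities are the same for all graphs in \<open>Om\<close>, so the sums of
  \<open>al\<close>, \<open>be\<close> and \<open>ga\<close> over their blocks vanish for each
  single graph and not only on average.\<close>

definition al :: "nat \<Rightarrow> (nat \<times> nat) set \<Rightarrow> nat \<Rightarrow> real" where "al j G c = ent G j c - q j"
definition be :: "nat \<Rightarrow> (nat \<times> nat) set \<Rightarrow> nat \<Rightarrow> real" where "be k G r = ent G r k - p k"
definition ga :: "(nat \<times> nat) set \<Rightarrow> nat \<Rightarrow> nat \<Rightarrow> real" where "ga G r c = ent G r c - rho"

lemma ent_corner: "G \<in> Om \<Longrightarrow> j \<in> {1..J} \<Longrightarrow> k \<in> {1..K} \<Longrightarrow> ent G j k = ent H j k"
  by (auto simp: Om_def induced_def ent_def)

lemma row_sum_C: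
  assumes "G \<in> Om" "j \<in> {1..J}"
  shows "(\<Sum>c\<in>{K<..n}. ent G j c) = real s - real (degU H j)"
proof -
  have "(\<Sum>c = 1..n. ent G j c) = (\<Sum>c = 1..K. ent G j c) + (\<Sum>c\<in>{K<..n}. ent G j c)"
    by (rule sum_split_interval[OF K_less])
  moreover have "(\<Sum>c = 1..K. ent G j c) = real (degU H j)"
    unfolding degU_eq_sum[OF H_sub] using ent_corner[OF assms] by simp
  ultimately show ?thesis using row_sum[OF assms(1), of j] assms J_less by simp
qed

lemma col_sum_R:
  assumes "G \<in> Om" "k \<in> {1..K}"
  shows "(\<Sum>r\<in>{J<..m}. ent G r k) = real t - real (degV H k)"
proof -
  have "(\<Sum>r = 1..m. ent G r k) = (\<Sum>r = 1..J. ent G r k) + (\<Sum>r\<in>{J<..m}. ent G r k)"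
    by (rule sum_split_interval[OF J_less])
  moreover have "(\<Sum>r = 1..J. ent G r k) = real (degV H k)"
    unfolding degV_eq_sum[OF H_sub] using ent_corner[OF assms(1) _ assms(2)] by simp
  ultimately show ?thesis using col_sum[OF assms(1), of k] assms K_less by simp
qed

lemma card_R: "real (card {J<..m}) = real m - real J" and card_C: "real (card {K<..n}) = real n - real K"
  using J_less K_less by auto

lemma al_sum: "G \<in> Om \<Longrightarrow> j \<in> {1..J} \<Longrightarrow> (\<Sum>c\<in>{K<..n}. al j G c) = 0"
  using K_less by (simp add: al_def sum_subtractf row_sum_C q_def)

lemma be_sum: "G \<in> Om \<Longrightarrow> k \<in> {1..K} \<Longrightarrow> (\<Sum>r\<in>{J<..m}. be k G r) = 0"
  using J_less by (simp add: be_def sum_subtractf col_sum_R p_def)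

lemma q_range: assumes "G \<in> Om" "j \<in> {1..J}" shows "0 \<le> q j" "q j \<le> 1"
proof -
  have "q j = (\<Sum>c\<in>{K<..n}. ent G j c) / (real n - real K)" by (simp add: q_def row_sum_C[OF assms])
  moreover have "0 \<le> (\<Sum>c\<in>{K<..n}. ent G j c)" by (intro sum_nonneg ent_range)
  moreover have "(\<Sum>c\<in>{K<..n}. ent G j c) \<le> (\<Sum>c\<in>{K<..n}. 1)" by (intro sum_mono ent_range)
  ultimately show "0 \<le> q j" "q j \<le> 1" using K_less by (auto simp: divide_le_eq)
qed

lemma al_bound: "G \<in> Om \<Longrightarrow> j \<in> {1..J} \<Longrightarrow> \<bar>al j G c\<bar> \<le> 1"
  using q_range[of G j] ent_range[of G j c] unfolding al_def by (auto simp: abs_le_iff)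

lemma card_H_eq: "real (card H) = (\<Sum>j = 1..J. \<Sum>k = 1..K. ent H j k)"
proof -
  have "(\<Sum>j = 1..J. \<Sum>k = 1..K. ent H j k) = (\<Sum>x\<in>{1..J} \<times> {1..K}. of_bool (x \<in> H))"
    unfolding sum.cartesian_product ent_def by (rule sum.cong) auto
  also have "\<dots> = real (card (({1..J} \<times> {1..K}) \<inter> H))" by simp
  also have "({1..J} \<times> {1..K}) \<inter> H = H" using H_sub by blast
  finally show ?thesis by simp
qed

lemma ga_sum:
  assumes G: "G \<in> Om"
  shows "(\<Sum>r\<in>{J<..m}. \<Sum>c\<in>{K<..n}. ga G r c) = 0"
proof -
  have "(\<Sum>r\<in>{J<..m}. \<Sum>c\<in>{K<..n}. ent G r c) = (\<Sum>r\<in>{J<..m}. real s - (\<Sum>c = 1..K. ent G r c))"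
  proof (rule sum.cong[OF refl])
    fix r assume "r \<in> {J<..m}"
    then have "(\<Sum>c = 1..n. ent G r c) = real s" using row_sum[OF G] by simp
    then show "(\<Sum>c\<in>{K<..n}. ent G r c) = real s - (\<Sum>c = 1..K. ent G r c)"
      unfolding sum_split_interval[OF K_less] by simp
  qed
  also have "\<dots> = (real m - real J) * real s - (\<Sum>c = 1..K. \<Sum>r\<in>{J<..m}. ent G r c)"
    using J_less by (subst sum.swap) (simp add: sum_subtractf)
  also have "(\<Sum>c = 1..K. \<Sum>r\<in>{J<..m}. ent G r c) = (\<Sum>c = 1..K. real t - real (degV H c))"
    using col_sum_R[OF G] by simp
  also have "\<dots> = real K * real t - real (card H)"
    unfolding card_H_eq degV_eq_sum[OF H_sub] sum_subtractf sum.swap[of "\<lambda>c r. ent H r c" "{1..J}"] by simp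
  finally have "(\<Sum>r\<in>{J<..m}. \<Sum>c\<in>{K<..n}. ent G r c)
    = real m * real s - real J * real s - real K * real t + real (card H)"
    by (simp add: algebra_simps)
  also have "\<dots> = (real m - real J) * (real n - real K) * rho"
    using J_less K_less by (simp add: rho_def)
  finally have "(\<Sum>r\<in>{J<..m}. \<Sum>c\<in>{K<..n}. ent G r c) = (real m - real J) * (real n - real K) * rho" .
  then show ?thesis
    using J_less K_less by (simp add: ga_def sum_subtractf)
qed

end

lemma abs_divide_diff_le:
  fixes N :: real
  assumes "0 < N" "\<bar>S - B * N\<bar> \<le> X"
  shows "\<bar>S / N - B\<bar> \<le> X / N"
proof -
  have "S / N - B = (S - B * N) / N" using assms by (simp add: diff_divide_distrib)
  then have "\<bar>S / N - B\<bar> = \<bar>S - B * N\<bar> / N" using assms by simp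
  then show ?thesis using assms by (simp add: divide_right_mono)
qed

text \<open>\<open>L\<close> will be a small power of \<open>n\<close>; powers of it absorb constants, logarithms and the imbalance
  between \<open>m\<close> and \<open>n\<close>, so that no attempt is made to keep exponents small.\<close>

locale bip_bounds = bip_ext +
  fixes L :: real
  assumes ms: "m * s = n * t" and L2: "2 \<le> L" and mL: "real m \<le> L * real n" and nL: "real n \<le> L * real m"
    and Jn: "(real J)\<^sup>2 \<le> L * real n" and Jm: "(real J)\<^sup>2 \<le> L * real m"
    and Kn: "(real K)\<^sup>2 \<le> L * real n" and Km: "(real K)\<^sup>2 \<le> L * real m"
    and vL: "1 \<le> L * (lam n s * (1 - lam n s))" and bign: "L ^ 5 \<le> real n" and bigm: "L ^ 5 \<le> real m"
begin

abbreviation "m' \<equiv> real m - real J"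
abbreviation "n' \<equiv> real n - real K"
abbreviation "lm \<equiv> lam n s"
abbreviation "v \<equiv> lm * (1 - lm)"

lemma Lpow: "2 ^ i \<le> L ^ i" using L2 by (intro power_mono) auto

lemma L_large: "16 * L \<le> real m" "16 * L \<le> real n" "32 \<le> real m" "32 \<le> real n"
proof -
  have "16 * L \<le> L ^ 4 * L" using Lpow[of 4] L2 by (intro mult_right_mono) auto
  also have "\<dots> = L ^ 5" using power_add[of L 4 1] by simp
  finally show "16 * L \<le> real m" "16 * L \<le> real n" using bign bigm by auto
  then show "32 \<le> real m" "32 \<le> real n" using L2 by auto
qed

lemma quarter_aux:
  assumes "x\<^sup>2 \<le> L * y" "16 * L \<le> y" "0 \<le> y" shows "x \<le> y / 4"
proof (rule power2_le_imp_le)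
  have "16 * L * y \<le> y * y" using assms by (intro mult_right_mono) auto
  then show "x\<^sup>2 \<le> (y / 4)\<^sup>2" using assms by (simp add: power2_eq_square)
qed (use assms in simp)

lemma J_quarter: "real J \<le> real m / 4" and K_quarter: "real K \<le> real n / 4"
  using quarter_aux[OF Jm] quarter_aux[OF Kn] L_large by auto

lemma lm_s: "real s = lm * real n" and lm_t: "real t = lm * real m"
proof -
  show "real s = lm * real n" using K_less by (simp add: lam_def)
  have "real n * real t = real m * real s" unfolding of_nat_mult[symmetric] ms ..
  then have "real t = real m * real s / real n" using K_less by (simp add: nonzero_eq_divide_eq mult.commute)
  then show "real t = lm * real m" by (simp add: lam_def)
qed

lemma v_pos: "v > 0"
proof (rule ccontr)
  assume "\<not> v > 0"
  then have "L * v \<le> 0" using L2 mult_nonneg_nonpos[of L v] by linarith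
  then show False using vL by linarith
qed

lemma lm_pos: "0 < lm"
proof -
  have "lm \<noteq> 0" using v_pos by auto
  moreover have "0 \<le> lm" by (simp add: lam_def)
  ultimately show ?thesis by simp
qed

lemma lm_less_1: "lm < 1" using v_pos lm_pos by (simp add: zero_less_mult_iff)
lemma v_inv: "1 / v \<le> L" using vL v_pos by (simp only: divide_le_eq mult.commute if_True)
lemma t_le: "real t \<le> real m"
  unfolding lm_t using lm_less_1 lm_pos by (intro mult_left_le_one_le) auto

lemma s_le: "real s \<le> real n"
  unfolding lm_s using lm_less_1 lm_pos by (intro mult_left_le_one_le) auto

lemma Jp1_sq: "(real J + 1)\<^sup>2 \<le> 4 * L * real n"
proof -
  have "(real J + 1)\<^sup>2 \<le> 2 * (real J)\<^sup>2 + 2" using sum_squares_bound[of "real J" 1] by (simp add: power2_sum)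
  moreover have "2 \<le> 2 * L * real n" using L2 L_large mult_mono[of 1 L 1 "real n"] by auto
  ultimately show ?thesis using Jn by linarith
qed


lemma L_absorb: "2 ^ i * L ^ j \<le> L ^ (i + j)"
  unfolding power_add using Lpow[of i] L2 by (intro mult_right_mono) auto

lemma L_mono: "i \<le> j \<Longrightarrow> L ^ i \<le> L ^ j"
  using L2 by (intro power_increasing) auto

lemma L_ge_1: "1 \<le> L ^ i" using L_mono[of 0 i] by simp

text \<open>Over all rows the double sum would be exactly \<open>t\<close> times the total weight,
  because the columns have sum \<open>t\<close>. Each row missing from \<open>R'\<close> changes it
  by at most \<open>n\<close>. This provides the row average that \<open>concentration_rows\<close>
  asks for.\<close>

lemma sum_rows_weighted:
  assumes G: "G \<in> Om" and R': "R' \<subseteq> {J<..m}" and w1: "\<And>c. \<bar>w c\<bar> \<le> 1"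
  shows "\<bar>(\<Sum>r\<in>R'. \<Sum>c = 1..n. w c * ent G r c) - real t * (\<Sum>c = 1..n. w c)\<bar>
    \<le> real n * real (card ({1..m} - R'))"
proof -
  have R'm: "R' \<subseteq> {1..m}" using R' by auto
  have "(\<Sum>r\<in>R'. \<Sum>c = 1..n. w c * ent G r c) = (\<Sum>c = 1..n. w c * (\<Sum>r\<in>R'. ent G r c))"
    by (subst sum.swap) (simp add: sum_distrib_left)
  also have "\<dots> = (\<Sum>c = 1..n. w c * (real t - (\<Sum>r\<in>{1..m} - R'. ent G r c)))"
  proof (rule sum.cong[OF refl])
    fix c assume c: "c \<in> {1..n}"
    have "(\<Sum>r\<in>{1..m} - R'. ent G r c) = (\<Sum>r = 1..m. ent G r c) - (\<Sum>r\<in>R'. ent G r c)"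
      using R'm by (intro sum_diff) auto
    then show "w c * (\<Sum>r\<in>R'. ent G r c) = w c * (real t - (\<Sum>r\<in>{1..m} - R'. ent G r c))"
      using col_sum[OF G c] by simp
  qed
  also have "\<dots> = real t * (\<Sum>c = 1..n. w c) - (\<Sum>c = 1..n. \<Sum>r\<in>{1..m} - R'. w c * ent G r c)"
    by (simp add: right_diff_distrib sum_subtractf sum_distrib_left mult.commute)
  finally have "(\<Sum>r\<in>R'. \<Sum>c = 1..n. w c * ent G r c) - real t * (\<Sum>c = 1..n. w c)
    = - (\<Sum>c = 1..n. \<Sum>r\<in>{1..m} - R'. w c * ent G r c)" by simp
  moreover have "\<bar>\<Sum>c = 1..n. \<Sum>r\<in>{1..m} - R'. w c * ent G r c\<bar> \<le> (\<Sum>c = 1..n. \<Sum>r\<in>{1..m} - R'. 1)"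
  proof (rule order_trans[OF sum_abs sum_mono], rule order_trans[OF sum_abs sum_mono])
    fix c r show "\<bar>w c * ent G r c\<bar> \<le> 1"
      using w1[of c] by (auto simp: ent_def)
  qed
  ultimately show ?thesis by simp
qed

lemma card_compl_R: "real (card ({1..m} - {J<..m})) = real J"
  and card_R_minus: "r \<in> {J<..m} \<Longrightarrow> real (card ({J<..m} - {r})) = m' - 1"
  and card_compl_R_minus: "r \<in> {J<..m} \<Longrightarrow> real (card ({1..m} - ({J<..m} - {r}))) = real J + 1"
proof -
  have "{1..m} - {J<..m} = {1..J}" using J_less by auto
  then show "real (card ({1..m} - {J<..m})) = real J" by simp
  assume r: "r \<in> {J<..m}"
  then show "real (card ({J<..m} - {r})) = m' - 1" using J_less by (simp add: card_Diff_singleton of_nat_diff)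
  have "{1..m} - ({J<..m} - {r}) = insert r {1..J}" using J_less r by auto
  then show "real (card ({1..m} - ({J<..m} - {r}))) = real J + 1" using r by simp
qed

lemma m'_half: "real m / 2 \<le> m' - 1" "real n / 2 \<le> n' - 1"
  using J_quarter K_quarter L_large by auto

text \<open>The number of common neighbours of two rows. For fixed \<open>r'\<close> it is linear in
  the row \<open>r\<close>, so that \<open>concentration_rows\<close> applies, and it determines
  \<open>dd\<close>.\<close>

definition cod :: "nat \<Rightarrow> nat \<Rightarrow> (nat \<times> nat) set \<Rightarrow> real" where
  "cod r r' G = (\<Sum>c = 1..n. ent G r' c * ent G r c)"

lemma dd_cod:
  assumes "G \<in> Om" "r \<in> {J<..m}" "r' \<in> {J<..m}"
  shows "dd r r' G = 2 * real s - 2 * cod r r' G"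
proof -
  have "dd r r' G = (\<Sum>c = 1..n. ent G r c + ent G r' c - 2 * (ent G r' c * ent G r c))"
    unfolding dd_def sg_def by (rule sum.cong) (auto simp: ent_def)
  also have "\<dots> = (\<Sum>c = 1..n. ent G r c) + (\<Sum>c = 1..n. ent G r' c) - 2 * cod r r' G"
    by (simp add: sum_subtractf sum.distrib cod_def sum_distrib_left)
  finally show ?thesis using row_sum[OF assms(1)] assms by simp
qed

lemma rest_ratio: "real n * (real J + 1) / (m' - 1) \<le> 2 * L * (real J + 1)"
proof -
  have "real n * (real J + 1) \<le> L * real m * (real J + 1)" using nL by (intro mult_right_mono) auto
  also have "\<dots> \<le> L * (2 * (m' - 1)) * (real J + 1)"
    using m'_half L2 by (intro mult_right_mono mult_left_mono) auto
  finally have "real n * (real J + 1) \<le> 2 * L * (real J + 1) * (m' - 1)" by (simp only: mult_ac)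
  moreover have "0 < m' - 1" using m'_half L_large by linarith
  ultimately show ?thesis by (simp only: pos_divide_le_eq)
qed

lemma rest_sq: "(2 * L * (real J + 1))\<^sup>2 \<le> 16 * L ^ 3 * real n"
proof -
  have "(2 * L * (real J + 1))\<^sup>2 = 4 * L\<^sup>2 * (real J + 1)\<^sup>2" by (simp add: power_mult_distrib)
  also have "\<dots> \<le> 4 * L\<^sup>2 * (4 * L * real n)" using Jp1_sq by (intro mult_left_mono) auto
  also have "\<dots> = 16 * L ^ 3 * real n" by (simp add: power2_eq_square power3_eq_cube)
  finally show ?thesis .
qed

text \<open>The entries of row \<open>r'\<close> serve as weights, which is allowed for pairs of
  rows that avoid \<open>r'\<close>. The target is the mean codegree: \<open>t * s\<close>
  incidences spread over \<open>m\<close> rows, that is \<open>lm * s\<close> for each.\<close>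

lemma cod_concentration_row:
  assumes r': "r' \<in> {J<..m}"
  shows "(\<Sum>r\<in>{J<..m} - {r'}. \<Sum>G\<in>Om. (cod r r' G - lm * real s)\<^sup>2) \<le> m' * (real n * M * L ^ 9)"
proof -
  let ?R = "{J<..m} - {r'}"
  have N: "real (card ?R) = m' - 1" and X: "real (card ({1..m} - ?R)) = real J + 1"
    using card_R_minus card_compl_R_minus r' by auto
  have N0: "0 < m' - 1" using m'_half L_large by linarith
  have ne: "?R \<noteq> {}" using N N0 by force
  have avg: "((\<Sum>r\<in>?R. cod r r' G) / real (card ?R) - lm * real s)\<^sup>2 \<le> 16 * L ^ 3 * real n" if G: "G \<in> Om" for G
  proof -
    let ?S = "\<Sum>r\<in>?R. cod r r' G"
    have "\<bar>ent G r' c\<bar> \<le> 1" for c using ent_range[of G r' c] by simp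
    then have "\<bar>(\<Sum>r\<in>?R. \<Sum>c = 1..n. ent G r' c * ent G r c) - real t * (\<Sum>c = 1..n. ent G r' c)\<bar>
      \<le> real n * real (card ({1..m} - ?R))"
      by (intro sum_rows_weighted[OF G]) auto
    then have 1: "\<bar>?S - real t * real s\<bar> \<le> real n * (real J + 1)"
      using X row_sum[OF G, of r'] r' by (simp add: cod_def)
    have ts: "real t * real s = lm * real s * (m' - 1) + lm * real s * (real J + 1)"
      by (simp add: lm_t algebra_simps)
    \<comment> \<open>A one-sided bound: the deviation from the target is a nonpositive plus a
      nonnegative term, each of size at most n(J+1), so the two errors need not be added.\<close>
    have S_le: "?S \<le> real t * real s"
    proof -
      have "?S \<le> (\<Sum>r = 1..m. cod r r' G)"
        by (rule sum_mono2) (auto simp: cod_def ent_range intro!: sum_nonneg)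
      also have "\<dots> = (\<Sum>c = 1..n. ent G r' c * (\<Sum>r = 1..m. ent G r c))"
        unfolding cod_def by (subst sum.swap) (simp add: sum_distrib_left)
      also have "\<dots> = (\<Sum>c = 1..n. ent G r' c * real t)" using col_sum[OF G] by simp
      also have "\<dots> = real t * real s" using row_sum[OF G, of r'] r' by (simp flip: sum_distrib_right)
      finally show ?thesis .
    qed
    have lms: "0 \<le> lm * real s" "lm * real s \<le> real n"
      using lm_pos lm_less_1 mult_mono[of lm 1 "real s" "real n"] s_le by auto
    have 3: "lm * real s * (real J + 1) \<le> real n * (real J + 1)" "0 \<le> lm * real s * (real J + 1)"
      using lms by (auto intro!: mult_right_mono)
    have "\<bar>?S - lm * real s * (m' - 1)\<bar> \<le> real n * (real J + 1)"
      using 1 3 S_le ts by linarith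
    then have "\<bar>?S / (m' - 1) - lm * real s\<bar> \<le> real n * (real J + 1) / (m' - 1)"
      using abs_divide_diff_le[OF N0] by blast
    then have "\<bar>?S / (m' - 1) - lm * real s\<bar> \<le> 2 * L * (real J + 1)" using rest_ratio by linarith
    then have "(?S / (m' - 1) - lm * real s)\<^sup>2 \<le> (2 * L * (real J + 1))\<^sup>2"
      by (metis abs_le_square_iff abs_of_nonneg order_trans abs_ge_zero)
    then show ?thesis unfolding N using rest_sq by linarith
  qed
  have off: "off_rows r r'' (\<lambda>G. ent G r' c)" if "r \<in> ?R" "r'' \<in> ?R" for r r'' c
    using that unfolding off_rows_def ent_def by auto
  have "(\<Sum>r\<in>?R. \<Sum>G\<in>Om. (cod r r' G - lm * real s)\<^sup>2)
     \<le> 2 * (m' - 1) * real n * M + 2 * (m' - 1) * (\<Sum>G\<in>Om. ((\<Sum>r\<in>?R. cod r r' G) / real (card ?R) - lm * real s)\<^sup>2)"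
    unfolding cod_def N[symmetric]
    by (rule concentration_rows) (use ne off in \<open>auto simp: ent_range\<close>)
  also have "\<dots> \<le> 2 * (m' - 1) * real n * M + 2 * (m' - 1) * (\<Sum>G\<in>Om. 16 * L ^ 3 * real n)"
    using N0 avg by (intro add_left_mono mult_left_mono sum_mono) auto
  also have "\<dots> = (m' - 1) * (real n * M * (2 + 32 * L ^ 3))" by (simp add: algebra_simps)
  also have "\<dots> \<le> m' * (real n * M * L ^ 9)"
  proof (intro mult_mono mult_left_mono)
    show "2 + 32 * L ^ 3 \<le> L ^ 9" using L_absorb[of 6 3] L_ge_1[of 3] by simp
  qed (use N0 L2 in auto)
  finally show ?thesis .
qed

lemma cod_concentration:
  "(\<Sum>r'\<in>{J<..m}. \<Sum>r\<in>{J<..m} - {r'}. \<Sum>G\<in>Om. (cod r r' G - lm * real s)\<^sup>2) \<le> m'\<^sup>2 * (real n * M * L ^ 9)"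
  using sum_mono[OF cod_concentration_row, of "{J<..m}"] card_R
  by (simp add: power2_eq_square mult_ac)

text \<open>The typical value of \<open>dd\<close> is 2nv; the threshold is half of it. Above the
  threshold \<open>1 / v\<close> is at most \<open>L\<close>, and below it only the trivial bound 1
  is used.\<close>

lemma recip_dd_bound:
  assumes "G \<in> Om" "r \<in> {J<..m}" "r' \<in> {J<..m}" "2 \<le> dd r r' G"
  shows "1 / (dd r r' G - 1) \<le> of_bool (dd r r' G < real n * v) + 2 * L / real n"
proof (cases "dd r r' G < real n * v")
  case True
  have "1 / (dd r r' G - 1) \<le> 1" using assms(4) by (simp add: divide_le_eq)
  moreover have "0 \<le> 2 * L / real n" using L2 by simp
  ultimately show ?thesis using True by simp
next
  case False
  have nL: "2 * L \<le> real n" using L_large L2 by linarith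
  have "real n * 1 \<le> real n * (L * v)" using vL by (intro mult_left_mono) auto
  then have nv: "real n / L \<le> real n * v" using L2 by (simp add: divide_le_eq mult_ac)
  moreover have "2 \<le> real n / L" using nL L2 by (simp add: le_divide_eq)
  ultimately have "real n / (2 * L) \<le> dd r r' G - 1" using False by (simp add: not_less)
  then have "1 / (dd r r' G - 1) \<le> 1 / (real n / (2 * L))"
    using L2 K_less assms(4) by (intro divide_left_mono mult_pos_pos) auto
  then show ?thesis using False by simp
qed

text \<open>Chebyshev's inequality before taking means: below the threshold the codegree exceeds its
  target by at least nv/2.\<close>

lemma bad_bound:
  assumes "G \<in> Om" "r \<in> {J<..m}" "r' \<in> {J<..m}"
  shows "of_bool (dd r r' G < real n * v) \<le> 4 * L\<^sup>2 / (real n)\<^sup>2 * (cod r r' G - lm * real s)\<^sup>2"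
proof (cases "dd r r' G < real n * v")
  case True
  have "dd r r' G = 2 * (real n * v) - 2 * (cod r r' G - lm * real s)"
    unfolding dd_cod[OF assms] by (simp add: lm_s algebra_simps)
  then have c: "real n * v / 2 \<le> cod r r' G - lm * real s" using True by simp
  have "2 * L / x * (x * y / 2) = L * y" if "x \<noteq> 0" for x y :: real using that by simp
  then have "1 \<le> 2 * L / real n * (real n * v / 2)" using K_less vL by simp
  also have "\<dots> \<le> 2 * L / real n * (cod r r' G - lm * real s)"
    using c L2 by (intro mult_left_mono) auto
  finally have "1\<^sup>2 \<le> (2 * L / real n * (cod r r' G - lm * real s))\<^sup>2" by (intro power_mono) auto
  then show ?thesis using True by (simp add: power_mult_distrib power_divide)
qed simp

end

lemma abs_le_of_double_mult:
  fixes x :: real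
  assumes x: "0 < x" and le: "\<bar>2 * x * T\<bar> \<le> x\<^sup>2 * M * Y"
  shows "\<bar>T\<bar> \<le> x * M * Y"
proof -
  have "x * (2 * \<bar>T\<bar>) \<le> x * (x * M * Y)" using assms by (simp add: abs_mult power2_eq_square mult_ac)
  then have "2 * \<bar>T\<bar> \<le> x * M * Y" using x by simp
  then show ?thesis by simp
qed

context bip_bounds
begin

abbreviation bad :: "nat \<Rightarrow> nat \<Rightarrow> (nat \<times> nat) set \<Rightarrow> real" where
  "bad r r' G \<equiv> 4 * L\<^sup>2 / (real n)\<^sup>2 * (cod r r' G - lm * real s)\<^sup>2"

lemma n_pos: "0 < real n" using K_less by simp

lemma m'_pos: "0 < m'" and n'_pos: "0 < n'" using J_less K_less by auto

lemma sum_bad: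
  "(\<Sum>r'\<in>{J<..m}. \<Sum>r\<in>{J<..m} - {r'}. \<Sum>G\<in>Om. bad r r' G) \<le> m'\<^sup>2 * M * (4 * L ^ 11 / real n)"
proof -
  have "(\<Sum>r'\<in>{J<..m}. \<Sum>r\<in>{J<..m} - {r'}. \<Sum>G\<in>Om. bad r r' G)
    = 4 * L\<^sup>2 / (real n)\<^sup>2 * (\<Sum>r'\<in>{J<..m}. \<Sum>r\<in>{J<..m} - {r'}. \<Sum>G\<in>Om. (cod r r' G - lm * real s)\<^sup>2)"
    by (simp only: sum_distrib_left)
  also have "\<dots> \<le> 4 * L\<^sup>2 / (real n)\<^sup>2 * (m'\<^sup>2 * (real n * M * L ^ 9))"
    by (intro mult_left_mono cod_concentration) auto
  also have "\<dots> = m'\<^sup>2 * M * (4 * (L\<^sup>2 * L ^ 9) / real n)"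
    using n_pos by (simp add: power2_eq_square)
  also have "L\<^sup>2 * L ^ 9 = L ^ 11" unfolding power_add[symmetric] by simp
  finally show ?thesis .
qed

lemma sum_pairs_const:
  assumes "0 \<le> X"
  shows "(\<Sum>r'\<in>{J<..m}. \<Sum>r\<in>{J<..m} - {r'}. X) \<le> m'\<^sup>2 * X"
proof -
  have "(\<Sum>r'\<in>{J<..m}. \<Sum>r\<in>{J<..m} - {r'}. X) \<le> (\<Sum>r'\<in>{J<..m}. m' * X)"
    using assms by (intro sum_mono) (simp add: card_R_minus mult_right_mono)
  also have "\<dots> = m'\<^sup>2 * X" using card_R by (simp add: power2_eq_square)
  finally show ?thesis .
qed

lemma sum_pairs_diag:
  assumes "\<And>r. r \<in> {J<..m} \<Longrightarrow> f r r = (0 :: real)"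
  shows "(\<Sum>r'\<in>{J<..m}. \<Sum>r\<in>{J<..m}. f r r') = (\<Sum>r'\<in>{J<..m}. \<Sum>r\<in>{J<..m} - {r'}. f r r')"
  by (rule sum.cong[OF refl]) (use assms in \<open>simp add: sum.remove\<close>)

text \<open>Bounds the right-hand side of \<open>sum_sg_sg\<close>. For untypical pairs the quotient
  is at most d/(d-1), hence at most 2, and the Chebyshev bound pays for it; for typical pairs the
  reciprocal is of order L/n.\<close>

lemma abs_pair_le:
  assumes G: "G \<in> Om" "r \<in> {J<..m}" "r' \<in> {J<..m}" and k: "k \<in> {1..n}" and z: "\<bar>z\<bar> \<le> dd r r' G"
  shows "\<bar>(sg r r' G k)\<^sup>2 * z / (dd r r' G - 1)\<bar> \<le> 2 * bad r r' G + \<bar>z\<bar> * (2 * L / real n)"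
proof (cases "sg r r' G k = 0")
  case True
  then show ?thesis using L2 by simp
next
  case False
  then have s1: "(sg r r' G k)\<^sup>2 = 1" using sg_cases[of r r' G k] by auto
  have d: "2 \<le> dd r r' G" by (rule dd_ge_2[OF G k False])
  have e: "\<bar>(sg r r' G k)\<^sup>2 * z / (dd r r' G - 1)\<bar> = \<bar>z\<bar> / (dd r r' G - 1)"
    unfolding s1 using d by simp
  show ?thesis
  proof (cases "dd r r' G < real n * v")
    case True
    have "\<bar>z\<bar> / (dd r r' G - 1) \<le> 2" using z d by (simp add: divide_le_eq)
    moreover have "1 \<le> bad r r' G" using bad_bound[OF G] True by simp
    moreover have "0 \<le> \<bar>z\<bar> * (2 * L / real n)" using L2 by simp
    ultimately show ?thesis unfolding e by linarith
  next
    case False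
    have "\<bar>z\<bar> / (dd r r' G - 1) = \<bar>z\<bar> * (1 / (dd r r' G - 1))" by simp
    also have "\<dots> \<le> \<bar>z\<bar> * (2 * L / real n)"
      using recip_dd_bound[OF G d] False by (intro mult_left_mono) auto
    finally show ?thesis unfolding e by (smt (verit) zero_le_power2 mult_nonneg_nonneg divide_nonneg_nonneg)
  qed
qed

section \<open>Correlations\<close>

text \<open>As \<open>be k\<close> sums to zero over the full rows, the sum of products is a sum of
  sign products over pairs of rows divided by 2m', and each pair contributes a mean of order 1/n by
  \<open>sum_sg_sg\<close>.\<close>

lemma cov_rows:
  assumes kl: "k \<in> {1..K}" "l \<in> {1..K}" "k \<noteq> l"
  shows "\<bar>\<Sum>G\<in>Om. \<Sum>r\<in>{J<..m}. be k G r * be l G r\<bar> \<le> m' * M * (L ^ 15 / real n)"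
proof -
  let ?R = "{J<..m}" and ?T = "\<Sum>G\<in>Om. \<Sum>r\<in>{J<..m}. be k G r * be l G r"
  have kn: "k \<in> {1..n}" "l \<in> {1..n}" using kl K_less by auto
  have "2 * m' * ?T = (\<Sum>G\<in>Om. 2 * m' * (\<Sum>r\<in>?R. be k G r * be l G r))"
    by (simp add: sum_distrib_left)
  also have "\<dots> = (\<Sum>G\<in>Om. \<Sum>r'\<in>?R. \<Sum>r\<in>?R. sg r r' G k * sg r r' G l)"
  proof (rule sum.cong[OF refl])
    fix G assume G: "G \<in> Om"
    have "2 * m' * (\<Sum>r\<in>?R. be k G r * be l G r) = (\<Sum>r\<in>?R. \<Sum>r'\<in>?R. (be k G r - be k G r') * (be l G r - be l G r'))"
      unfolding sum_sum_diff_mult be_sum[OF G kl(1)] using card_R by simp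
    also have "\<dots> = (\<Sum>r\<in>?R. \<Sum>r'\<in>?R. sg r r' G k * sg r r' G l)"
      by (simp add: be_def sg_def)
    also have "\<dots> = (\<Sum>r'\<in>?R. \<Sum>r\<in>?R. sg r r' G k * sg r r' G l)" by (rule sum.swap)
    finally show "2 * m' * (\<Sum>r\<in>?R. be k G r * be l G r) = (\<Sum>r'\<in>?R. \<Sum>r\<in>?R. sg r r' G k * sg r r' G l)" .
  qed
  also have "\<dots> = (\<Sum>r'\<in>?R. \<Sum>r\<in>?R. \<Sum>G\<in>Om. sg r r' G k * sg r r' G l)" by (rule sum_swap3)
  also have "\<dots> = (\<Sum>r'\<in>?R. \<Sum>r\<in>?R - {r'}. \<Sum>G\<in>Om. sg r r' G k * sg r r' G l)"
    by (rule sum_pairs_diag) (simp add: sg_def)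
  finally have T: "2 * m' * ?T = \<dots>" .
  have "\<bar>2 * m' * ?T\<bar> \<le> (\<Sum>r'\<in>?R. \<Sum>r\<in>?R - {r'}. (\<Sum>G\<in>Om. 2 * bad r r' G) + M * (2 * L / real n))"
    unfolding T
  proof (rule order_trans[OF sum_abs sum_mono], rule order_trans[OF sum_abs sum_mono])
    fix r' r assume r': "r' \<in> ?R" and "r \<in> ?R - {r'}"
    then have r: "r \<in> ?R" by simp
    have "(\<Sum>G\<in>Om. sg r r' G k * sg r r' G l) = - (\<Sum>G\<in>Om. (sg r r' G k)\<^sup>2 * (sg r r' G l)\<^sup>2 / (dd r r' G - 1))"
      using sum_sg_sg[OF r r' kn kl(3), of "\<lambda>_. 1"] by (simp add: off_rows_def)
    then have "\<bar>\<Sum>G\<in>Om. sg r r' G k * sg r r' G l\<bar> \<le> (\<Sum>G\<in>Om. \<bar>(sg r r' G k)\<^sup>2 * (sg r r' G l)\<^sup>2 / (dd r r' G - 1)\<bar>)"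
      by (simp only: abs_minus_cancel sum_abs)
    also have "\<dots> \<le> (\<Sum>G\<in>Om. 2 * bad r r' G + 2 * L / real n)"
    proof (rule sum_mono)
      fix G assume G: "G \<in> Om"
      have z: "\<bar>(sg r r' G l)\<^sup>2\<bar> \<le> 1" using sg_cases[of r r' G l] by auto
      have "(sg r r' G l)\<^sup>2 \<le> dd r r' G"
        unfolding dd_def using kn by (intro member_le_sum) auto
      then have "\<bar>(sg r r' G k)\<^sup>2 * (sg r r' G l)\<^sup>2 / (dd r r' G - 1)\<bar> \<le> 2 * bad r r' G + \<bar>(sg r r' G l)\<^sup>2\<bar> * (2 * L / real n)"
        by (intro abs_pair_le G r r' kn) simp
      also have "\<bar>(sg r r' G l)\<^sup>2\<bar> * (2 * L / real n) \<le> 1 * (2 * L / real n)"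
        using z L2 by (intro mult_right_mono) auto
      finally show "\<bar>(sg r r' G k)\<^sup>2 * (sg r r' G l)\<^sup>2 / (dd r r' G - 1)\<bar> \<le> 2 * bad r r' G + 2 * L / real n" by simp
    qed
    also have "\<dots> = (\<Sum>G\<in>Om. 2 * bad r r' G) + M * (2 * L / real n)" by (simp add: sum.distrib)
    finally show "\<bar>\<Sum>G\<in>Om. sg r r' G k * sg r r' G l\<bar> \<le> (\<Sum>G\<in>Om. 2 * bad r r' G) + M * (2 * L / real n)" .
  qed
  also have "\<dots> = 2 * (\<Sum>r'\<in>?R. \<Sum>r\<in>?R - {r'}. \<Sum>G\<in>Om. bad r r' G) + (\<Sum>r'\<in>?R. \<Sum>r\<in>?R - {r'}. M * (2 * L / real n))"
    by (simp only: sum.distrib sum_distrib_left)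
  also have "\<dots> \<le> 2 * (m'\<^sup>2 * M * (4 * L ^ 11 / real n)) + m'\<^sup>2 * (M * (2 * L / real n))"
    using L2 by (intro add_mono mult_left_mono sum_bad sum_pairs_const) auto
  also have "\<dots> = m'\<^sup>2 * M / real n * (8 * L ^ 11 + 2 * L)" by (simp add: algebra_simps add_divide_distrib)
  also have "\<dots> \<le> m'\<^sup>2 * M / real n * L ^ 15"
  proof (rule mult_left_mono)
    show "8 * L ^ 11 + 2 * L \<le> L ^ 15"
      using L_absorb[of 3 11] L_absorb[of 1 1] L_mono[of 2 14] L_absorb[of 1 14] by simp
  qed simp
  finally have "\<bar>2 * m' * ?T\<bar> \<le> m'\<^sup>2 * M * (L ^ 15 / real n)" by simp
  then show ?thesis by (rule abs_le_of_double_mult[OF m'_pos])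
qed

section \<open>Sums weighted by a row of the corner, taken over the disagreements of two full
  rows\<close>

definition w1 :: "nat \<Rightarrow> (nat \<times> nat) set \<Rightarrow> nat \<Rightarrow> real" where
  "w1 j G c = of_bool (c \<in> {K<..n}) * al j G c"

definition A1 :: "nat \<Rightarrow> (nat \<times> nat) set \<Rightarrow> nat \<Rightarrow> real" where
  "A1 j G r = (\<Sum>c = 1..n. w1 j G c * ent G r c)"

definition A2 :: "nat \<Rightarrow> (nat \<times> nat) set \<Rightarrow> nat \<Rightarrow> nat \<Rightarrow> real" where
  "A2 j G r r' = (\<Sum>c = 1..n. w1 j G c * ent G r' c * ent G r c)"

text \<open>The sum of \<open>al j\<close> over those columns > \<open>K\<close> where
  \<open>r\<close> and \<open>r'\<close> disagree. It arises when \<open>sum_sg_sg\<close> is summed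
  over one of its columns; the point is that it has size about sqrt n and not n.\<close>

definition Z :: "nat \<Rightarrow> (nat \<times> nat) set \<Rightarrow> nat \<Rightarrow> nat \<Rightarrow> real" where
  "Z j G r r' = (\<Sum>c = 1..n. w1 j G c * (sg r r' G c)\<^sup>2)"

lemma w1_sum: "(\<Sum>c = 1..n. w1 j G c * f c) = (\<Sum>c\<in>{K<..n}. al j G c * f c)"
proof -
  have "(\<Sum>c = 1..K. w1 j G c * f c) = 0" by (rule sum.neutral) (auto simp: w1_def)
  moreover have "(\<Sum>c\<in>{K<..n}. w1 j G c * f c) = (\<Sum>c\<in>{K<..n}. al j G c * f c)"
    by (rule sum.cong) (auto simp: w1_def)
  ultimately show ?thesis unfolding sum_split_interval[OF K_less] by simp
qed

lemma w1_bound: "G \<in> Om \<Longrightarrow> j \<in> {1..J} \<Longrightarrow> \<bar>w1 j G c\<bar> \<le> 1"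
  using al_bound[of G j c] by (auto simp: w1_def)

lemma w1_off: "j \<in> {1..J} \<Longrightarrow> r \<in> {J<..m} \<Longrightarrow> r' \<in> {J<..m} \<Longrightarrow> off_rows r r' (\<lambda>G. w1 j G c)"
  unfolding off_rows_def w1_def al_def ent_def by auto

text \<open>The target is 0 because the weights have total 0. They depend on row \<open>j\<close> <=
  \<open>J\<close> only, so they are unaffected by exchanges between full rows.\<close>

lemma A1_concentration:
  assumes j: "j \<in> {1..J}"
  shows "(\<Sum>r\<in>{J<..m}. \<Sum>G\<in>Om. (A1 j G r)\<^sup>2) \<le> m' * (real n * M * L ^ 9)"
proof -
  let ?R = "{J<..m}"
  have avg: "((\<Sum>r\<in>?R. A1 j G r) / real (card ?R) - 0)\<^sup>2 \<le> 16 * L ^ 3 * real n" if G: "G \<in> Om" for G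
  proof -
    let ?S = "\<Sum>r\<in>?R. A1 j G r"
    have "\<bar>?S - real t * (\<Sum>c = 1..n. w1 j G c)\<bar> \<le> real n * real (card ({1..m} - ?R))"
      unfolding A1_def by (rule sum_rows_weighted[OF G]) (auto simp: w1_bound[OF G j])
    moreover have "(\<Sum>c = 1..n. w1 j G c) = 0" using w1_sum[of j G "\<lambda>_. 1"] al_sum[OF G j] by simp
    ultimately have 1: "\<bar>?S - 0 * m'\<bar> \<le> real n * (real J + 1)" using card_compl_R by (simp add: algebra_simps)
    have "\<bar>?S / m' - 0\<bar> \<le> real n * (real J + 1) / m'"
      by (rule abs_divide_diff_le[OF m'_pos 1])
    also have "\<dots> \<le> real n * (real J + 1) / (m' - 1)"
      using m'_half L_large m'_pos by (intro divide_left_mono mult_pos_pos) auto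
    also have "\<dots> \<le> 2 * L * (real J + 1)" by (rule rest_ratio)
    finally have "(?S / m')\<^sup>2 \<le> (2 * L * (real J + 1))\<^sup>2"
      by (metis abs_le_square_iff abs_of_nonneg order_trans abs_ge_zero diff_zero)
    then show ?thesis unfolding card_R using rest_sq by simp
  qed
  have ne: "?R \<noteq> {}" using J_less by simp
  have "(\<Sum>r\<in>?R. \<Sum>G\<in>Om. (A1 j G r - 0)\<^sup>2)
     \<le> 2 * real (card ?R) * real n * M + 2 * real (card ?R) * (\<Sum>G\<in>Om. ((\<Sum>r\<in>?R. A1 j G r) / real (card ?R) - 0)\<^sup>2)"
    unfolding A1_def
    by (rule concentration_rows) (use ne w1_off j w1_bound in auto)
  also have "\<dots> \<le> 2 * m' * real n * M + 2 * m' * (\<Sum>G\<in>Om. 16 * L ^ 3 * real n)"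
    unfolding card_R using m'_pos avg[unfolded card_R] by (intro add_left_mono mult_left_mono sum_mono) auto
  also have "\<dots> = m' * (real n * M * (2 + 32 * L ^ 3))" by (simp add: algebra_simps)
  also have "\<dots> \<le> m' * (real n * M * L ^ 9)"
  proof (intro mult_left_mono)
    show "2 + 32 * L ^ 3 \<le> L ^ 9" using L_absorb[of 6 3] L_ge_1[of 3] by simp
  qed (use m'_pos in auto)
  finally show ?thesis by simp
qed

text \<open>Now the weights are restricted to the entries of \<open>r'\<close>, and their total is
  \<open>A1 j G r'\<close> instead of 0. The row average is thus about t/(m'-1), at most 2, times
  this quantity, which is why its second moment appears in the bound.\<close>

lemma A2_concentration_row:
  assumes j: "j \<in> {1..J}" and r': "r' \<in> {J<..m}"
  shows "(\<Sum>r\<in>{J<..m} - {r'}. \<Sum>G\<in>Om. (A2 j G r r')\<^sup>2)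
    \<le> m' * (real n * M * (2 + 64 * L ^ 3)) + m' * (16 * (\<Sum>G\<in>Om. (A1 j G r')\<^sup>2))"
proof -
  let ?R = "{J<..m} - {r'}"
  have N: "real (card ?R) = m' - 1" and X: "real (card ({1..m} - ?R)) = real J + 1"
    using card_R_minus card_compl_R_minus r' by auto
  have N0: "0 < m' - 1" using m'_half L_large by linarith
  have ne: "?R \<noteq> {}" using N N0 by force
  have wb: "\<bar>w1 j G c * ent G r' c\<bar> \<le> 1" if "G \<in> Om" for G c
    using w1_bound[OF that j, of c] by (auto simp: ent_def)
  have avg: "((\<Sum>r\<in>?R. A2 j G r r') / real (card ?R) - 0)\<^sup>2 \<le> 8 * (A1 j G r')\<^sup>2 + 32 * L ^ 3 * real n" if G: "G \<in> Om" for G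
  proof -
    let ?S = "\<Sum>r\<in>?R. A2 j G r r'"
    have "\<bar>?S - real t * A1 j G r'\<bar> \<le> real n * (real J + 1)"
      unfolding A1_def A2_def X[symmetric] by (rule sum_rows_weighted[OF G]) (auto simp: wb[OF G])
    then have "\<bar>?S - real t / (m' - 1) * A1 j G r' * (m' - 1)\<bar> \<le> real n * (real J + 1)"
      using N0 by simp
    then have "\<bar>?S / (m' - 1) - real t / (m' - 1) * A1 j G r'\<bar> \<le> real n * (real J + 1) / (m' - 1)"
      by (rule abs_divide_diff_le[OF N0])
    then have 1: "\<bar>?S / (m' - 1) - real t / (m' - 1) * A1 j G r'\<bar> \<le> 2 * L * (real J + 1)"
      using rest_ratio by linarith
    have "real t / (m' - 1) \<le> 2" using t_le m'_half N0 by (simp add: pos_divide_le_eq)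
    then have "\<bar>real t / (m' - 1) * A1 j G r'\<bar> \<le> 2 * \<bar>A1 j G r'\<bar>"
      unfolding abs_mult using N0 by (intro mult_right_mono) auto
    moreover have "\<bar>x\<bar> \<le> a + b" if "\<bar>y\<bar> \<le> a" "\<bar>x - y\<bar> \<le> b" for x y a b :: real using that by linarith
    ultimately have "\<bar>?S / (m' - 1)\<bar> \<le> 2 * \<bar>A1 j G r'\<bar> + 2 * L * (real J + 1)" using 1 by blast
    then have "(?S / (m' - 1))\<^sup>2 \<le> (2 * \<bar>A1 j G r'\<bar> + 2 * L * (real J + 1))\<^sup>2"
      by (metis abs_le_square_iff abs_of_nonneg order_trans abs_ge_zero)
    also have "\<dots> \<le> 2 * (2 * \<bar>A1 j G r'\<bar>)\<^sup>2 + 2 * (2 * L * (real J + 1))\<^sup>2"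
      using sum_squares_bound[of "2 * \<bar>A1 j G r'\<bar>" "2 * L * (real J + 1)"] by (simp add: power2_sum)
    also have "(2 * \<bar>A1 j G r'\<bar>)\<^sup>2 = 4 * (A1 j G r')\<^sup>2" by (simp add: power_mult_distrib)
    finally show ?thesis unfolding N using rest_sq by simp
  qed
  have off: "off_rows r r'' (\<lambda>G. w1 j G c * ent G r' c)" if "r \<in> ?R" "r'' \<in> ?R" for r r'' c
    using that j unfolding off_rows_def w1_def al_def ent_def by auto
  have "(\<Sum>r\<in>?R. \<Sum>G\<in>Om. (A2 j G r r' - 0)\<^sup>2)
     \<le> 2 * real (card ?R) * real n * M + 2 * real (card ?R) * (\<Sum>G\<in>Om. ((\<Sum>r\<in>?R. A2 j G r r') / real (card ?R) - 0)\<^sup>2)"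
    unfolding A2_def
    by (rule concentration_rows) (use ne off wb in auto)
  also have "\<dots> \<le> 2 * (m' - 1) * real n * M + 2 * (m' - 1) * (\<Sum>G\<in>Om. 8 * (A1 j G r')\<^sup>2 + 32 * L ^ 3 * real n)"
    unfolding N using N0 avg[unfolded N] by (intro add_left_mono mult_left_mono sum_mono) auto
  also have "\<dots> = (m' - 1) * (real n * M * (2 + 64 * L ^ 3)) + (m' - 1) * (16 * (\<Sum>G\<in>Om. (A1 j G r')\<^sup>2))"
    by (simp add: algebra_simps sum.distrib flip: sum_distrib_left)
  also have "\<dots> \<le> m' * (real n * M * (2 + 64 * L ^ 3)) + m' * (16 * (\<Sum>G\<in>Om. (A1 j G r')\<^sup>2))"
    using L2 by (intro add_mono mult_right_mono) (auto intro!: mult_nonneg_nonneg sum_nonneg)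
  finally show ?thesis by simp
qed

lemma A2_concentration:
  assumes j: "j \<in> {1..J}"
  shows "(\<Sum>r'\<in>{J<..m}. \<Sum>r\<in>{J<..m} - {r'}. \<Sum>G\<in>Om. (A2 j G r r')\<^sup>2) \<le> m'\<^sup>2 * (real n * M * L ^ 14)"
proof -
  have "(\<Sum>r'\<in>{J<..m}. \<Sum>r\<in>{J<..m} - {r'}. \<Sum>G\<in>Om. (A2 j G r r')\<^sup>2)
    \<le> (\<Sum>r'\<in>{J<..m}. m' * (real n * M * (2 + 64 * L ^ 3)) + m' * (16 * (\<Sum>G\<in>Om. (A1 j G r')\<^sup>2)))"
    by (intro sum_mono A2_concentration_row j)
  also have "\<dots> = m'\<^sup>2 * (real n * M * (2 + 64 * L ^ 3)) + m' * 16 * (\<Sum>r'\<in>{J<..m}. \<Sum>G\<in>Om. (A1 j G r')\<^sup>2)"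
    using card_R by (simp add: sum.distrib power2_eq_square mult_ac flip: sum_distrib_left)
  also have "\<dots> \<le> m'\<^sup>2 * (real n * M * (2 + 64 * L ^ 3)) + m' * 16 * (m' * (real n * M * L ^ 9))"
    using m'_pos by (intro add_left_mono mult_left_mono A1_concentration j) auto
  also have "\<dots> = m'\<^sup>2 * (real n * M * (2 + 64 * L ^ 3 + 16 * L ^ 9))"
    by (simp add: algebra_simps power2_eq_square)
  also have "\<dots> \<le> m'\<^sup>2 * (real n * M * L ^ 14)"
  proof (intro mult_left_mono)
    show "2 + 64 * L ^ 3 + 16 * L ^ 9 \<le> L ^ 14"
      using L_absorb[of 7 3] L_absorb[of 4 9] L_ge_1[of 3] L_mono[of 10 13] L_absorb[of 1 13] by simp
  qed auto
  finally show ?thesis .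
qed

lemma Z_eq: "Z j G r r' = A1 j G r + A1 j G r' - 2 * A2 j G r r'"
proof -
  have "Z j G r r' = (\<Sum>c = 1..n. w1 j G c * ent G r c + w1 j G c * ent G r' c - 2 * (w1 j G c * ent G r' c * ent G r c))"
    unfolding Z_def sg_def by (rule sum.cong) (auto simp: ent_def)
  then show ?thesis by (simp add: A1_def A2_def sum.distrib sum_subtractf sum_distrib_left)
qed

text \<open>On 0-1 entries the indicator of disagreement is x + y - 2xy, which expresses
  \<open>Z\<close> by \<open>A1\<close> and \<open>A2\<close>.\<close>

lemma Z_second_moment:
  assumes j: "j \<in> {1..J}"
  shows "(\<Sum>r'\<in>{J<..m}. \<Sum>r\<in>{J<..m} - {r'}. \<Sum>G\<in>Om. (Z j G r r')\<^sup>2) \<le> m'\<^sup>2 * (real n * M * L ^ 19)"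
proof -
  let ?R = "{J<..m}"
  let ?a = "\<Sum>r\<in>?R. \<Sum>G\<in>Om. (A1 j G r)\<^sup>2"
  have "(Z j G r r')\<^sup>2 \<le> 3 * (A1 j G r)\<^sup>2 + 3 * (A1 j G r')\<^sup>2 + 12 * (A2 j G r r')\<^sup>2" for G r r'
  proof -
    have "(x + y - 2 * z)\<^sup>2 \<le> 3 * x\<^sup>2 + 3 * y\<^sup>2 + 12 * z\<^sup>2" for x y z :: real
    proof -
      have "3 * x\<^sup>2 + 3 * y\<^sup>2 + 12 * z\<^sup>2 - (x + y - 2 * z)\<^sup>2 = (x - y)\<^sup>2 + (x + 2 * z)\<^sup>2 + (y + 2 * z)\<^sup>2"
        by (simp add: power2_eq_square algebra_simps)
      then show ?thesis by (smt (verit) zero_le_power2)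
    qed
    then show ?thesis unfolding Z_eq .
  qed
  then have "(\<Sum>r'\<in>?R. \<Sum>r\<in>?R - {r'}. \<Sum>G\<in>Om. (Z j G r r')\<^sup>2)
    \<le> (\<Sum>r'\<in>?R. \<Sum>r\<in>?R - {r'}. \<Sum>G\<in>Om. 3 * (A1 j G r)\<^sup>2 + 3 * (A1 j G r')\<^sup>2 + 12 * (A2 j G r r')\<^sup>2)"
    by (intro sum_mono)
  also have "\<dots> = 3 * (\<Sum>r'\<in>?R. \<Sum>r\<in>?R - {r'}. \<Sum>G\<in>Om. (A1 j G r)\<^sup>2)
    + 3 * (\<Sum>r'\<in>?R. \<Sum>r\<in>?R - {r'}. \<Sum>G\<in>Om. (A1 j G r')\<^sup>2)
    + 12 * (\<Sum>r'\<in>?R. \<Sum>r\<in>?R - {r'}. \<Sum>G\<in>Om. (A2 j G r r')\<^sup>2)"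
    by (simp only: sum.distrib sum_distrib_left)
  also have "\<dots> \<le> 3 * (m' * ?a) + 3 * (m' * ?a) + 12 * (m'\<^sup>2 * (real n * M * L ^ 14))"
  proof (intro add_mono mult_left_mono A2_concentration j)
    have "(\<Sum>r'\<in>?R. \<Sum>r\<in>?R - {r'}. \<Sum>G\<in>Om. (A1 j G r)\<^sup>2) \<le> (\<Sum>r'\<in>?R. ?a)"
      by (intro sum_mono sum_mono2) (auto intro: sum_nonneg)
    then show "(\<Sum>r'\<in>?R. \<Sum>r\<in>?R - {r'}. \<Sum>G\<in>Om. (A1 j G r)\<^sup>2) \<le> m' * ?a" using card_R by simp
    have "(\<Sum>r'\<in>?R. \<Sum>r\<in>?R - {r'}. \<Sum>G\<in>Om. (A1 j G r')\<^sup>2) \<le> (\<Sum>r'\<in>?R. m' * (\<Sum>G\<in>Om. (A1 j G r')\<^sup>2))"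
      by (intro sum_mono) (simp add: card_R_minus mult_right_mono sum_nonneg)
    then show "(\<Sum>r'\<in>?R. \<Sum>r\<in>?R - {r'}. \<Sum>G\<in>Om. (A1 j G r')\<^sup>2) \<le> m' * ?a"
      by (simp only: sum_distrib_left)
  qed auto
  also have "\<dots> = 6 * (m' * ?a) + 12 * (m'\<^sup>2 * (real n * M * L ^ 14))" by simp
  also have "\<dots> \<le> 6 * (m' * (m' * (real n * M * L ^ 9))) + 12 * (m'\<^sup>2 * (real n * M * L ^ 14))"
    using m'_pos by (intro add_right_mono mult_left_mono A1_concentration j) auto
  also have "\<dots> = m'\<^sup>2 * (real n * M * (6 * L ^ 9 + 12 * L ^ 14))"
    by (simp add: algebra_simps power2_eq_square)
  also have "\<dots> \<le> m'\<^sup>2 * (real n * M * L ^ 19)"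
  proof (intro mult_left_mono)
    show "6 * L ^ 9 + 12 * L ^ 14 \<le> L ^ 19"
      using L_absorb[of 4 14] L_mono[of 9 14] L_absorb[of 3 9] L_mono[of 12 18] L_absorb[of 1 18] L_ge_1[of 9] L_ge_1[of 14]
      by simp
  qed auto
  finally show ?thesis .
qed

text \<open>Cauchy-Schwarz in the form |z| <= sqrt n + z^2 / sqrt n, which can be summed term by
  term.\<close>

lemma Z_first_moment:
  assumes j: "j \<in> {1..J}"
  shows "(\<Sum>r'\<in>{J<..m}. \<Sum>r\<in>{J<..m} - {r'}. \<Sum>G\<in>Om. \<bar>Z j G r r'\<bar>) \<le> m'\<^sup>2 * (sqrt (real n) * M * L ^ 20)"
proof -
  let ?R = "{J<..m}" and ?q = "sqrt (real n)"
  have q: "0 < ?q" "?q * ?q = real n" using n_pos by auto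
  have "\<bar>z\<bar> \<le> ?q + z\<^sup>2 / ?q" for z
  proof (cases "\<bar>z\<bar> \<le> ?q")
    case True
    moreover have "0 \<le> z\<^sup>2 / ?q" using q by simp
    ultimately show ?thesis by linarith
  next
    case False
    then have "\<bar>z\<bar> * ?q \<le> \<bar>z\<bar> * \<bar>z\<bar>" by (intro mult_left_mono) auto
    then have "\<bar>z\<bar> \<le> z\<^sup>2 / ?q" using q by (simp add: le_divide_eq power2_eq_square)
    then show ?thesis using q by linarith
  qed
  then have "(\<Sum>r'\<in>?R. \<Sum>r\<in>?R - {r'}. \<Sum>G\<in>Om. \<bar>Z j G r r'\<bar>)
    \<le> (\<Sum>r'\<in>?R. \<Sum>r\<in>?R - {r'}. \<Sum>G\<in>Om. ?q + 1 / ?q * (Z j G r r')\<^sup>2)"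
    by (intro sum_mono) simp
  also have "\<dots> = (\<Sum>r'\<in>?R. \<Sum>r\<in>?R - {r'}. M * ?q) + 1 / ?q * (\<Sum>r'\<in>?R. \<Sum>r\<in>?R - {r'}. \<Sum>G\<in>Om. (Z j G r r')\<^sup>2)"
    by (simp only: sum.distrib sum_distrib_left sum_constant)
  also have "\<dots> \<le> m'\<^sup>2 * (M * ?q) + 1 / ?q * (m'\<^sup>2 * (real n * M * L ^ 19))"
    using q by (intro add_mono mult_left_mono sum_pairs_const Z_second_moment j) auto
  also have "\<dots> = m'\<^sup>2 * (?q * M * (1 + L ^ 19))"
  proof -
    have "a * (b * y) + 1 / y * (a * (x * b * c)) = a * (y * b * (1 + c))" if "0 < y" "y * y = x" for a b c x y :: real
      using that(1) unfolding that(2)[symmetric] by (simp add: algebra_simps)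
    from this[OF q] show ?thesis .
  qed
  also have "\<dots> \<le> m'\<^sup>2 * (?q * M * L ^ 20)"
    using L_ge_1[of 19] L_absorb[of 1 19] by (intro mult_left_mono) auto
  finally show ?thesis .
qed

text \<open>For a fixed pair of full rows, \<open>al j\<close> is a test function not depending on
  them, and \<open>k\<close> <= \<open>K\<close> < \<open>c\<close> keeps the two columns distinct.
  So \<open>sum_sg_sg\<close> applies and leaves the mean of \<open>Z\<close> over d-1, of order
  sqrt n / n up to powers of \<open>L\<close>.\<close>

lemma triple_bound:
  assumes j: "j \<in> {1..J}" and k: "k \<in> {1..K}"
  shows "\<bar>\<Sum>G\<in>Om. \<Sum>r\<in>{J<..m}. \<Sum>c\<in>{K<..n}. al j G c * be k G r * ga G r c\<bar> \<le> m' * M * (L ^ 23 / sqrt (real n))"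
proof -
  let ?R = "{J<..m}" and ?C = "{K<..n}"
  let ?T = "\<Sum>G\<in>Om. \<Sum>r\<in>?R. \<Sum>c\<in>?C. al j G c * be k G r * ga G r c"
  let ?q = "sqrt (real n)"
  have kn: "k \<in> {1..n}" using k K_less by auto
  have "2 * m' * ?T = (\<Sum>G\<in>Om. 2 * m' * (\<Sum>r\<in>?R. \<Sum>c\<in>?C. al j G c * be k G r * ga G r c))"
    by (simp add: sum_distrib_left)
  also have "\<dots> = (\<Sum>G\<in>Om. \<Sum>r'\<in>?R. \<Sum>r\<in>?R. \<Sum>c\<in>?C. sg r r' G k * sg r r' G c * al j G c)"
  proof (rule sum.cong[OF refl])
    fix G assume G: "G \<in> Om"
    have "2 * m' * (\<Sum>r\<in>?R. \<Sum>c\<in>?C. al j G c * be k G r * ga G r c)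
      = (\<Sum>c\<in>?C. al j G c * (2 * m' * (\<Sum>r\<in>?R. be k G r * ga G r c)))"
      by (subst sum.swap) (simp add: sum_distrib_left mult_ac)
    also have "\<dots> = (\<Sum>c\<in>?C. al j G c * (\<Sum>r\<in>?R. \<Sum>r'\<in>?R. (be k G r - be k G r') * (ga G r c - ga G r' c)))"
      unfolding sum_sum_diff_mult be_sum[OF G k] using card_R by simp
    also have "\<dots> = (\<Sum>c\<in>?C. \<Sum>r\<in>?R. \<Sum>r'\<in>?R. sg r r' G k * sg r r' G c * al j G c)"
      by (simp add: be_def ga_def sg_def sum_distrib_left mult_ac)
    also have "\<dots> = (\<Sum>r\<in>?R. \<Sum>r'\<in>?R. \<Sum>c\<in>?C. sg r r' G k * sg r r' G c * al j G c)"
      by (rule sum_swap3)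
    also have "\<dots> = (\<Sum>r'\<in>?R. \<Sum>r\<in>?R. \<Sum>c\<in>?C. sg r r' G k * sg r r' G c * al j G c)"
      by (rule sum.swap)
    finally show "2 * m' * (\<Sum>r\<in>?R. \<Sum>c\<in>?C. al j G c * be k G r * ga G r c)
      = (\<Sum>r'\<in>?R. \<Sum>r\<in>?R. \<Sum>c\<in>?C. sg r r' G k * sg r r' G c * al j G c)" .
  qed
  also have "\<dots> = (\<Sum>r'\<in>?R. \<Sum>r\<in>?R. \<Sum>G\<in>Om. \<Sum>c\<in>?C. sg r r' G k * sg r r' G c * al j G c)"
    by (rule sum_swap3)
  also have "\<dots> = (\<Sum>r'\<in>?R. \<Sum>r\<in>?R - {r'}. \<Sum>G\<in>Om. \<Sum>c\<in>?C. sg r r' G k * sg r r' G c * al j G c)"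
    by (rule sum_pairs_diag) (simp add: sg_def)
  finally have T: "2 * m' * ?T = \<dots>" .
  have "\<bar>2 * m' * ?T\<bar> \<le> (\<Sum>r'\<in>?R. \<Sum>r\<in>?R - {r'}. \<Sum>G\<in>Om. 2 * bad r r' G + 2 * L / real n * \<bar>Z j G r r'\<bar>)"
    unfolding T
  proof (rule order_trans[OF sum_abs sum_mono], rule order_trans[OF sum_abs sum_mono])
    fix r' r assume r': "r' \<in> ?R" and "r \<in> ?R - {r'}"
    then have r: "r \<in> ?R" by simp
    have "(\<Sum>G\<in>Om. \<Sum>c\<in>?C. sg r r' G k * sg r r' G c * al j G c)
      = (\<Sum>c\<in>?C. \<Sum>G\<in>Om. sg r r' G k * sg r r' G c * al j G c)" by (rule sum.swap)
    also have "\<dots> = (\<Sum>c\<in>?C. - (\<Sum>G\<in>Om. (sg r r' G k)\<^sup>2 * (sg r r' G c)\<^sup>2 * al j G c / (dd r r' G - 1)))"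
    proof (rule sum.cong[OF refl])
      fix c assume c: "c \<in> ?C"
      show "(\<Sum>G\<in>Om. sg r r' G k * sg r r' G c * al j G c)
        = - (\<Sum>G\<in>Om. (sg r r' G k)\<^sup>2 * (sg r r' G c)\<^sup>2 * al j G c / (dd r r' G - 1))"
      proof (rule sum_sg_sg[OF r r' kn])
        show "off_rows r r' (\<lambda>G. al j G c)"
          using r r' j unfolding off_rows_def al_def ent_def by auto
      qed (use c k in auto)
    qed
    also have "\<dots> = - (\<Sum>G\<in>Om. (sg r r' G k)\<^sup>2 * Z j G r r' / (dd r r' G - 1))"
      unfolding sum_negf
      by (subst sum.swap) (simp add: Z_def w1_sum sum_distrib_left sum_divide_distrib mult_ac)
    finally have "\<bar>\<Sum>G\<in>Om. \<Sum>c\<in>?C. sg r r' G k * sg r r' G c * al j G c\<bar>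
      \<le> (\<Sum>G\<in>Om. \<bar>(sg r r' G k)\<^sup>2 * Z j G r r' / (dd r r' G - 1)\<bar>)"
      by (simp only: abs_minus_cancel sum_abs)
    also have "\<dots> \<le> (\<Sum>G\<in>Om. 2 * bad r r' G + 2 * L / real n * \<bar>Z j G r r'\<bar>)"
    proof (rule sum_mono)
      fix G assume G: "G \<in> Om"
      have "\<bar>Z j G r r'\<bar> \<le> dd r r' G"
        unfolding Z_def dd_def
      proof (rule order_trans[OF sum_abs sum_mono])
        fix c show "\<bar>w1 j G c * (sg r r' G c)\<^sup>2\<bar> \<le> (sg r r' G c)\<^sup>2"
          using w1_bound[OF G j, of c] by (simp add: abs_mult mult_left_le_one_le)
      qed
      from abs_pair_le[OF G r r' kn this]
      show "\<bar>(sg r r' G k)\<^sup>2 * Z j G r r' / (dd r r' G - 1)\<bar> \<le> 2 * bad r r' G + 2 * L / real n * \<bar>Z j G r r'\<bar>"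
        by (simp only: mult.commute)
    qed
    finally show "\<bar>\<Sum>G\<in>Om. \<Sum>c\<in>?C. sg r r' G k * sg r r' G c * al j G c\<bar>
      \<le> (\<Sum>G\<in>Om. 2 * bad r r' G + 2 * L / real n * \<bar>Z j G r r'\<bar>)" .
  qed
  also have "\<dots> = 2 * (\<Sum>r'\<in>?R. \<Sum>r\<in>?R - {r'}. \<Sum>G\<in>Om. bad r r' G)
     + 2 * L / real n * (\<Sum>r'\<in>?R. \<Sum>r\<in>?R - {r'}. \<Sum>G\<in>Om. \<bar>Z j G r r'\<bar>)"
    by (simp only: sum.distrib sum_distrib_left)
  also have "\<dots> \<le> 2 * (m'\<^sup>2 * M * (4 * L ^ 11 / real n)) + 2 * L / real n * (m'\<^sup>2 * (?q * M * L ^ 20))"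
    using L2 by (intro add_mono mult_left_mono sum_bad Z_first_moment j) auto
  also have "\<dots> = m'\<^sup>2 * M * (8 * L ^ 11 / real n + 2 * (L * L ^ 20) * (?q / real n))"
    by (simp add: algebra_simps)
  also have "\<dots> \<le> m'\<^sup>2 * M * (L ^ 23 / ?q)"
  proof (rule mult_left_mono)
    have q: "?q * ?q = real n" "1 \<le> ?q" using n_pos by auto
    have "y / x = 1 / y" if "y * y = x" for x y :: real unfolding that[symmetric] by simp
    then have "?q / real n = 1 / ?q" using q(1) .
    moreover have "?q \<le> real n" using mult_left_mono[OF q(2), of ?q] unfolding q(1) by simp
    then have "8 * L ^ 11 / real n \<le> 8 * L ^ 11 / ?q"
      using q L2 n_pos by (intro divide_left_mono) auto
    moreover have "(8 * L ^ 11 + 2 * L ^ 21) / ?q \<le> L ^ 23 / ?q"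
    proof (rule divide_right_mono)
      show "8 * L ^ 11 + 2 * L ^ 21 \<le> L ^ 23"
        using L_absorb[of 3 11] L_absorb[of 1 21] L_mono[of 14 22] L_absorb[of 1 22] by simp
    qed simp
    moreover have "L * L ^ 20 = L ^ 21" using power_add[of L 1 20] by simp
    ultimately show "8 * L ^ 11 / real n + 2 * (L * L ^ 20) * (?q / real n) \<le> L ^ 23 / ?q"
      by (simp add: add_divide_distrib)
  qed simp
  finally show ?thesis by (rule abs_le_of_double_mult[OF m'_pos])
qed

end

context bip_ext
begin

lemma p_range: assumes "G \<in> Om" "k \<in> {1..K}" shows "0 \<le> p k" "p k \<le> 1"
proof -
  have "p k = (\<Sum>r\<in>{J<..m}. ent G r k) / (real m - real J)" by (simp add: p_def col_sum_R[OF assms])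
  moreover have "0 \<le> (\<Sum>r\<in>{J<..m}. ent G r k)" by (intro sum_nonneg ent_range)
  moreover have "(\<Sum>r\<in>{J<..m}. ent G r k) \<le> (\<Sum>r\<in>{J<..m}. 1)" by (intro sum_mono ent_range)
  ultimately show "0 \<le> p k" "p k \<le> 1" using J_less by (auto simp: divide_le_eq)
qed

lemma be_square_sum:
  assumes G: "G \<in> Om" and k: "k \<in> {1..K}"
  shows "(\<Sum>r\<in>{J<..m}. (be k G r)\<^sup>2) = (real m - real J) * p k * (1 - p k)"
proof -
  have b: "(\<Sum>r\<in>{J<..m}. ent G r k) = (real m - real J) * p k"
    unfolding col_sum_R[OF G k] p_def using J_less by simp
  have "(be k G r)\<^sup>2 = ent G r k * (1 - 2 * p k) + (p k)\<^sup>2" for r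
    by (simp add: be_def power2_diff ent_idem algebra_simps)
  then have "(\<Sum>r\<in>{J<..m}. (be k G r)\<^sup>2) = (real m - real J) * p k * (1 - 2 * p k) + (real m - real J) * (p k)\<^sup>2"
    unfolding b[symmetric] using card_R by (simp add: sum.distrib sum_distrib_right)
  then show ?thesis by (simp add: power2_eq_square algebra_simps)
qed

text \<open>A full row has \<open>s\<close> entries, so the sum of \<open>ga\<close> along it is a
  constant minus the sum of the \<open>be l\<close> over the columns of the corner. The constant
  disappears since \<open>be k\<close> sums to zero, and l = k gives the variance.\<close>

lemma be_ga_sum:
  assumes G: "G \<in> Om" and k: "k \<in> {1..K}"
  shows "(\<Sum>r\<in>{J<..m}. \<Sum>c\<in>{K<..n}. be k G r * ga G r c)
    = - (\<Sum>r\<in>{J<..m}. (be k G r)\<^sup>2) - (\<Sum>l\<in>{1..K} - {k}. \<Sum>r\<in>{J<..m}. be k G r * be l G r)"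
proof -
  define a where "a = real s - (real n - real K) * rho - (\<Sum>l = 1..K. p l)"
  have row: "(\<Sum>c\<in>{K<..n}. ga G r c) = a - (\<Sum>l = 1..K. be l G r)" if r: "r \<in> {J<..m}" for r
  proof -
    have "(\<Sum>c = 1..K. ent G r c) + (\<Sum>c\<in>{K<..n}. ent G r c) = real s"
      using row_sum[OF G, of r] r unfolding sum_split_interval[OF K_less] by simp
    then show ?thesis using card_C by (simp add: a_def ga_def be_def sum_subtractf)
  qed
  have "(\<Sum>r\<in>{J<..m}. \<Sum>c\<in>{K<..n}. be k G r * ga G r c)
    = (\<Sum>r\<in>{J<..m}. be k G r * (a - (\<Sum>l = 1..K. be l G r)))"
    by (rule sum.cong) (simp_all add: row flip: sum_distrib_left)
  also have "\<dots> = a * (\<Sum>r\<in>{J<..m}. be k G r) - (\<Sum>l = 1..K. \<Sum>r\<in>{J<..m}. be k G r * be l G r)"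
    by (simp add: right_diff_distrib sum_subtractf sum_distrib_left mult.commute) (rule sum.swap)
  also have "\<dots> = - (\<Sum>l = 1..K. \<Sum>r\<in>{J<..m}. be k G r * be l G r)"
    by (simp add: be_sum[OF G k])
  finally show ?thesis using k by (simp add: sum.remove power2_eq_square)
qed

end

context bip_bounds
begin

lemma K_over_n: "real K / real n \<le> L / sqrt (real n)"
proof -
  have "(real K)\<^sup>2 \<le> (L * sqrt (real n))\<^sup>2"
  proof -
    have "L * 1 \<le> L * L" using L2 by (intro mult_left_mono) auto
    then have "L * real n \<le> L * L * real n" by (intro mult_right_mono) auto
    moreover have "(L * sqrt (real n))\<^sup>2 = L * L * real n" by (simp add: power_mult_distrib power2_eq_square[of L])
    ultimately show ?thesis using Kn by linarith
  qed
  then have K: "real K \<le> L * sqrt (real n)" by (rule power2_le_imp_le) (use L2 in simp)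
  have "L * y / x = L / y" if "y * y = x" for x y :: real unfolding that[symmetric] by simp
  from this[of "sqrt (real n)" "real n"] have "L * sqrt (real n) / real n = L / sqrt (real n)" by simp
  then show ?thesis using divide_right_mono[OF K, of "real n"] by simp
qed

text \<open>The variance is a constant of the block and is the main term. The other columns
  contribute fewer than K covariances of order 1/n each, together of order K/n, that is about 1/sqrt
  n.\<close>

lemma be_ga_bound:
  assumes k: "k \<in> {1..K}"
  shows "\<bar>(\<Sum>G\<in>Om. \<Sum>r\<in>{J<..m}. \<Sum>c\<in>{K<..n}. be k G r * ga G r c) + M * (m' * p k * (1 - p k))\<bar>
    \<le> m' * M * (L ^ 16 / sqrt (real n))"
proof -
  let ?c = "\<lambda>l. \<Sum>G\<in>Om. \<Sum>r\<in>{J<..m}. be k G r * be l G r"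
  have "(\<Sum>G\<in>Om. \<Sum>r\<in>{J<..m}. \<Sum>c\<in>{K<..n}. be k G r * ga G r c)
    = (\<Sum>G\<in>Om. - (m' * p k * (1 - p k)) - (\<Sum>l\<in>{1..K} - {k}. \<Sum>r\<in>{J<..m}. be k G r * be l G r))"
    by (rule sum.cong[OF refl]) (simp only: be_ga_sum[OF _ k] be_square_sum[OF _ k])
  also have "\<dots> = - (M * (m' * p k * (1 - p k))) - (\<Sum>l\<in>{1..K} - {k}. ?c l)"
    unfolding sum_subtractf by (subst (2) sum.swap) simp
  finally have e: "(\<Sum>G\<in>Om. \<Sum>r\<in>{J<..m}. \<Sum>c\<in>{K<..n}. be k G r * ga G r c) + M * (m' * p k * (1 - p k))
    = - (\<Sum>l\<in>{1..K} - {k}. ?c l)" by simp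
  have "\<bar>\<Sum>l\<in>{1..K} - {k}. ?c l\<bar> \<le> (\<Sum>l\<in>{1..K} - {k}. m' * M * (L ^ 15 / real n))"
    by (rule order_trans[OF sum_abs sum_mono]) (use cov_rows k in auto)
  also have "\<dots> \<le> (\<Sum>l\<in>{1..K}. m' * M * (L ^ 15 / real n))"
    using m'_pos L2 by (intro sum_mono2) auto
  also have "\<dots> = m' * M * L ^ 15 * (real K / real n)" by simp
  also have "\<dots> \<le> m' * M * L ^ 15 * (L / sqrt (real n))"
    using m'_pos L2 by (intro mult_left_mono K_over_n) auto
  also have "\<dots> = m' * M * (L ^ 16 / sqrt (real n))" using power_add[of L 15 1] by simp
  finally show ?thesis unfolding e by simp
qed

text \<open>The hypotheses on sizes come in pairs that are exchanged by transposition, and lambda is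
  s/n = t/m. Each estimate for columns of the corner is thereby available for its rows.\<close>

lemma transposed: "bip_bounds n m t s K J (H\<inverse>) L"
proof -
  have "real m * real s = real n * real t" using ms by (metis of_nat_mult)
  then have "lam m t = lam n s" using lm_t J_less by (simp add: lam_def)
  then show ?thesis
    by unfold_locales (use J_less K_less H_sub ms L2 mL nL Jn Jm Kn Km vL bign bigm in auto)
qed

lemma Om_transposed: "bip_ext.Om n m t s K J (H\<inverse>) = converse ` Om"
proof -
  interpret tr: bip_bounds n m t s K J "H\<inverse>" L by (rule transposed)
  have "induced (G\<inverse>) K J = (induced G J K)\<inverse>" for G by (auto simp: induced_def)
  then have *: "G\<inverse> \<in> tr.Om \<longleftrightarrow> G \<in> Om" for G
    unfolding tr.Om_def Om_def by (simp add: bip_graphs_converse)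
  show ?thesis
  proof (intro set_eqI iffI)
    fix G assume "G \<in> tr.Om"
    then have "G\<inverse> \<in> Om" using *[of "G\<inverse>"] by simp
    then show "G \<in> converse ` Om" by (metis converse_converse imageI)
  qed (use * in auto)
qed

lemma al_ga_bound:
  assumes j: "j \<in> {1..J}"
  shows "\<bar>(\<Sum>G\<in>Om. \<Sum>r\<in>{J<..m}. \<Sum>c\<in>{K<..n}. al j G c * ga G r c) + M * (n' * q j * (1 - q j))\<bar>
    \<le> n' * M * (L ^ 16 / sqrt (real m))"
proof -
  interpret tr: bip_bounds n m t s K J "H\<inverse>" L by (rule transposed)
  have inj: "inj_on converse Om" by (simp add: inj_on_def)
  have p: "tr.p j = q j" by (simp add: tr.p_def q_def degV_converse)
  have ms': "real m * real s = real n * real t" using ms by (metis of_nat_mult)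
  have rho: "tr.rho = rho"
    unfolding tr.rho_def rho_def using ms' by (simp add: card_inverse algebra_simps)
  have "(\<Sum>G\<in>tr.Om. \<Sum>c\<in>{K<..n}. \<Sum>r\<in>{J<..m}. tr.be j G c * tr.ga G c r)
    = (\<Sum>G\<in>Om. \<Sum>r\<in>{J<..m}. \<Sum>c\<in>{K<..n}. al j G c * ga G r c)"
    unfolding Om_transposed sum.reindex[OF inj] o_def
    by (rule sum.cong[OF refl], subst sum.swap)
       (simp add: tr.be_def tr.ga_def al_def ga_def p rho ent_converse)
  moreover have "card tr.Om = card Om" unfolding Om_transposed by (rule card_image[OF inj])
  ultimately show ?thesis using tr.be_ga_bound[OF j] by (simp add: p)
qed

end

section \<open>Switchings\<close>

text \<open>The numbers of rectangles that can be flipped to create, respectively destroy, the edge \<open>(j, k)\<close>.\<close>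

definition gcount :: "nat \<Rightarrow> nat \<Rightarrow> nat \<Rightarrow> nat \<Rightarrow> nat \<Rightarrow> nat \<Rightarrow> (nat \<times> nat) set \<Rightarrow> real" where
  "gcount m n J K j k G = (\<Sum>r\<in>{J<..m}. \<Sum>c\<in>{K<..n}. ent G r k * ent G j c * (1 - ent G r c))"

definition fcount :: "nat \<Rightarrow> nat \<Rightarrow> nat \<Rightarrow> nat \<Rightarrow> nat \<Rightarrow> nat \<Rightarrow> (nat \<times> nat) set \<Rightarrow> real" where
  "fcount m n J K j k G = (\<Sum>r\<in>{J<..m}. \<Sum>c\<in>{K<..n}. (1 - ent G r k) * (1 - ent G j c) * ent G r c)"

text \<open>Double counting of pairs of graphs related by a flip. For fixed (r,c) the flip is a
  bijection between the graphs counted on either side; as \<open>r\<close> > \<open>J\<close> and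
  \<open>c\<close> > \<open>K\<close>, the only cell of the corner that changes is (j,k).\<close>

lemma switching:
  assumes Jm: "J < m" and Kn: "K < n" and H: "H \<subseteq> {1..J} \<times> {1..K}"
    and j: "j \<in> {1..J}" and k: "k \<in> {1..K}" and jk: "(j, k) \<notin> H"
  shows "(\<Sum>G\<in>bip_ext.Om m n s t J K (insert (j, k) H). fcount m n J K j k G)
       = (\<Sum>G\<in>bip_ext.Om m n s t J K H. gcount m n J K j k G)"
proof -
  interpret A: bip_ext m n s t J K H by unfold_locales (use assms in auto)
  interpret B: bip_ext m n s t J K "insert (j, k) H" by unfold_locales (use assms in auto)
  have *: "(\<Sum>G\<in>B.Om. (1 - ent G r k) * (1 - ent G j c) * ent G r c)
      = (\<Sum>G\<in>A.Om. ent G r k * ent G j c * (1 - ent G r c))"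
    if r: "r \<in> {J<..m}" and c: "c \<in> {K<..n}" for r c
  proof -
    define PB where "PB = {G \<in> B.Om. (r, k) \<notin> G \<and> (j, c) \<notin> G \<and> (r, c) \<in> G}"
    define PA where "PA = {G \<in> A.Om. (r, k) \<in> G \<and> (j, c) \<in> G \<and> (r, c) \<notin> G}"
    let ?f = "flip j r k c"
    have mem: "j \<in> {1..m}" "r \<in> {1..m}" "k \<in> {1..n}" "c \<in> {1..n}" "j \<noteq> r" "k \<noteq> c"
      using Jm Kn j k r c by auto
    have jkB: "(j, k) \<in> G" if "G \<in> B.Om" for G
      using that unfolding B.Om_def induced_def by blast
    have jkA: "(j, k) \<notin> G" if "G \<in> A.Om" for G
      using that jk j k unfolding A.Om_def induced_def by blast
    have BA: "?f G \<in> PA" if "G \<in> PB" for G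
    proof -
      have G: "G \<in> bip_graphs m n s t" "induced G J K = insert (j, k) H" "(j, k) \<in> G"
         "(r, k) \<notin> G" "(j, c) \<notin> G" "(r, c) \<in> G"
        using that jkB unfolding PB_def B.Om_def by auto
      then have "alternating j r k c G" by (simp add: alternating_def)
      then have "?f G \<in> bip_graphs m n s t" using G(1) mem by (intro flip_bip_graphs) auto
      moreover have "induced (?f G) J K = H"
      proof (rule set_eqI, clarify)
        fix x y
        have "(x, y) \<in> induced G J K \<longleftrightarrow> (x, y) = (j, k) \<or> (x, y) \<in> H" using G(2) by simp
        then show "(x, y) \<in> induced (?f G) J K \<longleftrightarrow> (x, y) \<in> H"
          using r c j k jk G(3) H unfolding induced_def by (auto simp: mem_flip)
      qed
      ultimately show ?thesis using G mem by (auto simp: PA_def A.Om_def mem_flip)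
    qed
    have AB: "?f G \<in> PB" if "G \<in> PA" for G
    proof -
      have G: "G \<in> bip_graphs m n s t" "induced G J K = H" "(j, k) \<notin> G"
         "(r, k) \<in> G" "(j, c) \<in> G" "(r, c) \<notin> G"
        using that jkA unfolding PA_def A.Om_def by auto
      then have "alternating j r k c G" by (simp add: alternating_def)
      then have "?f G \<in> bip_graphs m n s t" using G(1) mem by (intro flip_bip_graphs) auto
      moreover have "induced (?f G) J K = insert (j, k) H"
      proof (rule set_eqI, clarify)
        fix x y
        have "(x, y) \<in> induced G J K \<longleftrightarrow> (x, y) \<in> H" using G(2) by simp
        then show "(x, y) \<in> induced (?f G) J K \<longleftrightarrow> (x, y) \<in> insert (j, k) H"
          using r c j k jk G(3) H unfolding induced_def by (auto simp: mem_flip)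
      qed
      ultimately show ?thesis using G mem by (auto simp: PB_def B.Om_def mem_flip)
    qed
    have "bij_betw ?f PB PA"
      by (rule bij_betw_byWitness[of _ ?f]) (use AB BA in auto)
    then have "card PB = card PA" by (rule bij_betw_same_card)
    moreover have "(\<Sum>G\<in>B.Om. (1 - ent G r k) * (1 - ent G j c) * ent G r c) = real (card PB)"
    proof -
      have "(\<Sum>G\<in>B.Om. (1 - ent G r k) * (1 - ent G j c) * ent G r c)
        = (\<Sum>G\<in>B.Om. of_bool ((r, k) \<notin> G \<and> (j, c) \<notin> G \<and> (r, c) \<in> G))"
        by (rule sum.cong) (auto simp: ent_def)
      then show ?thesis using B.finite_Om by (simp add: PB_def Int_def)
    qed
    moreover have "(\<Sum>G\<in>A.Om. ent G r k * ent G j c * (1 - ent G r c)) = real (card PA)"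
    proof -
      have "(\<Sum>G\<in>A.Om. ent G r k * ent G j c * (1 - ent G r c))
        = (\<Sum>G\<in>A.Om. of_bool ((r, k) \<in> G \<and> (j, c) \<in> G \<and> (r, c) \<notin> G))"
        by (rule sum.cong) (auto simp: ent_def)
      then show ?thesis using A.finite_Om by (simp add: PA_def Int_def)
    qed
    ultimately show ?thesis by simp
  qed
  show ?thesis
    unfolding fcount_def gcount_def sum_swap3[of _ "\<lambda>_. {K<..n}" "{J<..m}" A.Om]
       sum_swap3[of _ "\<lambda>_. {K<..n}" "{J<..m}" B.Om]
    by (rule sum.cong[OF refl], rule sum.cong[OF refl]) (rule *)
qed

context bip_ext
begin

text \<open>Substitute mean plus deviation for every factor. The terms with a single deviation, and
  those with \<open>al\<close> times \<open>be\<close>, sum to zero exactly; only the two pairings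
  with \<open>ga\<close> and the triple product survive.\<close>

lemma gcount_expand:
  assumes G: "G \<in> Om" and j: "j \<in> {1..J}" and k: "k \<in> {1..K}"
  shows "gcount m n J K j k G = (real m - real J) * (real n - real K) * (p k * q j * (1 - rho))
    - q j * (\<Sum>r\<in>{J<..m}. \<Sum>c\<in>{K<..n}. be k G r * ga G r c)
    - p k * (\<Sum>r\<in>{J<..m}. \<Sum>c\<in>{K<..n}. al j G c * ga G r c)
    - (\<Sum>r\<in>{J<..m}. \<Sum>c\<in>{K<..n}. al j G c * be k G r * ga G r c)" (is ?g)
  and "fcount m n J K j k G = (real m - real J) * (real n - real K) * ((1 - p k) * (1 - q j) * rho)
    - (1 - q j) * (\<Sum>r\<in>{J<..m}. \<Sum>c\<in>{K<..n}. be k G r * ga G r c)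
    - (1 - p k) * (\<Sum>r\<in>{J<..m}. \<Sum>c\<in>{K<..n}. al j G c * ga G r c)
    + (\<Sum>r\<in>{J<..m}. \<Sum>c\<in>{K<..n}. al j G c * be k G r * ga G r c)" (is ?f)
proof -
  let ?R = "{J<..m}" and ?C = "{K<..n}"
  have a0: "(\<Sum>r\<in>?R. \<Sum>c\<in>?C. x * al j G c) = 0" for x
    using al_sum[OF G j] by (simp flip: sum_distrib_left)
  have b0: "(\<Sum>r\<in>?R. \<Sum>c\<in>?C. x * be k G r) = 0" for x
    using be_sum[OF G k] by (simp flip: sum_distrib_left)
  have ab0: "(\<Sum>r\<in>?R. \<Sum>c\<in>?C. x * (al j G c * be k G r)) = 0" for x
    using al_sum[OF G j] by (simp add: mult.assoc[symmetric] flip: sum_distrib_left sum_distrib_right)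
  have c0: "(\<Sum>r\<in>?R. \<Sum>c\<in>?C. x * ga G r c) = 0" for x
    using ga_sum[OF G] by (simp flip: sum_distrib_left)
  have k0: "(\<Sum>r\<in>?R. \<Sum>c\<in>?C. x) = (real m - real J) * (real n - real K) * x" for x :: real
    using card_R card_C by simp
  have e1: "ent G r k * ent G j c * (1 - ent G r c)
    = p k * q j * (1 - rho) + p k * (1 - rho) * al j G c + q j * (1 - rho) * be k G r
      + (1 - rho) * (al j G c * be k G r) - p k * q j * ga G r c - p k * (al j G c * ga G r c)
      - q j * (be k G r * ga G r c) - al j G c * be k G r * ga G r c" for r c
    unfolding al_def be_def ga_def by (simp add: algebra_simps)
  have e2: "(1 - ent G r k) * (1 - ent G j c) * ent G r c
    = (1 - p k) * (1 - q j) * rho - (1 - p k) * rho * al j G c - (1 - q j) * rho * be k G r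
      + rho * (al j G c * be k G r) + (1 - p k) * (1 - q j) * ga G r c - (1 - p k) * (al j G c * ga G r c)
      - (1 - q j) * (be k G r * ga G r c) + al j G c * be k G r * ga G r c" for r c
    unfolding al_def be_def ga_def by (simp add: algebra_simps)
  show ?g
    unfolding gcount_def e1 sum.distrib sum_subtractf a0 b0 ab0 c0 k0 by (simp add: sum_distrib_left)
  show ?f
    unfolding fcount_def e2 sum.distrib sum_subtractf a0 b0 ab0 c0 k0 by (simp add: sum_distrib_left)
qed

end

section \<open>Expansion of the log odds\<close>

text \<open>The remainder has derivative x^2/(1+x), so the mean value theorem gives a cubic bound on
  both sides of 0.\<close>

lemma ln_cubic_bound:
  fixes u :: real
  assumes "\<bar>u\<bar> \<le> 1 / 2"
  shows "\<bar>ln (1 + u) - (u - u\<^sup>2 / 2)\<bar> \<le> 2 * \<bar>u\<bar> ^ 3"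
proof -
  define f where "f x = ln (1 + x) - (x - x\<^sup>2 / 2)" for x :: real
  have der: "(f has_real_derivative x\<^sup>2 / (1 + x)) (at x)" if "\<bar>x\<bar> \<le> 1 / 2" for x
  proof -
    have "1 + x > 0" using that by linarith
    moreover have "1 / (1 + x) - (1 - x) = x\<^sup>2 / (1 + x)"
      using \<open>1 + x > 0\<close> by (simp add: field_simps power2_eq_square)
    ultimately show ?thesis unfolding f_def by (auto intro!: derivative_eq_intros)
  qed
  have bd: "\<bar>x\<^sup>2 / (1 + x)\<bar> \<le> 2 * u\<^sup>2" if "\<bar>x\<bar> \<le> \<bar>u\<bar>" for x
  proof -
    have "1 / 2 \<le> 1 + x" using that assms by linarith
    then have "x\<^sup>2 / (1 + x) \<le> x\<^sup>2 / (1 / 2)" by (intro divide_left_mono) auto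
    also have "\<dots> \<le> 2 * u\<^sup>2" using that by (simp add: abs_le_square_iff)
    finally show ?thesis using \<open>1 / 2 \<le> 1 + x\<close> by (subst abs_of_nonneg) auto
  qed
  have f0: "f 0 = 0" by (simp add: f_def)
  have "\<exists>c. \<bar>c\<bar> \<le> \<bar>u\<bar> \<and> f u = u * (c\<^sup>2 / (1 + c))"
  proof (cases "u = 0")
    case True
    then show ?thesis using f0 by auto
  next
    case False
    show ?thesis
    proof (cases "u > 0")
      case True
      have "\<exists>z. 0 < z \<and> z < u \<and> f u - f 0 = (u - 0) * (z\<^sup>2 / (1 + z))"
        using True assms by (intro MVT2 der) auto
      then show ?thesis using f0 by force
    next
      case neg: False
      have "\<exists>z. u < z \<and> z < 0 \<and> f 0 - f u = (0 - u) * (z\<^sup>2 / (1 + z))"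
        using neg False assms by (intro MVT2 der) auto
      then obtain z where "u < z" "z < 0" "f u = u * (z\<^sup>2 / (1 + z))" using f0 by auto
      then show ?thesis by (intro exI[of _ z]) auto
    qed
  qed
  then obtain c where c: "\<bar>c\<bar> \<le> \<bar>u\<bar>" "f u = u * (c\<^sup>2 / (1 + c))" by blast
  have "\<bar>f u\<bar> = \<bar>u\<bar> * \<bar>c\<^sup>2 / (1 + c)\<bar>" unfolding c by (rule abs_mult)
  also have "\<dots> \<le> \<bar>u\<bar> * (2 * u\<^sup>2)" using bd[OF c(1)] by (intro mult_left_mono) auto
  also have "\<dots> = 2 * \<bar>u\<bar> ^ 3" by (cases "0 \<le> u") (simp_all add: power3_eq_cube power2_eq_square)
  finally show ?thesis by (simp add: f_def)
qed

lemma abs_mult_le: "\<bar>x\<bar> \<le> a \<Longrightarrow> \<bar>y\<bar> \<le> b \<Longrightarrow> \<bar>x * y\<bar> \<le> a * (b :: real)"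
  unfolding abs_mult by (rule mult_mono) auto

text \<open>With a = 1/l and b = 1/(1-l) the logarithms are those of q/l before, and of (1-q')/(1-l)
  after, adding the edge. The factors in \<kappa> are 1 + O(h) and cost only order h^3 here; they
  are inserted because \<open>side_term_identity\<close> then turns the expansion into an exact
  increment.\<close>

lemma log_side_expansion:
  fixes a b u e \<kappa> h L :: real
  assumes ab: "0 < a" "0 < b" "a + b \<le> L" and L2: "2 \<le> L" and h: "0 < h" "4 * L\<^sup>2 * h \<le> 1"
    and u: "\<bar>u\<bar> \<le> h" and e: "0 \<le> e" "e \<le> h\<^sup>2" and \<kappa>: "0 \<le> \<kappa>" "\<kappa> \<le> h"
  shows "\<bar>ln (1 - a * u) - ln (1 + b * (u + e))
     - ((a - b) * e * (1 - \<kappa>) / 2 - (a + b) * (1 - \<kappa>\<^sup>2) * (2 * u + e) / 2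
        - (a\<^sup>2 - b\<^sup>2) * (3 * u\<^sup>2 + 3 * u * e + e\<^sup>2) * (1 - \<kappa>)\<^sup>2 / 6)\<bar> \<le> 21 * L ^ 3 * h ^ 3"
proof -
  have Lh: "L * h \<le> 1 / 8"
  proof -
    have "2 * (L * h) \<le> L * (L * h)" using L2 h by (intro mult_right_mono) auto
    then show ?thesis using h(2) by (simp add: power2_eq_square mult_ac)
  qed
  have "2 * h \<le> L * h" using L2 h by (intro mult_right_mono) auto
  then have h1: "h \<le> 1 / 16" using Lh by linarith
  have hh: "h\<^sup>2 \<le> h" using h1 h mult_left_le[of h h] by (simp add: power2_eq_square)
  have h43: "h ^ 4 \<le> h ^ 3" using h1 h by (intro power_decreasing) auto
  have aL: "a \<le> L" "b \<le> L" "\<bar>a - b\<bar> \<le> L" "\<bar>a + b\<bar> \<le> L" "\<bar>a\<bar> \<le> L" "\<bar>b\<bar> \<le> L" using ab by auto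
  have sq: "\<bar>a\<^sup>2 - b\<^sup>2\<bar> \<le> L\<^sup>2"
  proof -
    have "a\<^sup>2 - b\<^sup>2 = (a - b) * (a + b)" by (simp add: power2_eq_square algebra_simps)
    then show ?thesis using abs_mult_le[OF aL(3,4)] by (simp add: power2_eq_square)
  qed
  have b2: "\<bar>b\<^sup>2\<bar> \<le> L\<^sup>2" using abs_mult_le[OF aL(6,6)] by (simp add: power2_eq_square)
  have ue: "\<bar>u + e\<bar> \<le> 2 * h" using u e hh by linarith
  define x where "x = - (a * u)"
  define y where "y = b * (u + e)"
  have x: "\<bar>x\<bar> \<le> L * h" unfolding x_def abs_minus_cancel by (rule abs_mult_le[OF aL(5) u])
  have y: "\<bar>y\<bar> \<le> 2 * (L * h)" using abs_mult_le[OF aL(6) ue] by (simp add: y_def mult_ac)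
  have lx: "\<bar>ln (1 + x) - (x - x\<^sup>2 / 2)\<bar> \<le> 2 * (L * h) ^ 3"
  proof -
    have "\<bar>x\<bar> ^ 3 \<le> (L * h) ^ 3" using x by (intro power_mono) auto
    then show ?thesis using ln_cubic_bound[of x] x Lh by linarith
  qed
  have ly: "\<bar>ln (1 + y) - (y - y\<^sup>2 / 2)\<bar> \<le> 16 * (L * h) ^ 3"
  proof -
    have "\<bar>y\<bar> ^ 3 \<le> (2 * (L * h)) ^ 3" using y by (intro power_mono) auto
    then have "\<bar>y\<bar> ^ 3 \<le> 8 * (L * h) ^ 3" by (simp only: power_mult_distrib) simp
    then show ?thesis using ln_cubic_bound[of y] y Lh by linarith
  qed
  define D where "D = (a - b) * e * (1 - \<kappa>) / 2 - (a + b) * (1 - \<kappa>\<^sup>2) * (2 * u + e) / 2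
        - (a\<^sup>2 - b\<^sup>2) * (3 * u\<^sup>2 + 3 * u * e + e\<^sup>2) * (1 - \<kappa>)\<^sup>2 / 6"
  define t1 where "t1 = (a + b) * (\<kappa>\<^sup>2 * u)"
  define t2 where "t2 = (a - b) * (e * \<kappa>)"
  define t3 where "t3 = (a + b) * (e * \<kappa>\<^sup>2)"
  define t4 where "t4 = (a\<^sup>2 - b\<^sup>2) * ((\<kappa> * (\<kappa> - 2)) * u\<^sup>2)"
  define t5 where "t5 = b\<^sup>2 * (u * e + e * e / 2)"
  define t6 where "t6 = (a\<^sup>2 - b\<^sup>2) * ((u * e / 2 + e * e / 6) * (1 - \<kappa>)\<^sup>2)"
  \<comment> \<open>An exact identity: \<open>t1\<close> to \<open>t4\<close> come from the factors
    in \<kappa>, while \<open>t5\<close> and \<open>t6\<close> collect the products u e and e^2.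
    Each term is of order h^3.\<close>
  have eq: "(x - x\<^sup>2 / 2) - (y - y\<^sup>2 / 2) - D = - t1 + t2 / 2 - t3 / 2 + t4 / 2 + t5 + t6"
    unfolding x_def y_def D_def t1_def t2_def t3_def t4_def t5_def t6_def
    by (simp add: field_simps power2_eq_square)
  have k1: "\<bar>\<kappa>\<bar> \<le> h" and e1: "\<bar>e\<bar> \<le> h\<^sup>2" using \<kappa> e by auto
  have k2: "\<bar>\<kappa>\<^sup>2\<bar> \<le> h\<^sup>2" using abs_mult_le[OF k1 k1] by (simp add: power2_eq_square)
  have u2: "\<bar>u\<^sup>2\<bar> \<le> h\<^sup>2" using abs_mult_le[OF u u] by (simp add: power2_eq_square)
  have h3: "h\<^sup>2 * h = h ^ 3" "h\<^sup>2 * h\<^sup>2 = h ^ 4" "h * h\<^sup>2 = h ^ 3"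
    by (simp_all add: power2_eq_square power3_eq_cube power4_eq_xxxx)
  have B1: "\<bar>t1\<bar> \<le> L * h ^ 3" unfolding t1_def
    using abs_mult_le[OF aL(4) abs_mult_le[OF k2 u]] by (simp only: h3)
  have B2: "\<bar>t2\<bar> \<le> L * h ^ 3" unfolding t2_def
    using abs_mult_le[OF aL(3) abs_mult_le[OF e1 k1]] by (simp only: h3)
  have B3: "\<bar>t3\<bar> \<le> L * h ^ 3"
  proof -
    have "\<bar>t3\<bar> \<le> L * h ^ 4" unfolding t3_def
      using abs_mult_le[OF aL(4) abs_mult_le[OF e1 k2]] by (simp only: h3)
    also have "\<dots> \<le> L * h ^ 3" using h43 L2 by (intro mult_left_mono) auto
    finally show ?thesis .
  qed
  have B4: "\<bar>t4\<bar> \<le> 2 * (L\<^sup>2 * h ^ 3)"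
  proof -
    have "\<bar>\<kappa> - 2\<bar> \<le> 2" using \<kappa> h1 by auto
    from abs_mult_le[OF sq abs_mult_le[OF abs_mult_le[OF k1 this] u2]]
    have "\<bar>t4\<bar> \<le> L\<^sup>2 * (h * 2 * h\<^sup>2)" unfolding t4_def .
    moreover have "L\<^sup>2 * (h * 2 * h\<^sup>2) = 2 * (L\<^sup>2 * h ^ 3)" by (simp add: h3(3)[symmetric])
    ultimately show ?thesis by simp
  qed
  have ue1: "\<bar>u * e\<bar> \<le> h ^ 3" using abs_mult_le[OF u e1] by (simp only: h3)
  have ee1: "\<bar>e * e\<bar> \<le> h ^ 3" using abs_mult_le[OF e1 e1] h43 by (simp only: h3)
  have B5: "\<bar>t5\<bar> \<le> 2 * (L\<^sup>2 * h ^ 3)"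
  proof -
    have "\<bar>u * e + e * e / 2\<bar> \<le> 2 * h ^ 3" using ue1 ee1 by linarith
    from abs_mult_le[OF b2 this] show ?thesis unfolding t5_def by simp
  qed
  have B6: "\<bar>t6\<bar> \<le> L\<^sup>2 * h ^ 3"
  proof -
    have 1: "\<bar>u * e / 2 + e * e / 6\<bar> \<le> h ^ 3" using ue1 ee1 by linarith
    have 2: "\<bar>(1 - \<kappa>)\<^sup>2\<bar> \<le> 1" using \<kappa> h1 by (simp add: abs_square_le_1)
    from abs_mult_le[OF sq abs_mult_le[OF 1 2]] show ?thesis unfolding t6_def by simp
  qed
  have L3: "L * h ^ 3 \<le> L ^ 3 * h ^ 3 / 4" "L\<^sup>2 * h ^ 3 \<le> L ^ 3 * h ^ 3 / 2"
  proof -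
    have "2 * (L * L) \<le> L * (L * L)" "4 * L \<le> (L * L) * L" 
      using L2 mult_mono[of 2 L 2 L] by (auto intro!: mult_right_mono)
    then have "4 * L * h ^ 3 \<le> (L * L) * L * h ^ 3" "2 * (L * L) * h ^ 3 \<le> L * (L * L) * h ^ 3"
      using h by (auto intro!: mult_right_mono)
    then show "L * h ^ 3 \<le> L ^ 3 * h ^ 3 / 4" "L\<^sup>2 * h ^ 3 \<le> L ^ 3 * h ^ 3 / 2"
      by (simp_all add: power2_eq_square power3_eq_cube mult_ac)
  qed
  have "\<bar>(x - x\<^sup>2 / 2) - (y - y\<^sup>2 / 2) - D\<bar> \<le> 3 * (L ^ 3 * h ^ 3)"
    unfolding eq using B1 B2 B3 B4 B5 B6 L3 unfolding abs_le_iff by linarith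
  moreover have "(L * h) ^ 3 = L ^ 3 * h ^ 3" by (rule power_mult_distrib)
  \<comment> \<open>21 = 2 + 16 + 3: the two Taylor remainders and the polynomial
    difference.\<close>
  ultimately have "\<bar>ln (1 + x) - ln (1 + y) - D\<bar> \<le> 21 * (L ^ 3 * h ^ 3)"
    using lx ly by linarith
  then show ?thesis unfolding D_def x_def y_def by simp
qed

text \<open>In the application \<open>u\<close>, \<open>y\<close> are the normalised degree deviations of \<open>u_j\<close>, \<open>v_k\<close>, \<open>e = 1 / (n - K)\<close>,
  \<open>g = 1 / (m - J)\<close>, \<open>\<kappa> = K / n\<close>, \<open>\<iota> = J / m\<close>, and primes refer to the graph with the edge \<open>(j, k)\<close> added.\<close>

lemma log_odds_expansion:
  fixes l u y e g \<kappa> \<iota> \<omega> \<delta>0 \<delta>1 h L :: real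
  assumes l: "0 < l" "l < 1" and vL: "1 / (l * (1 - l)) \<le> L" and L2: "2 \<le> L"
    and h: "0 < h" "4 * L\<^sup>2 * h \<le> 1"
    and u: "\<bar>u\<bar> \<le> h" and y: "\<bar>y\<bar> \<le> h" and e: "0 \<le> e" "e \<le> h\<^sup>2" and g: "0 \<le> g" "g \<le> h\<^sup>2"
    and \<kappa>: "0 \<le> \<kappa>" "\<kappa> \<le> h" and \<iota>: "0 \<le> \<iota>" "\<iota> \<le> h" and \<omega>: "\<bar>\<omega>\<bar> \<le> h\<^sup>2"
    and \<delta>0: "\<bar>\<delta>0\<bar> \<le> h ^ 3" and \<delta>1: "\<bar>\<delta>1\<bar> \<le> h ^ 3"
  defines "p \<equiv> l - y" and "q \<equiv> l - u" and "p' \<equiv> l - y - g" and "q' \<equiv> l - u - e"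
    and "a \<equiv> 1 / l" and "b \<equiv> 1 / (1 - l)"
  defines "G \<equiv> p * q * (1 - (l + \<omega>) + (1 - p) * e + (1 - q) * g) + \<delta>0"
    and "F \<equiv> (1 - p') * (1 - q') * ((l + \<omega> + e * g) + p' * e + q' * g) + \<delta>1"
    and "D \<equiv> \<lambda>u e \<kappa>. (a - b) * e * (1 - \<kappa>) / 2 - (a + b) * (1 - \<kappa>\<^sup>2) * (2 * u + e) / 2
        - (a\<^sup>2 - b\<^sup>2) * (3 * u\<^sup>2 + 3 * u * e + e\<^sup>2) * (1 - \<kappa>)\<^sup>2 / 6"
  shows "0 < G" and "0 < F"
    and "\<bar>ln (G / F) - ln (l / (1 - l)) - (D u e \<kappa> + D y g \<iota> - (a + b) * (\<omega> + e * g / 2) * (1 - \<kappa>) * (1 - \<iota>))\<bar>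
      \<le> 56 * L ^ 3 * h ^ 3"
proof -
  have a0: "0 < a" "0 < b" using l by (auto simp: a_def b_def)
  have "a + b = 1 / (l * (1 - l))" using l by (simp add: a_def b_def field_simps)
  then have abL: "a + b \<le> L" using vL by simp
  have al: "a * l = 1" "b * (1 - l) = 1" using l by (auto simp: a_def b_def)
  have aL: "a \<le> L" "b \<le> L" "\<bar>a + b\<bar> \<le> L" "\<bar>a\<bar> \<le> L" "\<bar>b\<bar> \<le> L" using a0 abL by auto
  have Lh: "L * h \<le> 1 / 8"
  proof -
    have "2 * (L * h) \<le> L * (L * h)" using L2 h by (intro mult_right_mono) auto
    then show ?thesis using h(2) by (simp add: power2_eq_square mult_ac)
  qed
  have "2 * h \<le> L * h" using L2 h by (intro mult_right_mono) auto
  then have h1: "h \<le> 1 / 16" using Lh by linarith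
  have hh: "h\<^sup>2 \<le> h" using h1 h mult_left_le[of h h] by (simp add: power2_eq_square)
  have h43: "h ^ 4 \<le> h ^ 3" using h1 h by (intro power_decreasing) auto
  have h3: "h\<^sup>2 * h = h ^ 3" "h\<^sup>2 * h\<^sup>2 = h ^ 4" "h * h\<^sup>2 = h ^ 3"
    by (simp_all add: power2_eq_square power3_eq_cube power4_eq_xxxx)
  have au: "\<bar>a * u\<bar> \<le> L * h" and ay: "\<bar>a * y\<bar> \<le> L * h" and bu: "\<bar>b * u\<bar> \<le> L * h" and by': "\<bar>b * y\<bar> \<le> L * h"
    by (intro abs_mult_le aL u y)+
  have ue: "\<bar>u + e\<bar> \<le> 2 * h" and yg: "\<bar>y + g\<bar> \<le> 2 * h" using u y e g hh by auto
  have aue: "\<bar>a * (u + e)\<bar> \<le> 2 * (L * h)" and ayg: "\<bar>a * (y + g)\<bar> \<le> 2 * (L * h)"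
    and bue: "\<bar>b * (u + e)\<bar> \<le> 2 * (L * h)" and byg: "\<bar>b * (y + g)\<bar> \<le> 2 * (L * h)"
    unfolding mult.left_commute[of 2 L h] by (intro abs_mult_le aL ue yg)+
  have pe: "p = l * (1 - a * y)" "q = l * (1 - a * u)" using al by (simp_all add: p_def q_def algebra_simps)
  have scale: "(1 - l) * (1 + b * z) = 1 - l + z" "l * (1 - a * z) = l - z" for z
  proof -
    have "(1 - l) * (1 + b * z) = (1 - l) + b * (1 - l) * z" "l * (1 - a * z) = l - a * l * z"
      by (simp_all add: algebra_simps)
    then show "(1 - l) * (1 + b * z) = 1 - l + z" "l * (1 - a * z) = l - z" unfolding al by simp_all
  qed
  have pe': "1 - p' = (1 - l) * (1 + b * (y + g))" "1 - q' = (1 - l) * (1 + b * (u + e))"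
    unfolding scale by (simp_all add: p'_def q'_def)
  have lL: "1 / L \<le> l" "1 / L \<le> 1 - l"
    using aL l L2 by (auto simp: a_def b_def field_simps)
  have half: "1 / (2 * L) \<le> p" "1 / (2 * L) \<le> q" "1 / (2 * L) \<le> 1 - p'" "1 / (2 * L) \<le> 1 - q'"
  proof -
    have "(1 / L) * (1 / 2) \<le> x * (1 + z)" if "1 / L \<le> x" "\<bar>z\<bar> \<le> 2 * (L * h)" for x z
      using that Lh L2 order_trans[of 0 "1 / L" x] by (intro mult_mono) auto
    from this[OF lL(1), of "- (a * y)"] this[OF lL(1), of "- (a * u)"]
      this[OF lL(2), of "b * (y + g)"] this[OF lL(2), of "b * (u + e)"]
    show "1 / (2 * L) \<le> p" "1 / (2 * L) \<le> q" "1 / (2 * L) \<le> 1 - p'" "1 / (2 * L) \<le> 1 - q'"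
      unfolding pe pe' using au ay bue byg Lh by (auto simp: mult_ac)
  qed
  have iL: "0 < 1 / (2 * L)" using L2 by simp
  have pos: "0 < p" "0 < q" "0 < 1 - p'" "0 < 1 - q'" using half iL by linarith+
  have dq: "\<bar>d / (x * z)\<bar> \<le> 4 * L\<^sup>2 * h ^ 3" if d: "\<bar>d\<bar> \<le> h ^ 3" and "1 / (2 * L) \<le> x" "1 / (2 * L) \<le> z" for d x z
  proof -
    have "0 \<le> x" by (rule order_trans[OF less_imp_le[OF iL] that(2)])
    then have "1 / (2 * L) * (1 / (2 * L)) \<le> x * z"
      by (intro mult_mono that(2,3)) (use L2 in simp_all)
    then have xz: "1 / (4 * L\<^sup>2) \<le> x * z" by (simp add: power2_eq_square)
    have p4: "0 < 1 / (4 * L\<^sup>2)" using L2 by simp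
    have "0 < x * z" by (rule less_le_trans[OF p4 xz])
    then have "\<bar>d / (x * z)\<bar> = \<bar>d\<bar> / (x * z)" by (simp only: abs_divide abs_of_pos)
    also have "\<dots> \<le> h ^ 3 / (1 / (4 * L\<^sup>2))"
      using d xz p4 h by (intro frac_le) auto
    finally show ?thesis by (simp add: mult_ac)
  qed
  \<comment> \<open>The additive errors become relative ones. The densities are at least 1/(2L), so
    this costs a factor 4L^2.\<close>
  define d0 where "d0 = \<delta>0 / (p * q)"
  define d1 where "d1 = \<delta>1 / ((1 - p') * (1 - q'))"
  have d0: "\<bar>d0\<bar> \<le> 4 * L\<^sup>2 * h ^ 3" unfolding d0_def by (rule dq[OF \<delta>0 half(1,2)])
  have d1: "\<bar>d1\<bar> \<le> 4 * L\<^sup>2 * h ^ 3" unfolding d1_def by (rule dq[OF \<delta>1 half(3,4)])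
  \<comment> \<open>With these, \<open>G\<close> is \<open>p * q * (1 - l) * (1 + z0)\<close> and
    \<open>F\<close> is \<open>(1 - p') * (1 - q') * l * (1 + z1)\<close>. Both \<open>z0\<close>
    and \<open>z1\<close> are of order h^2, so a first-order expansion of their logarithms is
    enough.\<close>
  define z0 where "z0 = - (b * \<omega>) + (1 + b * y) * e + (1 + b * u) * g + b * d0"
  define z1 where "z1 = a * \<omega> + a * (e * g) + (1 - a * (y + g)) * e + (1 - a * (u + e)) * g + a * d1"
  have G_eq: "G = p * q * (1 - l) * (1 + z0)"
  proof -
    have "(1 - l) * (1 + b * y) = 1 - p" "(1 - l) * (1 + b * u) = 1 - q"
      unfolding scale by (simp_all add: p_def q_def)
    then have f1: "(1 - l) * ((1 + b * y) * e) = (1 - p) * e" "(1 - l) * ((1 + b * u) * g) = (1 - q) * g"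
      by (simp_all only: mult.assoc[symmetric])
    have f2: "(1 - l) * (b * \<omega>) = \<omega>" "(1 - l) * (b * d0) = d0"
      using al by (simp_all add: mult.assoc[symmetric] mult.commute[of "1 - l"])
    have "(1 - l) * (1 + z0) = (1 - l) - (1 - l) * (b * \<omega>) + (1 - l) * ((1 + b * y) * e)
       + (1 - l) * ((1 + b * u) * g) + (1 - l) * (b * d0)"
      unfolding z0_def by (simp add: algebra_simps)
    then have "(1 - l) * (1 + z0) = 1 - (l + \<omega>) + (1 - p) * e + (1 - q) * g + d0"
      unfolding f1 f2 by simp
    then have "p * q * ((1 - l) * (1 + z0)) = p * q * (1 - (l + \<omega>) + (1 - p) * e + (1 - q) * g) + p * q * d0"
      by (simp only: distrib_left[of "p * q" _ d0])
    moreover have "p * q * d0 = \<delta>0" using pos by (simp add: d0_def)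
    ultimately show ?thesis by (simp add: G_def mult.assoc)
  qed
  have F_eq: "F = (1 - p') * (1 - q') * l * (1 + z1)"
  proof -
    have "l * (1 - a * (y + g)) = p'" "l * (1 - a * (u + e)) = q'"
      unfolding scale by (simp_all add: p'_def q'_def)
    then have f1: "l * ((1 - a * (y + g)) * e) = p' * e" "l * ((1 - a * (u + e)) * g) = q' * g"
      by (simp_all only: mult.assoc[symmetric])
    have f2: "l * (a * \<omega>) = \<omega>" "l * (a * d1) = d1" "l * (a * (e * g)) = e * g"
      using al by (simp_all add: mult.assoc[symmetric] mult.commute[of l])
    have "l * (1 + z1) = l + l * (a * \<omega>) + l * (a * (e * g)) + l * ((1 - a * (y + g)) * e)
       + l * ((1 - a * (u + e)) * g) + l * (a * d1)"
      unfolding z1_def by (simp add: algebra_simps)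
    then have "l * (1 + z1) = (l + \<omega> + e * g) + p' * e + q' * g + d1"
      unfolding f1 f2 by simp
    then have "(1 - p') * (1 - q') * (l * (1 + z1))
      = (1 - p') * (1 - q') * ((l + \<omega> + e * g) + p' * e + q' * g) + (1 - p') * (1 - q') * d1"
      by (simp only: distrib_left[of "(1 - p') * (1 - q')" _ d1])
    moreover have "(1 - p') * (1 - q') * d1 = \<delta>1" using pos by (simp add: d1_def)
    ultimately show ?thesis by (simp add: F_def mult.assoc)
  qed
  have L3: "8 * h ^ 3 \<le> L ^ 3 * h ^ 3" "4 * (L * h ^ 3) \<le> L ^ 3 * h ^ 3"
  proof -
    have "2 * 2 \<le> L * L" using L2 by (intro mult_mono) auto
    then have "2 * 2 * L \<le> L * L * L" using L2 by (intro mult_right_mono) auto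
    then have "4 * L \<le> L ^ 3" by (simp add: power3_eq_cube)
    moreover from this have "8 \<le> L ^ 3" using L2 by linarith
    ultimately have "4 * L \<le> L ^ 3" "8 \<le> L ^ 3" .
    then have "4 * L * h ^ 3 \<le> L ^ 3 * h ^ 3" "8 * h ^ 3 \<le> L ^ 3 * h ^ 3"
      using h by (auto intro!: mult_right_mono)
    then show "8 * h ^ 3 \<le> L ^ 3 * h ^ 3" "4 * (L * h ^ 3) \<le> L ^ 3 * h ^ 3" by auto
  qed
  have Ld: "\<bar>b * d0\<bar> \<le> 4 * (L ^ 3 * h ^ 3)" "\<bar>a * d1\<bar> \<le> 4 * (L ^ 3 * h ^ 3)"
    using abs_mult_le[OF aL(5) d0] abs_mult_le[OF aL(4) d1] by (auto simp: power2_eq_square power3_eq_cube mult_ac)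
  have Ld2: "4 * (L ^ 3 * h ^ 3) \<le> L * h\<^sup>2"
  proof -
    have "4 * (L ^ 3 * h ^ 3) = (4 * L\<^sup>2 * h) * (L * h\<^sup>2)" by (simp add: power2_eq_square power3_eq_cube)
    also have "\<dots> \<le> 1 * (L * h\<^sup>2)" using h L2 by (intro mult_right_mono) auto
    finally show ?thesis by simp
  qed
  have e1: "\<bar>e\<bar> \<le> h\<^sup>2" and g1: "\<bar>g\<bar> \<le> h\<^sup>2" using e g by auto
  have eg: "\<bar>e * g\<bar> \<le> h ^ 4" using abs_mult_le[OF e1 g1] by (simp only: h3)
  have h42: "h ^ 4 \<le> h\<^sup>2" using h1 h by (intro power_decreasing) auto
  have two: "\<bar>1 + b * y\<bar> \<le> 2" "\<bar>1 + b * u\<bar> \<le> 2" "\<bar>1 - a * (y + g)\<bar> \<le> 2" "\<bar>1 - a * (u + e)\<bar> \<le> 2"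
    using bu by' ayg aue Lh by auto
  have Lh2: "2 * h\<^sup>2 \<le> L * h\<^sup>2" using L2 by (intro mult_right_mono) auto
  have z0: "\<bar>z0\<bar> \<le> 5 * (L * h\<^sup>2)"
  proof -
    have "\<bar>b * \<omega>\<bar> \<le> L * h\<^sup>2" by (rule abs_mult_le[OF aL(5) \<omega>])
    moreover have "\<bar>(1 + b * y) * e\<bar> \<le> 2 * h\<^sup>2" "\<bar>(1 + b * u) * g\<bar> \<le> 2 * h\<^sup>2"
      by (intro abs_mult_le two e1 g1)+
    ultimately show ?thesis unfolding z0_def using Ld(1) Ld2 Lh2 unfolding abs_le_iff by linarith
  qed
  have z1: "\<bar>z1\<bar> \<le> 5 * (L * h\<^sup>2)"
  proof -
    have "\<bar>a * \<omega>\<bar> \<le> L * h\<^sup>2" by (rule abs_mult_le[OF aL(4) \<omega>])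
    moreover have "\<bar>a * (e * g)\<bar> \<le> L * h\<^sup>2" using eg h42 by (intro abs_mult_le[OF aL(4)]) auto
    moreover have "\<bar>(1 - a * (y + g)) * e\<bar> \<le> 2 * h\<^sup>2" "\<bar>(1 - a * (u + e)) * g\<bar> \<le> 2 * h\<^sup>2"
      by (intro abs_mult_le two e1 g1)+
    ultimately show ?thesis unfolding z1_def using Ld(2) Ld2 Lh2 unfolding abs_le_iff by linarith
  qed
  have Lhh: "5 * (L * h\<^sup>2) \<le> 1 / 2"
  proof -
    have "L * h\<^sup>2 = (L * h) * h" by (simp add: power2_eq_square)
    also have "\<dots> \<le> (1 / 8) * (1 / 16)" using Lh h1 h L2 by (intro mult_mono) auto
    finally show ?thesis by simp
  qed
  \<comment> \<open>The square of z is of order L^2 h^4, and 4 L^2 h <= 1 trades L^2 h for a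
    constant: 2 * 25/4 is below 16.\<close>
  have lnz: "\<bar>ln (1 + z) - z\<bar> \<le> 16 * h ^ 3" if "\<bar>z\<bar> \<le> 5 * (L * h\<^sup>2)" for z
  proof -
    have "\<bar>ln (1 + z) - z\<bar> \<le> 2 * z\<^sup>2"
      by (rule abs_ln_one_plus_x_minus_x_bound) (use that Lhh in linarith)
    moreover have "z\<^sup>2 \<le> (5 * (L * h\<^sup>2))\<^sup>2"
      using power_mono[OF that, of 2] by simp
    moreover have "(5 * (L * h\<^sup>2))\<^sup>2 = 25 / 4 * ((4 * L\<^sup>2 * h) * h ^ 3)"
      by (simp add: power2_eq_square power3_eq_cube)
    moreover have "(4 * L\<^sup>2 * h) * h ^ 3 \<le> 1 * h ^ 3" using h by (intro mult_right_mono) auto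
    ultimately have "\<bar>ln (1 + z) - z\<bar> \<le> 2 * (25 / 4 * (1 * h ^ 3))" by linarith
    moreover have "0 \<le> h ^ 3" using h by simp
    ultimately show ?thesis by linarith
  qed
  have zpos: "0 < 1 + z0" "0 < 1 + z1" using z0 z1 Lhh by linarith+
  show Gp: "0 < G" unfolding G_eq using pos l zpos by simp
  show Fp: "0 < F" unfolding F_eq using pos l zpos by simp
  define Dz where "Dz = - ((a + b) * (\<omega> + e * g / 2) * (1 - \<kappa>) * (1 - \<iota>))"
  have zz: "\<bar>z0 - z1 - Dz\<bar> \<le> 10 * (L ^ 3 * h ^ 3)"
  proof -
    define T where "T = (1 - \<kappa>) * (1 - \<iota>) - 1"
    have T: "\<bar>T\<bar> \<le> 2 * h"
    proof -
      have "T = - \<kappa> - \<iota> * (1 - \<kappa>)" by (simp add: T_def algebra_simps)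
      moreover have "0 \<le> \<iota> * (1 - \<kappa>)" "\<iota> * (1 - \<kappa>) \<le> \<iota>" using \<kappa> \<iota> h1 by (auto simp: mult_left_le)
      ultimately show ?thesis using \<kappa> \<iota> by linarith
    qed
    have eq: "z0 - z1 - Dz = (a + b) * (\<omega> * T) + (a + b) * (e * g * (1 + T)) / 2 - a * (e * g)
       + (a + b) * (y * e) + (a + b) * (u * g) + 2 * (a * (e * g)) + b * d0 - a * d1"
      unfolding z0_def z1_def Dz_def T_def by (simp add: algebra_simps)
    have "\<bar>(a + b) * (\<omega> * T)\<bar> \<le> 2 * (L * h ^ 3)"
      using abs_mult_le[OF aL(3) abs_mult_le[OF \<omega> T]] by (simp add: h3(1)[symmetric] mult_ac)
    moreover have "\<bar>(a + b) * (e * g * (1 + T))\<bar> \<le> 2 * (L * h ^ 3)"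
    proof -
      have "\<bar>1 + T\<bar> \<le> 2" using T h1 by linarith
      from abs_mult_le[OF aL(3) abs_mult_le[OF eg this]]
      have "\<bar>(a + b) * (e * g * (1 + T))\<bar> \<le> 2 * (L * h ^ 4)" by simp
      moreover have "L * h ^ 4 \<le> L * h ^ 3" using h43 L2 by (intro mult_left_mono) auto
      ultimately show ?thesis by linarith
    qed
    moreover have "\<bar>a * (e * g)\<bar> \<le> L * h ^ 3" using eg h43 by (intro abs_mult_le[OF aL(4)]) auto
    moreover have "\<bar>(a + b) * (y * e)\<bar> \<le> L * h ^ 3" "\<bar>(a + b) * (u * g)\<bar> \<le> L * h ^ 3"
      using abs_mult_le[OF aL(3) abs_mult_le[OF y e1]] abs_mult_le[OF aL(3) abs_mult_le[OF u g1]]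
      by (simp_all only: h3)
    ultimately show ?thesis unfolding eq using Ld L3 unfolding abs_le_iff by linarith
  qed
  have lnG: "ln G = 2 * ln l + ln (1 - a * y) + ln (1 - a * u) + ln (1 - l) + ln (1 + z0)"
    using pos l zpos unfolding G_eq pe by (simp add: ln_mult zero_less_mult_iff)
  have lnF: "ln F = 2 * ln (1 - l) + ln (1 + b * (y + g)) + ln (1 + b * (u + e)) + ln l + ln (1 + z1)"
    using pos l zpos unfolding F_eq pe' by (simp add: ln_mult zero_less_mult_iff)
  have eq: "ln (G / F) - ln (l / (1 - l)) = (ln (1 - a * u) - ln (1 + b * (u + e)))
     + (ln (1 - a * y) - ln (1 + b * (y + g))) + (ln (1 + z0) - ln (1 + z1))"
    using Gp Fp l by (simp add: ln_div lnG lnF)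
  have S1: "\<bar>ln (1 - a * u) - ln (1 + b * (u + e)) - D u e \<kappa>\<bar> \<le> 21 * L ^ 3 * h ^ 3"
    unfolding D_def by (rule log_side_expansion) (use a0 abL L2 h u e \<kappa> in auto)
  have S2: "\<bar>ln (1 - a * y) - ln (1 + b * (y + g)) - D y g \<iota>\<bar> \<le> 21 * L ^ 3 * h ^ 3"
    unfolding D_def by (rule log_side_expansion) (use a0 abL L2 h y g \<iota> in auto)
  \<comment> \<open>56 = 21 + 21 + 4 + 10: two sides, two remainders of 16 h^3 with 8 h^3 <= L^3
    h^3, and the bound \<open>zz\<close>.\<close>
  have "\<bar>ln (G / F) - ln (l / (1 - l)) - (D u e \<kappa> + D y g \<iota> + Dz)\<bar> \<le> 56 * L ^ 3 * h ^ 3"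
    unfolding eq using S1 S2 lnz[OF z0] lnz[OF z1] zz L3(1) unfolding abs_le_iff by linarith
  then show "\<bar>ln (G / F) - ln (l / (1 - l)) - (D u e \<kappa> + D y g \<iota> - (a + b) * (\<omega> + e * g / 2) * (1 - \<kappa>) * (1 - \<iota>))\<bar>
      \<le> 56 * L ^ 3 * h ^ 3"
    unfolding Dz_def by simp
qed

section \<open>The exponent of the claimed formula and its increment when an edge is added\<close>

definition log_correction :: "nat \<Rightarrow> nat \<Rightarrow> nat \<Rightarrow> nat \<Rightarrow> nat \<Rightarrow> (nat \<times> nat) set \<Rightarrow> real" where
  "log_correction m n s J K H =
    (let mm = real m; nn = real n; JJ = real J; KK = real K; l = lam n s; A = Acoef n s;
         w1 = omega H l J K 1; w2 = omega H l J K 2; w3 = omega H l J K 3;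
         w2' = omega' H l J K 2; w3' = omega' H l J K 3
     in (JJ * KK / 2 + (1 - 2 * l) * w1 / (4 * A)) * (1 / mm + 1 / nn)
        - w1\<^sup>2 / (4 * A * mm * nn) - (nn + KK) * w2 / (4 * A * nn\<^sup>2) - (mm + JJ) * w2' / (4 * A * mm\<^sup>2)
        - (1 - 2 * l) / (24 * A\<^sup>2) * (w3 / nn\<^sup>2 + w3' / mm\<^sup>2))"

lemma degU_insert:
  assumes "finite H" "(j, k) \<notin> H"
  shows "degU (insert (j, k) H) x = degU H x + of_bool (x = j)"
proof (cases "x = j")
  case True
  have "{y. (x, y) \<in> H} \<subseteq> snd ` H" by force
  then have "finite {y. (x, y) \<in> H}" using assms finite_subset by blast
  moreover have "{y. (x, y) \<in> insert (j, k) H} = insert k {y. (x, y) \<in> H}" using True by auto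
  ultimately show ?thesis using True assms by (simp add: degU_def)
qed (simp add: degU_def)

lemma degV_insert:
  assumes "finite H" "(j, k) \<notin> H"
  shows "degV (insert (j, k) H) x = degV H x + of_bool (x = k)"
proof -
  have "(insert (j, k) H)\<inverse> = insert (k, j) (H\<inverse>)" by auto
  then show ?thesis using degU_insert[of "H\<inverse>" k j x] assms by (simp flip: degU_converse)
qed

lemma omega_insert:
  assumes "finite H" "(j, k) \<notin> H" "j \<in> {1..J}"
  shows "omega (insert (j, k) H) l J K e = omega H l J K e
    + ((real (degU H j) - l * real K + 1) ^ e - (real (degU H j) - l * real K) ^ e)"
proof -
  have "omega (insert (j, k) H) l J K e = (\<Sum>x = 1..J. (real (degU H x) - l * real K) ^ e
     + (if x = j then (real (degU H j) - l * real K + 1) ^ e - (real (degU H j) - l * real K) ^ e else 0))"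
    unfolding omega_def degU_insert[OF assms(1,2)] by (rule sum.cong) (auto simp: algebra_simps)
  then show ?thesis using assms(3) by (simp add: sum.distrib omega_def)
qed

lemma omega'_insert:
  assumes "finite H" "(j, k) \<notin> H" "k \<in> {1..K}"
  shows "omega' (insert (j, k) H) l J K e = omega' H l J K e
    + ((real (degV H k) - l * real J + 1) ^ e - (real (degV H k) - l * real J) ^ e)"
proof -
  have "omega' (insert (j, k) H) l J K e = (\<Sum>x = 1..K. (real (degV H x) - l * real J) ^ e
     + (if x = k then (real (degV H k) - l * real J + 1) ^ e - (real (degV H k) - l * real J) ^ e else 0))"
    unfolding omega'_def degV_insert[OF assms(1,2)] by (rule sum.cong) (auto simp: algebra_simps)
  then show ?thesis using assms(3) by (simp add: sum.distrib omega'_def)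
qed

text \<open>Everything rests on e(1-\<kappa>) = 1/n, which replaces n - K by n without error. One
  factor 1+\<kappa> of 1-\<kappa>^2 survives and becomes the n + K in the coefficient of the
  quadratic term of the exponent.\<close>

lemma side_term_identity:
  fixes l \<xi> n K n' :: real
  assumes l: "0 < l" "l < 1" and n: "0 < n" "0 < n'" "n' = n - K"
  defines "a \<equiv> 1 / l" and "b \<equiv> 1 / (1 - l)" and "v \<equiv> l * (1 - l)"
  defines "u \<equiv> \<xi> / n'" and "e \<equiv> 1 / n'" and "\<kappa> \<equiv> K / n"
  shows "(a - b) * e * (1 - \<kappa>) / 2 - (a + b) * (1 - \<kappa>\<^sup>2) * (2 * u + e) / 2
        - (a\<^sup>2 - b\<^sup>2) * (3 * u\<^sup>2 + 3 * u * e + e\<^sup>2) * (1 - \<kappa>)\<^sup>2 / 6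
    = (1 - 2 * l) / (2 * v * n) - (n + K) * (2 * \<xi> + 1) / (2 * v * n\<^sup>2)
        - (1 - 2 * l) * (3 * \<xi>\<^sup>2 + 3 * \<xi> + 1) / (6 * v\<^sup>2 * n\<^sup>2)"
proof -
  have ab: "a - b = (1 - 2 * l) / v" "a + b = 1 / v" using l by (auto simp: a_def b_def v_def field_simps)
  have ab2: "a\<^sup>2 - b\<^sup>2 = (1 - 2 * l) / v\<^sup>2"
  proof -
    have "a\<^sup>2 - b\<^sup>2 = (a - b) * (a + b)" by (simp add: power2_eq_square algebra_simps)
    then show ?thesis unfolding ab by (simp add: power2_eq_square)
  qed
  have "1 - \<kappa> = n' / n" using n by (simp add: \<kappa>_def diff_divide_distrib)
  then have 1: "e * (1 - \<kappa>) = 1 / n" using n(2) by (simp add: e_def)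
  have u: "u = \<xi> * e" by (simp add: u_def e_def)
  have 2: "(1 - \<kappa>\<^sup>2) * (2 * u + e) = (n + K) * (2 * \<xi> + 1) / n\<^sup>2"
  proof -
    have "(1 - \<kappa>\<^sup>2) * (2 * u + e) = (1 + \<kappa>) * (2 * \<xi> + 1) * (e * (1 - \<kappa>))"
      unfolding u by (simp add: power2_eq_square algebra_simps)
    also have "\<dots> = (n + K) * (2 * \<xi> + 1) / n\<^sup>2"
      unfolding 1 using n by (simp add: \<kappa>_def field_simps power2_eq_square)
    finally show ?thesis .
  qed
  have 3: "(3 * u\<^sup>2 + 3 * u * e + e\<^sup>2) * (1 - \<kappa>)\<^sup>2 = (3 * \<xi>\<^sup>2 + 3 * \<xi> + 1) / n\<^sup>2"
  proof -
    have "(3 * u\<^sup>2 + 3 * u * e + e\<^sup>2) * (1 - \<kappa>)\<^sup>2 = (3 * \<xi>\<^sup>2 + 3 * \<xi> + 1) * (e * (1 - \<kappa>))\<^sup>2"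
      unfolding u by (simp add: power2_eq_square algebra_simps)
    then show ?thesis unfolding 1 by (simp add: power_divide)
  qed
  have "(a - b) * e * (1 - \<kappa>) = (1 - 2 * l) / v * (1 / n)" unfolding ab mult.assoc 1 ..
  moreover have "(a + b) * (1 - \<kappa>\<^sup>2) * (2 * u + e) = 1 / v * ((n + K) * (2 * \<xi> + 1) / n\<^sup>2)"
    unfolding ab mult.assoc 2 ..
  moreover have "(a\<^sup>2 - b\<^sup>2) * (3 * u\<^sup>2 + 3 * u * e + e\<^sup>2) * (1 - \<kappa>)\<^sup>2
    = (1 - 2 * l) / v\<^sup>2 * ((3 * \<xi>\<^sup>2 + 3 * \<xi> + 1) / n\<^sup>2)" unfolding ab2 mult.assoc[of "(1 - 2 * l) / v\<^sup>2"] 3 ..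
  ultimately show ?thesis by simp
qed

text \<open>The case C = 0 is included since \<open>Om\<close> may be empty; then S is 0 as well and
  any error will do.\<close>

lemma ex_scaled_error:
  fixes S C X d :: real
  assumes "\<bar>S - C * X\<bar> \<le> C * d" and "0 \<le> d" "0 \<le> C"
  shows "\<exists>e. \<bar>e\<bar> \<le> d \<and> S = C * (X + e)"
proof (cases "C = 0")
  case True
  then show ?thesis using assms by (intro exI[of _ 0]) auto
next
  case False
  then have c: "0 < C" using assms by simp
  define e where "e = (S - C * X) / C"
  have "\<bar>e\<bar> \<le> d"
    unfolding e_def abs_divide using assms c by (simp add: pos_divide_le_eq mult.commute)
  moreover have "C * e = S - C * X" unfolding e_def using c by simp
  ultimately show ?thesis by (intro exI[of _ e]) (simp add: distrib_left)
qed

context bip_bounds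
begin

lemma sqrt_n_le: "sqrt (real n) \<le> L * sqrt (real m)"
proof -
  have "real n \<le> L\<^sup>2 * real m"
  proof -
    have "L * real m \<le> (L * L) * real m" using L2 by (intro mult_right_mono) auto
    then show ?thesis using nL by (simp add: power2_eq_square)
  qed
  then have "sqrt (real n) \<le> sqrt (L\<^sup>2 * real m)" by simp
  also have "\<dots> = L * sqrt (real m)" using L2 by (simp add: real_sqrt_mult)
  finally show ?thesis .
qed

text \<open>Each bound lacks a factor n' or m'. Supplying it costs 2/n or 2/m, and passing from m
  sqrt m to n sqrt n costs L^2.\<close>

lemma error_sum:
  "m' * M * (L ^ 16 / sqrt (real n)) + n' * M * (L ^ 16 / sqrt (real m)) + m' * M * (L ^ 23 / sqrt (real n))
   \<le> M * (m' * n') * (L ^ 26 / (real n * sqrt (real n)))"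
proof -
  let ?d = "real n * sqrt (real n)"
  have m_pos: "0 < real m" using J_less by simp
  have d: "0 < ?d" using n_pos by simp
  have 1: "L ^ i / sqrt (real n) \<le> n' * (2 * L ^ i / ?d)" for i
  proof -
    have "1 \<le> n' * (2 / real n)" using m'_half n_pos by (simp add: le_divide_eq)
    then have "L ^ i / sqrt (real n) * 1 \<le> L ^ i / sqrt (real n) * (n' * (2 / real n))"
      using L2 by (intro mult_left_mono) auto
    moreover have "A / w * (y * (2 / z)) = y * (2 * A / (z * w))" for A w y z :: real by (simp add: mult_ac)
    ultimately show ?thesis by (simp only: mult_1_right)
  qed
  have 2: "L ^ 16 / sqrt (real m) \<le> m' * (2 * L ^ 18 / ?d)"
  proof -
    have "1 \<le> m' * (2 / real m)" using m'_half m_pos by (simp add: le_divide_eq)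
    then have "L ^ 16 / sqrt (real m) * 1 \<le> L ^ 16 / sqrt (real m) * (m' * (2 / real m))"
      using L2 by (intro mult_left_mono) auto
    also have "\<dots> = m' * (2 * L ^ 16) * (1 / (real m * sqrt (real m)))"
    proof -
      have "A / w * (y * (2 / z)) = y * (2 * A) * (1 / (z * w))" for A w y z :: real by (simp add: mult_ac)
      then show ?thesis .
    qed
    also have "\<dots> \<le> m' * (2 * L ^ 16) * (L\<^sup>2 / ?d)"
    proof (rule mult_left_mono)
      have "?d \<le> (L * real m) * (L * sqrt (real m))"
        using nL sqrt_n_le L2 by (intro mult_mono) auto
      also have "\<dots> = L\<^sup>2 * (real m * sqrt (real m))" by (simp add: power2_eq_square)
      finally have le: "?d \<le> L\<^sup>2 * (real m * sqrt (real m))" .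
      have "1 / y \<le> B / z" if "z \<le> B * y" "0 < y" "0 < z" for B y z :: real
        using that by (simp add: field_simps)
      from this[OF le _ d] show "1 / (real m * sqrt (real m)) \<le> L\<^sup>2 / ?d" using m_pos by simp
    qed (use m'_pos L2 in simp)
    also have "\<dots> = m' * (2 * (L ^ 16 * L\<^sup>2) / ?d)"
    proof -
      have "y * (2 * A) * (B / z) = y * (2 * (A * B) / z)" for A B y z :: real by simp
      then show ?thesis .
    qed
    also have "L ^ 16 * L\<^sup>2 = L ^ 18" unfolding power_add[symmetric] by simp
    finally show ?thesis by simp
  qed
  have 3: "2 * L ^ 16 / ?d + 2 * L ^ 18 / ?d + 2 * L ^ 23 / ?d \<le> L ^ 26 / ?d"
  proof -
    have "2 * L ^ 16 + 2 * L ^ 18 + 2 * L ^ 23 \<le> L ^ 26"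
      using L_mono[of 16 23] L_mono[of 18 23] L_absorb[of 3 23] L_ge_1[of 23] by simp
    from divide_right_mono[OF this, of ?d] show ?thesis using d by (simp add: add_divide_distrib)
  qed
  have "m' * M * (L ^ 16 / sqrt (real n)) + n' * M * (L ^ 16 / sqrt (real m)) + m' * M * (L ^ 23 / sqrt (real n))
    \<le> m' * M * (n' * (2 * L ^ 16 / ?d)) + n' * M * (m' * (2 * L ^ 18 / ?d)) + m' * M * (n' * (2 * L ^ 23 / ?d))"
    using m'_pos n'_pos by (intro add_mono mult_left_mono 1 2) auto
  also have "\<dots> = M * (m' * n') * (2 * L ^ 16 / ?d + 2 * L ^ 18 / ?d + 2 * L ^ 23 / ?d)"
    by (simp only: distrib_left mult_ac)
  also have "\<dots> \<le> M * (m' * n') * (L ^ 26 / ?d)"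
    using m'_pos n'_pos by (intro mult_left_mono 3) auto
  finally show ?thesis .
qed

text \<open>The corrections with 1/n' and 1/m' are the variances \<open>p k * (1 - p k)\<close> and
  \<open>q j * (1 - q j)\<close> from \<open>be_ga_bound\<close> and \<open>al_ga_bound\<close>,
  after division by the number m' n' of cells of the block. All other correlations go into the
  error.\<close>

lemma count_estimates:
  assumes j: "j \<in> {1..J}" and k: "k \<in> {1..K}"
  defines "d \<equiv> L ^ 26 / (real n * sqrt (real n))"
  shows "\<exists>e. \<bar>e\<bar> \<le> d \<and> (\<Sum>G\<in>Om. gcount m n J K j k G)
      = M * (m' * n') * (p k * q j * (1 - rho + (1 - p k) * (1 / n') + (1 - q j) * (1 / m')) + e)"
    and "\<exists>e. \<bar>e\<bar> \<le> d \<and> (\<Sum>G\<in>Om. fcount m n J K j k G)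
      = M * (m' * n') * ((1 - p k) * (1 - q j) * (rho + p k * (1 / n') + q j * (1 / m')) + e)"
proof -
  let ?B = "\<Sum>G\<in>Om. \<Sum>r\<in>{J<..m}. \<Sum>c\<in>{K<..n}. be k G r * ga G r c"
  let ?A = "\<Sum>G\<in>Om. \<Sum>r\<in>{J<..m}. \<Sum>c\<in>{K<..n}. al j G c * ga G r c"
  let ?T = "\<Sum>G\<in>Om. \<Sum>r\<in>{J<..m}. \<Sum>c\<in>{K<..n}. al j G c * be k G r * ga G r c"
  define eB where "eB = ?B + M * (m' * p k * (1 - p k))"
  define eA where "eA = ?A + M * (n' * q j * (1 - q j))"
  have eB: "\<bar>eB\<bar> \<le> m' * M * (L ^ 16 / sqrt (real n))" unfolding eB_def by (rule be_ga_bound[OF k])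
  have eA: "\<bar>eA\<bar> \<le> n' * M * (L ^ 16 / sqrt (real m))" unfolding eA_def by (rule al_ga_bound[OF j])
  have T: "\<bar>?T\<bar> \<le> m' * M * (L ^ 23 / sqrt (real n))" by (rule triple_bound[OF j k])
  have d0: "0 \<le> d" using L2 by (simp add: d_def)
  have bound: "\<bar>x * eB + y * eA + z * ?T\<bar> \<le> M * (m' * n') * d" if "\<bar>x\<bar> \<le> 1" "\<bar>y\<bar> \<le> 1" "\<bar>z\<bar> \<le> 1" for x y z
  proof -
    have "\<bar>x * eB\<bar> \<le> 1 * (m' * M * (L ^ 16 / sqrt (real n)))" "\<bar>y * eA\<bar> \<le> 1 * (n' * M * (L ^ 16 / sqrt (real m)))"
      "\<bar>z * ?T\<bar> \<le> 1 * (m' * M * (L ^ 23 / sqrt (real n)))"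
      by (intro abs_mult_le that eB eA T)+
    moreover have "\<bar>x * eB + y * eA + z * ?T\<bar> \<le> \<bar>x * eB\<bar> + \<bar>y * eA\<bar> + \<bar>z * ?T\<bar>" by linarith
    ultimately show ?thesis using error_sum unfolding d_def by linarith
  qed
  \<comment> \<open>If \<open>Om\<close> is empty, \<open>p k\<close> and \<open>q j\<close> need
    not be probabilities; but then all sums and \<open>M\<close> are 0.\<close>
  have pq: "Om = {} \<or> (\<bar>p k\<bar> \<le> 1 \<and> \<bar>q j\<bar> \<le> 1 \<and> \<bar>1 - p k\<bar> \<le> 1 \<and> \<bar>1 - q j\<bar> \<le> 1)"
    using p_range[OF _ k] q_range[OF _ j] by fastforce
  have g: "(\<Sum>G\<in>Om. gcount m n J K j k G) = M * (m' * n' * (p k * q j * (1 - rho))) - q j * ?B - p k * ?A - ?T"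
    using gcount_expand(1)[OF _ j k] by (simp add: sum_subtractf sum_distrib_left)
  have f: "(\<Sum>G\<in>Om. fcount m n J K j k G)
      = M * (m' * n' * ((1 - p k) * (1 - q j) * rho)) - (1 - q j) * ?B - (1 - p k) * ?A + ?T"
    using gcount_expand(2)[OF _ j k] by (simp add: sum_subtractf sum.distrib sum_distrib_left)
  have B: "?B = eB - M * (m' * p k * (1 - p k))" and A: "?A = eA - M * (n' * q j * (1 - q j))"
    by (simp_all add: eB_def eA_def)
  have canc: "m' * n' * (x * (1 / n')) = m' * x" "m' * n' * (x * (1 / m')) = n' * x" for x
    using m'_pos n'_pos by auto
  have "(\<Sum>G\<in>Om. gcount m n J K j k G) - M * (m' * n') * (p k * q j * (1 - rho + (1 - p k) * (1 / n') + (1 - q j) * (1 / m')))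
      = (- q j) * eB + (- p k) * eA + (- 1) * ?T"
  proof -
    have "M * (m' * n') * (p k * q j * (1 - rho + (1 - p k) * (1 / n') + (1 - q j) * (1 / m')))
      = M * (m' * n' * (p k * q j * (1 - rho))) + M * (m' * n' * (p k * q j * (1 - p k) * (1 / n')))
        + M * (m' * n' * (p k * q j * (1 - q j) * (1 / m')))"
      by (simp only: distrib_left mult.assoc)
    also have "\<dots> = M * (m' * n' * (p k * q j * (1 - rho))) + M * (m' * (p k * q j * (1 - p k))) + M * (n' * (p k * q j * (1 - q j)))"
      unfolding canc ..
    finally show ?thesis unfolding g B A by (simp add: algebra_simps)
  qed
  then show "\<exists>e. \<bar>e\<bar> \<le> d \<and> (\<Sum>G\<in>Om. gcount m n J K j k G)
      = M * (m' * n') * (p k * q j * (1 - rho + (1 - p k) * (1 / n') + (1 - q j) * (1 / m')) + e)"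
    using pq bound[of "- q j" "- p k" "- 1"] d0 m'_pos n'_pos by (intro ex_scaled_error) auto
  have "(\<Sum>G\<in>Om. fcount m n J K j k G) - M * (m' * n') * ((1 - p k) * (1 - q j) * (rho + p k * (1 / n') + q j * (1 / m')))
      = (- (1 - q j)) * eB + (- (1 - p k)) * eA + 1 * ?T"
  proof -
    have "M * (m' * n') * ((1 - p k) * (1 - q j) * (rho + p k * (1 / n') + q j * (1 / m')))
      = M * (m' * n' * ((1 - p k) * (1 - q j) * rho)) + M * (m' * n' * ((1 - p k) * (1 - q j) * p k * (1 / n')))
        + M * (m' * n' * ((1 - p k) * (1 - q j) * q j * (1 / m')))"
      by (simp only: distrib_left mult.assoc)
    also have "\<dots> = M * (m' * n' * ((1 - p k) * (1 - q j) * rho)) + M * (m' * ((1 - p k) * (1 - q j) * p k)) + M * (n' * ((1 - p k) * (1 - q j) * q j))"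
      unfolding canc ..
    finally show ?thesis unfolding f B A by (simp add: algebra_simps)
  qed
  then show "\<exists>e. \<bar>e\<bar> \<le> d \<and> (\<Sum>G\<in>Om. fcount m n J K j k G)
      = M * (m' * n') * ((1 - p k) * (1 - q j) * (rho + p k * (1 / n') + q j * (1 / m')) + e)"
    using pq bound[of "- (1 - q j)" "- (1 - p k)" 1] d0 m'_pos n'_pos by (intro ex_scaled_error) auto
qed

lemma p_eq: "p k = lm - (real (degV H k) - lm * real J) / m'"
  unfolding p_def lm_t using m'_pos by (simp add: field_simps)

lemma q_eq: "q j = lm - (real (degU H j) - lm * real K) / n'"
  unfolding q_def using lm_s n'_pos by (simp add: field_simps)

lemma omega_1: "omega H lm J K 1 = real (card H) - lm * real J * real K"
  unfolding omega_def card_H_eq degU_eq_sum[OF H_sub] by (simp add: sum_subtractf)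

lemma rho_eq: "rho = lm + omega H lm J K 1 / (m' * n')"
proof -
  have "real m * real s - real J * real s - real K * real t + real (card H) = lm * (m' * n') + omega H lm J K 1"
    unfolding omega_1 lm_t using lm_s by (simp add: algebra_simps)
  then show ?thesis unfolding rho_def using m'_pos n'_pos by (simp add: add_divide_distrib)
qed

end

lemma correction_increment:
  fixes JK l w A mm nn w2 w2' w3 w3' cn cm \<xi> \<eta> i :: real
  shows "((JK / 2 + (1 - 2 * l) * (w + 1) / (4 * A)) * i - (w + 1)\<^sup>2 / (4 * A * mm * nn)
      - cn * (w2 + (2 * \<xi> + 1)) / (4 * A * nn\<^sup>2) - cm * (w2' + (2 * \<eta> + 1)) / (4 * A * mm\<^sup>2)
      - (1 - 2 * l) / (24 * A\<^sup>2) * ((w3 + (3 * \<xi>\<^sup>2 + 3 * \<xi> + 1)) / nn\<^sup>2 + (w3' + (3 * \<eta>\<^sup>2 + 3 * \<eta> + 1)) / mm\<^sup>2))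
    - ((JK / 2 + (1 - 2 * l) * w / (4 * A)) * i - w\<^sup>2 / (4 * A * mm * nn)
      - cn * w2 / (4 * A * nn\<^sup>2) - cm * w2' / (4 * A * mm\<^sup>2)
      - (1 - 2 * l) / (24 * A\<^sup>2) * (w3 / nn\<^sup>2 + w3' / mm\<^sup>2))
    = (1 - 2 * l) / (4 * A) * i - (2 * w + 1) / (4 * A * mm * nn)
      - cn * (2 * \<xi> + 1) / (4 * A * nn\<^sup>2) - cm * (2 * \<eta> + 1) / (4 * A * mm\<^sup>2)
      - (1 - 2 * l) / (24 * A\<^sup>2) * ((3 * \<xi>\<^sup>2 + 3 * \<xi> + 1) / nn\<^sup>2 + (3 * \<eta>\<^sup>2 + 3 * \<eta> + 1) / mm\<^sup>2)"
proof -
  have 1: "(JK / 2 + (1 - 2 * l) * (w + 1) / (4 * A)) * i = (JK / 2 + (1 - 2 * l) * w / (4 * A)) * i + (1 - 2 * l) / (4 * A) * i"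
    by (simp add: algebra_simps add_divide_distrib diff_divide_distrib)
  have 2: "(w + 1)\<^sup>2 / (4 * A * mm * nn) = w\<^sup>2 / (4 * A * mm * nn) + (2 * w + 1) / (4 * A * mm * nn)"
    by (simp add: power2_sum flip: add_divide_distrib)
  have 3: "c * (x + y) / z = c * x / z + c * y / z" for c x y z :: real
    by (simp add: distrib_left add_divide_distrib)
  have 4: "d * ((x + y) / z + (x' + y') / z') = d * (x / z + x' / z') + d * (y / z + y' / z')" for d x y z x' y' z' :: real
    by (simp add: distrib_left add_divide_distrib)
  show ?thesis unfolding 1 2 unfolding 3 4 by simp
qed

context bip_bounds
begin

text \<open>The new edge raises the deviations of \<open>u_j\<close> and \<open>v_k\<close> by 1,
  hence the differences of consecutive squares and cubes. Grouping by the two sides and a mixed term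
  reproduces the shape of \<open>log_odds_expansion\<close>.\<close>

lemma log_correction_insert:
  assumes j: "j \<in> {1..J}" and k: "k \<in> {1..K}" and jk: "(j, k) \<notin> H"
  defines "\<xi> \<equiv> real (degU H j) - lm * real K" and "\<eta> \<equiv> real (degV H k) - lm * real J"
    and "w \<equiv> omega H lm J K 1"
  shows "log_correction m n s J K (insert (j, k) H) - log_correction m n s J K H
    = ((1 - 2 * lm) / (2 * v * real n) - (real n + real K) * (2 * \<xi> + 1) / (2 * v * (real n)\<^sup>2)
        - (1 - 2 * lm) * (3 * \<xi>\<^sup>2 + 3 * \<xi> + 1) / (6 * v\<^sup>2 * (real n)\<^sup>2))
    + ((1 - 2 * lm) / (2 * v * real m) - (real m + real J) * (2 * \<eta> + 1) / (2 * v * (real m)\<^sup>2)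
        - (1 - 2 * lm) * (3 * \<eta>\<^sup>2 + 3 * \<eta> + 1) / (6 * v\<^sup>2 * (real m)\<^sup>2))
    - (2 * w + 1) / (2 * v * real m * real n)"
proof -
  have fin: "finite H" using H_sub finite_subset by blast
  have x1: "(\<xi> + 1) ^ 1 - \<xi> ^ 1 = 1" by simp
  have x2: "(x + 1) ^ 2 - x ^ 2 = 2 * x + 1" and x3: "(x + 1) ^ 3 - x ^ 3 = 3 * x\<^sup>2 + 3 * x + 1" for x :: real
    by (simp_all add: power2_eq_square power3_eq_cube algebra_simps)
  have A: "4 * Acoef n s = 2 * v" "24 * (Acoef n s)\<^sup>2 = 6 * v\<^sup>2"
    by (simp_all add: Acoef_def power2_eq_square)
  have f1: "c / V * (1 / x + 1 / y) = c / (V * x) + c / (V * y)" for c V x y :: real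
    by (simp add: distrib_left)
  have f2: "c / V * (X / x + Y / y) = c * X / (V * x) + c * Y / (V * y)" for c V x y X Y :: real
    by (simp add: distrib_left)
  have f3: "a1 + a2 - b - c1 - c2 - (d1 + d2) = (a2 - c1 - d1) + (a1 - c2 - d2) - b" for a1 a2 b c1 c2 d1 d2 :: real
    by simp
  show ?thesis
    unfolding log_correction_def Let_def omega_insert[OF fin jk j] omega'_insert[OF fin jk k]
      \<xi>_def[symmetric] \<eta>_def[symmetric] x1 x2 x3 w_def[symmetric]
    unfolding correction_increment
    unfolding A f1
    unfolding f2
    by (rule f3)
qed

text \<open>The parameter h of \<open>log_odds_expansion\<close>. The exponent 9 is the least for
  which h^3 covers the error L^26 / n^(3/2) of the mean switching counts, given that powers of
  \<open>L\<close> are integral.\<close>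

abbreviation "hh \<equiv> L ^ 9 / sqrt (real n)"

lemma degU_le: "degU H j \<le> K"
proof -
  have "{k. (j, k) \<in> H} \<subseteq> {1..K}" using H_sub by auto
  from card_mono[OF _ this] show ?thesis by (simp add: degU_def)
qed

lemma degV_le: "degV H k \<le> J"
proof -
  have "{j. (j, k) \<in> H} \<subseteq> {1..J}" using H_sub by auto
  from card_mono[OF _ this] show ?thesis by (simp add: degV_def)
qed

lemma abs_deviation_le:
  assumes "(x :: nat) \<le> y" shows "\<bar>real x - lm * real y\<bar> \<le> real y"
proof -
  have "0 \<le> lm * real y" "lm * real y \<le> 1 * real y"
    using lm_pos lm_less_1 mult_right_mono[of lm 1 "real y"] by auto
  then show ?thesis using assms unfolding abs_le_iff by auto
qed

lemma J_over_m: "real J / real m \<le> L\<^sup>2 / sqrt (real n)"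
proof -
  interpret tr: bip_bounds n m t s K J "H\<inverse>" L by (rule transposed)
  have m_pos: "0 < real m" using J_less by simp
  have "L / y \<le> L\<^sup>2 / z" if "z \<le> L * y" "0 < y" "0 < z" for y z
  proof -
    have "L * z \<le> L * (L * y)" using that L2 by (intro mult_left_mono) auto
    then show ?thesis using that by (simp add: frac_le_eq divide_le_eq le_divide_eq power2_eq_square mult_ac)
  qed
  from this[OF sqrt_n_le] have "L / sqrt (real m) \<le> L\<^sup>2 / sqrt (real n)" using m_pos n_pos by simp
  then show ?thesis using tr.K_over_n by linarith
qed

lemma ratio_K: "real K / n' \<le> 2 * (L\<^sup>2 / sqrt (real n))" and ratio_J: "real J / m' \<le> 2 * (L\<^sup>2 / sqrt (real n))"
proof -
  have half: "x / y' \<le> 2 * (x / y)" if "y / 2 \<le> y'" "0 \<le> x" "0 < y" for x y y' :: real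
  proof -
    have "x / y' \<le> x / (y / 2)" using that by (intro divide_left_mono) auto
    then show ?thesis by (simp add: mult.commute)
  qed
  have m_pos: "0 < real m" using J_less by simp
  have "L * 1 \<le> L * L" using L2 by (intro mult_left_mono) auto
  then have "L / sqrt (real n) \<le> L\<^sup>2 / sqrt (real n)" unfolding power2_eq_square by (intro divide_right_mono) auto
  then have "real K / real n \<le> L\<^sup>2 / sqrt (real n)" using K_over_n by linarith
  then show "real K / n' \<le> 2 * (L\<^sup>2 / sqrt (real n))"
    using half[of "real n" n' "real K"] m'_half n_pos by linarith
  show "real J / m' \<le> 2 * (L\<^sup>2 / sqrt (real n))"
    using half[of "real m" m' "real J"] m'_half m_pos J_over_m by linarith
qed

lemma two_L2_le_hh: "2 * (L\<^sup>2 / sqrt (real n)) \<le> hh" "4 * (L\<^sup>2 / sqrt (real n))\<^sup>2 \<le> hh\<^sup>2"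
proof -
  have "2 * L\<^sup>2 \<le> L ^ 9" using L_absorb[of 1 2] L_mono[of 3 9] by simp
  then have "2 * L\<^sup>2 / sqrt (real n) \<le> hh" by (intro divide_right_mono) auto
  then show 1: "2 * (L\<^sup>2 / sqrt (real n)) \<le> hh" by simp
  have "(2 * (L\<^sup>2 / sqrt (real n)))\<^sup>2 \<le> hh\<^sup>2" using 1 L2 by (intro power_mono) auto
  then show "4 * (L\<^sup>2 / sqrt (real n))\<^sup>2 \<le> hh\<^sup>2" by (simp only: power_mult_distrib) simp
qed

lemma hh_sq: "hh\<^sup>2 = L ^ 18 / real n" by (simp add: power_divide flip: power_mult)

lemma recip_bounds: "1 / n' \<le> hh\<^sup>2" "1 / m' \<le> hh\<^sup>2"
proof -
  have m_pos: "0 < real m" using J_less by simp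
  have "1 / n' \<le> 1 / (real n / 2)" using m'_half n_pos n'_pos by (intro divide_left_mono) auto
  also have "\<dots> = 2 / real n" by simp
  also have "\<dots> \<le> L ^ 18 / real n" using L2 L_mono[of 1 18] by (intro divide_right_mono) auto
  finally show "1 / n' \<le> hh\<^sup>2" unfolding hh_sq .
  have "1 / m' \<le> 1 / (real m / 2)" using m'_half m_pos m'_pos by (intro divide_left_mono) auto
  also have "\<dots> = 2 / real m" by simp
  also have "\<dots> \<le> 2 * L / real n"
  proof -
    have "2 / y \<le> 2 * L / z" if "z \<le> L * y" "0 < y" "0 < z" for y z
      using that by (simp add: frac_le_eq divide_le_eq le_divide_eq mult_ac)
    from this[OF nL m_pos n_pos] show ?thesis .
  qed
  also have "\<dots> \<le> L ^ 18 / real n" using L_absorb[of 1 1] L_mono[of 2 18] by (intro divide_right_mono) auto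
  finally show "1 / m' \<le> hh\<^sup>2" unfolding hh_sq .
qed

lemma omega_1_bound: "\<bar>omega H lm J K 1 / (m' * n')\<bar> \<le> hh\<^sup>2"
proof -
  have "\<bar>omega H lm J K 1\<bar> \<le> (\<Sum>j = 1..J. real K)"
    unfolding omega_def by (rule order_trans[OF sum_abs sum_mono]) (use abs_deviation_le degU_le in simp)
  then have "\<bar>omega H lm J K 1\<bar> / (m' * n') \<le> (real J * real K) / (m' * n')"
    using m'_pos n'_pos by (intro divide_right_mono) auto
  also have "\<dots> = (real J / m') * (real K / n')" by simp
  also have "\<dots> \<le> (2 * (L\<^sup>2 / sqrt (real n))) * (2 * (L\<^sup>2 / sqrt (real n)))"
    using ratio_J ratio_K n'_pos m'_pos L2 by (intro mult_mono) auto
  also have "\<dots> = 4 * (L\<^sup>2 / sqrt (real n))\<^sup>2" by (simp add: power2_eq_square)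
  also have "\<dots> \<le> hh\<^sup>2" by (rule two_L2_le_hh)
  finally show ?thesis using m'_pos n'_pos by (simp add: abs_divide)
qed

text \<open>By \<open>switching\<close> the ratio of the two cardinalities is a quotient of mean
  switching numbers. Both means are positive, so neither set can be empty alone; this later yields
  that every corner occurs.\<close>

lemma ratio_step:
  assumes j: "j \<in> {1..J}" and k: "k \<in> {1..K}" and jk: "(j, k) \<notin> H" and big: "L ^ 26 \<le> real n"
  defines "N0 \<equiv> real (card Om)" and "N1 \<equiv> real (card (bip_ext.Om m n s t J K (insert (j, k) H)))"
  shows "0 < N0 \<longleftrightarrow> 0 < N1"
    and "0 < N0 \<Longrightarrow> \<bar>ln (N1 / N0) - ln (lm / (1 - lm))
       - (log_correction m n s J K (insert (j, k) H) - log_correction m n s J K H)\<bar> \<le> 56 * L ^ 3 * hh ^ 3"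
proof -
  have fin: "finite H" using H_sub finite_subset by blast
  \<comment> \<open>The means come from two different graphs: rectangles creating the edge are
    counted over extensions of \<open>H\<close>, those destroying it over extensions of
    \<open>insert (j, k) H\<close>.\<close>
  interpret B: bip_bounds m n s t J K "insert (j, k) H" L
    by unfold_locales (use J_less K_less H_sub ms L2 mL nL Jn Jm Kn Km vL bign bigm j k in auto)
  define \<xi> where "\<xi> = real (degU H j) - lm * real K"
  define \<eta> where "\<eta> = real (degV H k) - lm * real J"
  define w where "w = omega H lm J K 1"
  define u where "u = \<xi> / n'"
  define y where "y = \<eta> / m'"
  define e where "e = 1 / n'"
  define g where "g = 1 / m'"
  define \<kappa> where "\<kappa> = real K / real n"
  define \<iota> where "\<iota> = real J / real m"
  define \<omega> where "\<omega> = w / (m' * n')"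
  define d where "d = L ^ 26 / (real n * sqrt (real n))"
  have m_pos: "0 < real m" using J_less by simp
  have pA: "p k = lm - y" and qA: "q j = lm - u" and rA: "rho = lm + \<omega>"
    unfolding p_eq q_eq rho_eq y_def u_def \<omega>_def \<eta>_def \<xi>_def w_def by auto
  have pB: "B.p k = lm - y - g"
    unfolding B.p_eq degV_insert[OF fin jk] y_def \<eta>_def g_def by (simp add: diff_divide_distrib add_divide_distrib)
  have qB: "B.q j = lm - u - e"
    unfolding B.q_eq degU_insert[OF fin jk] u_def \<xi>_def e_def by (simp add: diff_divide_distrib add_divide_distrib)
  have rB: "B.rho = lm + \<omega> + e * g"
    unfolding B.rho_eq omega_insert[OF fin jk j] \<omega>_def w_def e_def g_def by (simp add: add_divide_distrib mult.commute)
  from count_estimates(1)[OF j k, folded d_def] obtain \<delta>0 where \<delta>0: "\<bar>\<delta>0\<bar> \<le> d"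
    "(\<Sum>G\<in>Om. gcount m n J K j k G) = N0 * (m' * n') * (p k * q j * (1 - rho + (1 - p k) * e + (1 - q j) * g) + \<delta>0)"
    unfolding e_def g_def N0_def by blast
  from B.count_estimates(2)[OF j k, folded d_def] obtain \<delta>1 where \<delta>1: "\<bar>\<delta>1\<bar> \<le> d"
    "(\<Sum>G\<in>B.Om. fcount m n J K j k G)
      = N1 * (m' * n') * ((1 - B.p k) * (1 - B.q j) * (B.rho + B.p k * e + B.q j * g) + \<delta>1)"
    unfolding e_def g_def N1_def by blast
  define GG where "GG = (lm - y) * (lm - u) * (1 - (lm + \<omega>) + (1 - (lm - y)) * e + (1 - (lm - u)) * g) + \<delta>0"
  define FF where "FF = (1 - (lm - y - g)) * (1 - (lm - u - e)) * ((lm + \<omega> + e * g) + (lm - y - g) * e + (lm - u - e) * g) + \<delta>1"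
  have sw: "N1 * (m' * n') * FF = N0 * (m' * n') * GG"
    using switching[OF J_less K_less H_sub j k jk, of s t] \<delta>0(2) \<delta>1(2)
    unfolding GG_def FF_def pA qA rA pB qB rB by simp
  have c: "0 < m' * n'" using m'_pos n'_pos by simp
  have "m' * n' * (N1 * FF) = m' * n' * (N0 * GG)" using sw by (simp only: mult_ac)
  then have sw': "N1 * FF = N0 * GG" using c by (simp only: mult_cancel_left) auto
  have h0: "0 < hh" using L2 n_pos by simp
  have h1: "4 * L\<^sup>2 * hh \<le> 1"
  proof -
    have "L ^ 13 \<le> sqrt (real n)"
      by (rule real_le_rsqrt) (use big in \<open>simp flip: power_mult\<close>)
    moreover have "4 * (L\<^sup>2 * L ^ 9) \<le> L ^ 13" using L_absorb[of 2 11] by (simp flip: power_add)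
    ultimately have "4 * (L\<^sup>2 * L ^ 9) \<le> sqrt (real n)" by linarith
    then show ?thesis using n_pos by (simp add: divide_le_eq mult_ac)
  qed
  have dh: "d \<le> hh ^ 3"
  proof -
    have "hh ^ 3 = L ^ 27 / (real n * sqrt (real n))"
      by (simp add: power_divide power3_eq_cube[of "sqrt (real n)"] flip: power_mult)
    then show ?thesis unfolding d_def using L_mono[of 26 27] by (simp add: divide_right_mono)
  qed
  have u: "\<bar>u\<bar> \<le> hh"
  proof -
    have "\<bar>u\<bar> \<le> real K / n'" unfolding u_def \<xi>_def abs_divide
      using abs_deviation_le[OF degU_le[of j]] n'_pos by (simp add: divide_right_mono)
    then show ?thesis using ratio_K two_L2_le_hh by linarith
  qed
  have y: "\<bar>y\<bar> \<le> hh"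
  proof -
    have "\<bar>y\<bar> \<le> real J / m'" unfolding y_def \<eta>_def abs_divide
      using abs_deviation_le[OF degV_le[of k]] m'_pos by (simp add: divide_right_mono)
    then show ?thesis using ratio_J two_L2_le_hh by linarith
  qed
  have kb: "0 \<le> \<kappa>" "\<kappa> \<le> hh"
  proof -
    have "real K / real n \<le> real K / n'" using n'_pos n_pos by (intro divide_left_mono) auto
    then show "0 \<le> \<kappa>" "\<kappa> \<le> hh" unfolding \<kappa>_def using ratio_K two_L2_le_hh by auto
  qed
  have ib: "0 \<le> \<iota>" "\<iota> \<le> hh"
  proof -
    have "real J / real m \<le> real J / m'" using m'_pos m_pos by (intro divide_left_mono) auto
    then show "0 \<le> \<iota>" "\<iota> \<le> hh" unfolding \<iota>_def using ratio_J two_L2_le_hh by auto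
  qed
  have eb: "0 \<le> e" "e \<le> hh\<^sup>2" "0 \<le> g" "g \<le> hh\<^sup>2"
    unfolding e_def g_def using n'_pos m'_pos recip_bounds by auto
  have wb: "\<bar>\<omega>\<bar> \<le> hh\<^sup>2" unfolding \<omega>_def w_def by (rule omega_1_bound)
  have d0: "\<bar>\<delta>0\<bar> \<le> hh ^ 3" "\<bar>\<delta>1\<bar> \<le> hh ^ 3" using \<delta>0(1) \<delta>1(1) dh by linarith+
  note T = log_odds_expansion[OF lm_pos lm_less_1 v_inv L2 h0 h1 u y eb kb ib wb d0, folded GG_def FF_def]
  show iff: "0 < N0 \<longleftrightarrow> 0 < N1"
  proof -
    have "N1 = N0 * GG / FF" using sw' T(2) by (simp add: eq_divide_eq)
    then show ?thesis using T(1,2) by (simp add: zero_less_mult_iff zero_less_divide_iff)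
  qed
  assume N0: "0 < N0"
  have r: "N1 / N0 = GG / FF" using sw' T(2) N0 by (simp add: frac_eq_eq mult.commute)
  have ab: "1 / lm + 1 / (1 - lm) = 1 / v" using lm_pos lm_less_1 by (simp add: field_simps)
  \<comment> \<open>Again the factors 1-\<kappa> and 1-\<iota> turn 1/(m' n') into 1/(mn) exactly;
    2w+1 is the increment of the square of \<open>w\<close>.\<close>
  have mid: "(1 / lm + 1 / (1 - lm)) * (\<omega> + e * g / 2) * (1 - \<kappa>) * (1 - \<iota>) = (2 * w + 1) / (2 * v * real m * real n)"
  proof -
    have k1: "1 - \<kappa> = n' / real n" unfolding \<kappa>_def using n_pos by (simp add: diff_divide_distrib)
    have i1: "1 - \<iota> = m' / real m" unfolding \<iota>_def using m_pos by (simp add: diff_divide_distrib)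
    have *: "1 / V * (W / (M * N) + 1 / N * (1 / M) / 2) * (N / x) * (M / z) = (2 * W + 1) / (2 * V * z * x)"
      if "M \<noteq> 0" "N \<noteq> 0" "V \<noteq> 0" "x \<noteq> 0" "z \<noteq> 0" for V W M N x z :: real
      using that by (simp add: field_simps)
    show ?thesis
      unfolding ab k1 i1 \<omega>_def e_def g_def
      by (rule *) (rule less_imp_neq[symmetric], rule m'_pos n'_pos v_pos n_pos m_pos)+
  qed
  note S1 = side_term_identity[OF lm_pos lm_less_1 n_pos n'_pos refl, of \<xi>,
      folded u_def e_def \<kappa>_def]
  note S2 = side_term_identity[OF lm_pos lm_less_1 m_pos m'_pos refl, of \<eta>,
      folded y_def g_def \<iota>_def]
  show "\<bar>ln (N1 / N0) - ln (lm / (1 - lm))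
       - (log_correction m n s J K (insert (j, k) H) - log_correction m n s J K H)\<bar> \<le> 56 * L ^ 3 * hh ^ 3"
    using T(3) unfolding S1 S2 mid r log_correction_insert[OF j k jk, folded \<xi>_def \<eta>_def w_def] .
qed

end

section \<open>Moments of the Bernoulli and of the regular model\<close>

definition bern :: "real \<Rightarrow> 'a set \<Rightarrow> 'a set \<Rightarrow> real" where
  "bern l U H = l ^ card H * (1 - l) ^ (card U - card H)"

definition EB :: "real \<Rightarrow> 'a set \<Rightarrow> ('a set \<Rightarrow> real) \<Rightarrow> real" where
  "EB l U f = (\<Sum>H\<in>Pow U. bern l U H * f H)"

text \<open>Conditioning on one element. Independence is never introduced as a notion; its
  consequences are drawn from this recursion.\<close>

lemma EB_insert:
  assumes fin: "finite U" and e: "e \<notin> U"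
  shows "EB l (insert e U) f = l * EB l U (\<lambda>H. f (insert e H)) + (1 - l) * EB l U f"
proof -
  have inj: "inj_on (insert e) (Pow U)"
  proof (rule inj_onI)
    fix X Y assume "X \<in> Pow U" "Y \<in> Pow U" "insert e X = insert e Y"
    then show "X = Y" using e by (metis Diff_insert_absorb PowD subsetD)
  qed
  have b1: "bern l (insert e U) (insert e H) = l * bern l U H" if "H \<in> Pow U" for H
  proof -
    have "finite H" "e \<notin> H" using that fin e finite_subset by auto
    then show ?thesis using fin e by (simp add: bern_def)
  qed
  have b2: "bern l (insert e U) H = (1 - l) * bern l U H" if "H \<in> Pow U" for H
  proof -
    have "card H \<le> card U" using that fin card_mono by auto
    then show ?thesis using fin e by (simp add: bern_def Suc_diff_le)
  qed
  have "EB l (insert e U) f = (\<Sum>H\<in>Pow U. bern l (insert e U) H * f H)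
    + (\<Sum>H\<in>insert e ` Pow U. bern l (insert e U) H * f H)"
    unfolding EB_def Pow_insert using fin e by (intro sum.union_disjoint) auto
  also have "(\<Sum>H\<in>insert e ` Pow U. bern l (insert e U) H * f H)
     = (\<Sum>H\<in>Pow U. bern l (insert e U) (insert e H) * f (insert e H))"
    using sum.reindex[OF inj] by simp
  also have "\<dots> = (\<Sum>H\<in>Pow U. l * (bern l U H * f (insert e H)))"
    by (rule sum.cong) (simp_all add: b1)
  also have "(\<Sum>H\<in>Pow U. bern l (insert e U) H * f H) = (\<Sum>H\<in>Pow U. (1 - l) * (bern l U H * f H))"
    by (rule sum.cong) (simp_all add: b2)
  finally show ?thesis by (simp add: EB_def sum_distrib_left)
qed

lemma EB_const: "finite U \<Longrightarrow> EB l U (\<lambda>_. c) = c"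
proof (induction U rule: finite_induct)
  case empty
  then show ?case by (simp add: EB_def bern_def)
next
  case (insert e U)
  then show ?case by (simp add: EB_insert algebra_simps)
qed

lemma EB_add: "EB l U (\<lambda>H. f H + g H) = EB l U f + EB l U g"
  by (simp add: EB_def distrib_left sum.distrib)

lemma EB_cmult: "EB l U (\<lambda>H. c * f H) = c * EB l U f"
  by (simp add: EB_def sum_distrib_left mult.left_commute)

lemma EB_sum: "EB l U (\<lambda>H. \<Sum>x\<in>A. h x H) = (\<Sum>x\<in>A. EB l U (h x))"
  by (simp add: EB_def sum_distrib_left sum.swap[of _ A])

text \<open>\<open>Y\<close> ignores \<open>e\<close>, hence is independent of its indicator, whose
  centred version has mean l(1-l) - (1-l)l = 0.\<close>

lemma EB_center:
  assumes fin: "finite U" and e: "e \<in> U" and Y: "\<And>H. e \<notin> H \<Longrightarrow> Y (insert e H) = Y H"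
  shows "EB l U (\<lambda>H. (of_bool (e \<in> H) - l) * Y H) = 0"
proof -
  have U: "U = insert e (U - {e})" using e by auto
  have "EB l U (\<lambda>H. (of_bool (e \<in> H) - l) * Y H)
    = l * EB l (U - {e}) (\<lambda>H. (1 - l) * Y (insert e H)) + (1 - l) * EB l (U - {e}) (\<lambda>H. (of_bool (e \<in> H) - l) * Y H)"
    by (subst U, subst EB_insert) (use fin in auto)
  also have "EB l (U - {e}) (\<lambda>H. (1 - l) * Y (insert e H)) = EB l (U - {e}) (\<lambda>H. (1 - l) * Y H)"
    unfolding EB_def by (rule sum.cong) (use Y in auto)
  also have "EB l (U - {e}) (\<lambda>H. (of_bool (e \<in> H) - l) * Y H) = EB l (U - {e}) (\<lambda>H. (- l) * Y H)"
    unfolding EB_def by (rule sum.cong) auto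
  finally show ?thesis unfolding EB_cmult by simp
qed

lemma EB_pair:
  assumes "finite U" "e \<in> U" "f \<in> U"
  shows "EB l U (\<lambda>H. (of_bool (e \<in> H) - l) * (of_bool (f \<in> H) - l)) = (if e = f then l * (1 - l) else 0)"
proof (cases "e = f")
  case True
  have "(of_bool (e \<in> H) - l) * (of_bool (e \<in> H) - l) = l * (1 - l) + (1 - 2 * l) * ((of_bool (e \<in> H) - l) * 1)" for H
    by (auto simp: algebra_simps)
  then show ?thesis using True EB_center[OF assms(1,2), of "\<lambda>_. 1" l] assms(1)
    by (simp add: EB_add EB_const EB_cmult)
next
  case False
  then show ?thesis using EB_center[OF assms(1,2), of "\<lambda>H. of_bool (f \<in> H) - l" l] by auto
qed

lemma EB_sum_zero:
  assumes "finite U" "S \<subseteq> U"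
  shows "EB l U (\<lambda>H. \<Sum>e\<in>S. of_bool (e \<in> H) - l) = 0"
proof -
  have "EB l U (\<lambda>H. of_bool (e \<in> H) - l) = 0" if "e \<in> S" for e
    using EB_center[OF assms(1), of e "\<lambda>_. 1" l] that assms(2) by auto
  then show ?thesis by (simp add: EB_sum)
qed

lemma EB_sum_square:
  assumes "finite U" "S \<subseteq> U"
  shows "EB l U (\<lambda>H. (\<Sum>e\<in>S. of_bool (e \<in> H) - l)\<^sup>2) = real (card S) * (l * (1 - l))"
proof -
  have fS: "finite S" using assms finite_subset by blast
  have "EB l U (\<lambda>H. (\<Sum>e\<in>S. of_bool (e \<in> H) - l)\<^sup>2)
    = (\<Sum>e\<in>S. \<Sum>f\<in>S. EB l U (\<lambda>H. (of_bool (e \<in> H) - l) * (of_bool (f \<in> H) - l)))"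
    by (simp add: power2_eq_square sum_product EB_sum)
  also have "\<dots> = (\<Sum>e\<in>S. \<Sum>f\<in>S. if e = f then l * (1 - l) else 0)"
    using assms by (intro sum.cong refl EB_pair) auto
  finally show ?thesis using fS by simp
qed

section \<open>Exchangeability of the columns in the regular model\<close>

definition colswap :: "nat \<Rightarrow> nat \<Rightarrow> (nat \<times> nat) set \<Rightarrow> (nat \<times> nat) set" where
  "colswap c c' G = {(r, x). (r, transpose c c' x) \<in> G}"

lemma ent_colswap: "ent (colswap c c' G) r x = ent G r (transpose c c' x)"
  by (simp add: ent_def colswap_def)

lemma colswap_bip_graphs:
  assumes G: "G \<in> bip_graphs m n s t" and c: "c \<in> {1..n}" "c' \<in> {1..n}"
  shows "colswap c c' G \<in> bip_graphs m n s t"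
proof -
  have tr: "transpose c c' x \<in> {1..n} \<longleftrightarrow> x \<in> {1..n}" for x using c by (auto simp: transpose_def)
  show ?thesis
    unfolding bip_graphs_iff_sums ent_colswap sum_transpose[OF c]
  proof (intro conjI ballI)
    show "colswap c c' G \<subseteq> {1..m} \<times> {1..n}"
    proof
      fix z assume "z \<in> colswap c c' G"
      then obtain r x where z: "z = (r, x)" "(r, transpose c c' x) \<in> G" by (auto simp: colswap_def)
      then have "(r, transpose c c' x) \<in> {1..m} \<times> {1..n}" using G by (auto simp: bip_graphs_def)
      then show "z \<in> {1..m} \<times> {1..n}" using tr[of x] z by blast
    qed
  next
    fix x assume "x \<in> {1..n}"
    then show "(\<Sum>r = 1..m. ent G r (transpose c c' x)) = real t"
      using G tr[of x] unfolding bip_graphs_iff_sums by blast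
  qed (use G in \<open>auto simp: bip_graphs_iff_sums\<close>)
qed

lemma sum_colswap:
  assumes "c \<in> {1..n}" "c' \<in> {1..n}"
  shows "(\<Sum>G\<in>bip_graphs m n s t. X (colswap c c' G)) = (\<Sum>G\<in>bip_graphs m n s t. X G :: real)"
proof (rule sum.reindex_bij_witness[of _ "colswap c c'" "colswap c c'"])
  show "colswap c c' (colswap c c' G) = G" for G by (simp add: colswap_def)
qed (use assms colswap_bip_graphs in \<open>auto simp: colswap_def\<close>)

text \<open>By exchangeability all entries of a row have the same mean and all pairs the same
  covariance. Since the centred row sums to zero, the mean is 0 and the covariance is -v/(n-1), as
  for sampling without replacement.\<close>

lemma row_moments:
  fixes m n s t r K :: nat
  assumes n: "2 \<le> n" and r: "r \<in> {1..m}" and K: "K \<le> n"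
  defines "l \<equiv> lam n s" and "B \<equiv> bip_graphs m n s t"
  shows "(\<Sum>G\<in>B. \<Sum>k = 1..K. ent G r k - l) = 0"
    and "(\<Sum>G\<in>B. (\<Sum>k = 1..K. ent G r k - l)\<^sup>2)
      = real (card B) * (l * (1 - l)) * (real K * (1 - (real K - 1) / (real n - 1)))"
proof -
  have row: "(\<Sum>k = 1..n. ent G r k - l) = 0" if "G \<in> B" for G
  proof -
    have "(\<Sum>k = 1..n. ent G r k) = real s" using that r unfolding B_def bip_graphs_iff_sums by blast
    then show ?thesis using n by (simp add: sum_subtractf l_def lam_def)
  qed
  have mean: "(\<Sum>G\<in>B. ent G r k - l) = 0" if k: "k \<in> {1..n}" for k
  proof -
    have "(\<Sum>G\<in>B. ent G r x - l) = (\<Sum>G\<in>B. ent G r k - l)" if x: "x \<in> {1..n}" for x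
      using sum_colswap[OF k x, of "\<lambda>G. ent G r k - l" m s t] unfolding B_def ent_colswap by simp
    then have "(\<Sum>x = 1..n. \<Sum>G\<in>B. ent G r x - l) = real n * (\<Sum>G\<in>B. ent G r k - l)" by simp
    moreover have "(\<Sum>x = 1..n. \<Sum>G\<in>B. ent G r x - l) = 0"
      by (subst sum.swap) (simp add: row)
    ultimately show ?thesis using n by simp
  qed
  show "(\<Sum>G\<in>B. \<Sum>k = 1..K. ent G r k - l) = 0"
    by (subst sum.swap) (rule sum.neutral, use mean K in auto)
  define V where "V = real (card B) * (l * (1 - l))"
  have sq: "(\<Sum>G\<in>B. (ent G r k - l)\<^sup>2) = V" if k: "k \<in> {1..n}" for k
  proof -
    have "(ent G r k - l)\<^sup>2 = (1 - 2 * l) * (ent G r k - l) + l * (1 - l)" for G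
      by (simp add: power2_diff ent_idem) (simp add: algebra_simps power2_eq_square)
    then have "(\<Sum>G\<in>B. (ent G r k - l)\<^sup>2) = (1 - 2 * l) * (\<Sum>G\<in>B. ent G r k - l) + V"
      by (simp only: sum.distrib sum_distrib_left sum_constant V_def)
    then show ?thesis using mean[OF k] by simp
  qed
  have off: "(\<Sum>G\<in>B. (ent G r k - l) * (ent G r x - l)) = - V / (real n - 1)"
    if k: "k \<in> {1..n}" and x: "x \<in> {1..n} - {k}" for k x
  proof -
    have same: "(\<Sum>G\<in>B. (ent G r k - l) * (ent G r y - l)) = (\<Sum>G\<in>B. (ent G r k - l) * (ent G r x - l))"
      if y: "y \<in> {1..n} - {k}" for y
    proof -
      have "x \<in> {1..n}" "y \<in> {1..n}" using x y by auto
      from sum_colswap[OF this, of "\<lambda>G. (ent G r k - l) * (ent G r x - l)" m s t]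
      show ?thesis unfolding B_def ent_colswap using x y by simp
    qed
    have "(\<Sum>y\<in>{1..n} - {k}. \<Sum>G\<in>B. (ent G r k - l) * (ent G r y - l)) = - V"
    proof -
      have "(\<Sum>y\<in>{1..n} - {k}. \<Sum>G\<in>B. (ent G r k - l) * (ent G r y - l))
        = (\<Sum>G\<in>B. (ent G r k - l) * (\<Sum>y\<in>{1..n} - {k}. ent G r y - l))"
        by (subst sum.swap) (simp add: sum_distrib_left)
      also have "\<dots> = (\<Sum>G\<in>B. - (ent G r k - l)\<^sup>2)"
      proof (rule sum.cong[OF refl])
        fix G assume "G \<in> B"
        then have "(\<Sum>y\<in>{1..n} - {k}. ent G r y - l) = - (ent G r k - l)"
          using row[of G] k by (simp add: sum.remove)
        then show "(ent G r k - l) * (\<Sum>y\<in>{1..n} - {k}. ent G r y - l) = - (ent G r k - l)\<^sup>2"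
          by (simp only: power2_eq_square mult_minus_right)
      qed
      finally show ?thesis using sq[OF k] by (simp add: sum_negf)
    qed
    moreover have "(\<Sum>y\<in>{1..n} - {k}. \<Sum>G\<in>B. (ent G r k - l) * (ent G r y - l))
      = (real n - 1) * (\<Sum>G\<in>B. (ent G r k - l) * (ent G r x - l))"
      using same k n by (simp add: of_nat_diff card_Diff_singleton)
    moreover have "real n - 1 \<noteq> 0" using n by simp
    ultimately show ?thesis by (simp add: eq_divide_eq mult.commute)
  qed
  have "(\<Sum>G\<in>B. (\<Sum>k = 1..K. ent G r k - l)\<^sup>2)
    = (\<Sum>k = 1..K. \<Sum>G\<in>B. (ent G r k - l)\<^sup>2)
      + (\<Sum>k = 1..K. \<Sum>x\<in>{1..K} - {k}. \<Sum>G\<in>B. (ent G r k - l) * (ent G r x - l))"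
    unfolding square_sum_off_diagonal[OF finite_atLeastAtMost] sum.distrib
    by (intro arg_cong2[where f = "(+)"] sum.swap sum_swap3)
  also have "(\<Sum>k = 1..K. \<Sum>G\<in>B. (ent G r k - l)\<^sup>2) = (\<Sum>k = 1..K. V)"
    using K sq by (intro sum.cong) auto
  also have "(\<Sum>k = 1..K. \<Sum>x\<in>{1..K} - {k}. \<Sum>G\<in>B. (ent G r k - l) * (ent G r x - l))
    = (\<Sum>k = 1..K. \<Sum>x\<in>{1..K} - {k}. - V / (real n - 1))"
    using K by (intro sum.cong refl off) auto
  also have "\<dots> = (\<Sum>k = 1..K. (real K - 1) * (- V / (real n - 1)))"
    by (rule sum.cong) (auto simp: of_nat_diff card_Diff_singleton)
  finally show "(\<Sum>G\<in>B. (\<Sum>k = 1..K. ent G r k - l)\<^sup>2)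
      = real (card B) * (l * (1 - l)) * (real K * (1 - (real K - 1) / (real n - 1)))"
    by (simp add: V_def[symmetric]) (simp add: algebra_simps diff_divide_distrib)
qed

text \<open>Fill the rows one after another, running cyclically through the columns.\<close>

lemma bip_graphs_nonempty:
  assumes s: "s < n" and t: "0 < s" and ms: "m * s = n * t"
  shows "bip_graphs m n s t \<noteq> {}"
proof -
  \<comment> \<open>Edge number i < ms is placed in row i div s and column i mod n, both counted
    from 1.\<close>
  define f where "f i = (Suc (i div s), Suc (i mod n))" for i
  define G where "G = f ` {..<m * s}"
  have inj: "inj f"
  proof (rule injI)
    fix x y assume "f x = f y"
    then have d: "x div s = y div s" and e: "x mod n = y mod n" by (auto simp: f_def)
    \<comment> \<open>Edge numbers in the same row differ by less than s < n, whereas in the same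
      column they differ by a multiple of n.\<close>
    have "\<bar>int x - int y\<bar> < int n"
    proof -
      have "x = s * (x div s) + x mod s" "y = s * (x div s) + y mod s" using d by (metis mult_div_mod_eq)+
      moreover have "x mod s < s" "y mod s < s" using t by auto
      ultimately have "\<bar>int x - int y\<bar> < int s" by linarith
      then show ?thesis using s by linarith
    qed
    moreover have "int n dvd int x - int y" using e by (metis mod_eq_dvd_iff of_nat_mod)
    ultimately have "int x - int y = 0" by (metis abs_of_nat dvd_imp_le_int linorder_not_less)
    then show "x = y" by simp
  qed
  have "G \<in> bip_graphs m n s t"
    unfolding bip_graphs_def mem_Collect_eq
  proof (intro conjI ballI)
    show "G \<subseteq> {1..m} \<times> {1..n}"
      using s t by (auto simp: G_def f_def less_mult_imp_div_less Suc_le_eq)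
  next
    fix j assume j: "j \<in> {1..m}"
    have "{k. (j, k) \<in> G} = (\<lambda>i. Suc (i mod n)) ` {i. i < m * s \<and> i div s = j - 1}"
      using j by (force simp: G_def f_def)
    also have "{i. i < m * s \<and> i div s = j - 1} = {(j - 1) * s..<j * s}"
    proof (intro set_eqI iffI)
      fix i assume "i \<in> {i. i < m * s \<and> i div s = j - 1}"
      then have i: "i div s = j - 1" by simp
      have "i < Suc (i div s) * s" using t by (metis dividend_less_div_times mult.commute mult_Suc add.commute)
      moreover have "Suc (i div s) = j" using i j by auto
      ultimately have "i < j * s" by (simp only:)
      then show "i \<in> {(j - 1) * s..<j * s}" using i div_times_less_eq_dividend[of i s] by auto
    next
      fix i assume i: "i \<in> {(j - 1) * s..<j * s}"
      then have "i div s = j - 1" using j t by (intro div_nat_eqI) (auto simp: mult.commute)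
      moreover have "i < m * s"
        by (rule less_le_trans[of _ "j * s"]) (use i j in auto)
      ultimately show "i \<in> {i. i < m * s \<and> i div s = j - 1}" by auto
    qed
    finally have e: "{k. (j, k) \<in> G} = (\<lambda>i. Suc (i mod n)) ` {(j - 1) * s..<j * s}" .
    have "inj_on (\<lambda>i. Suc (i mod n)) {(j - 1) * s..<j * s}"
    proof (rule inj_onI)
      fix x y assume xy: "x \<in> {(j - 1) * s..<j * s}" "y \<in> {(j - 1) * s..<j * s}" "Suc (x mod n) = Suc (y mod n)"
      have "z div s = j - 1" if "z \<in> {(j - 1) * s..<j * s}" for z
        using that j t by (intro div_nat_eqI) (auto simp: mult.commute)
      then have "f x = f y" using xy by (simp add: f_def)
      then show "x = y" using inj by (simp add: inj_eq)
    qed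
    then show "degU G j = s"
      unfolding degU_def e using j by (simp add: card_image diff_mult_distrib)
  next
    fix k assume k: "k \<in> {1..n}"
    have "{j. (j, k) \<in> G} = (\<lambda>i. Suc (i div s)) ` {i. i < m * s \<and> i mod n = k - 1}"
      using k by (force simp: G_def f_def)
    \<comment> \<open>Column \<open>k\<close> receives the numbers congruent to k-1 modulo n, and
      the first ms = nt numbers contain exactly t of them.\<close>
    also have "{i. i < m * s \<and> i mod n = k - 1} = (\<lambda>q. q * n + (k - 1)) ` {..<t}"
    proof (intro set_eqI iffI)
      fix i assume i: "i \<in> {i. i < m * s \<and> i mod n = k - 1}"
      then have "i = (i div n) * n + (k - 1)" by (metis (mono_tags) mem_Collect_eq div_mult_mod_eq)
      moreover have "i div n < t" using i ms by (simp add: less_mult_imp_div_less mult.commute)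
      ultimately show "i \<in> (\<lambda>q. q * n + (k - 1)) ` {..<t}" by blast
    next
      fix i assume "i \<in> (\<lambda>q. q * n + (k - 1)) ` {..<t}"
      then obtain q where q: "q < t" "i = q * n + (k - 1)" by auto
      have "i < Suc q * n" using q k by auto
      also have "\<dots> \<le> t * n" using q by (intro mult_right_mono) auto
      finally have "i < m * s" using ms by (simp add: mult.commute)
      moreover have "k - 1 < n" using k by auto
      then have "i mod n = k - 1" unfolding q(2) by simp
      ultimately show "i \<in> {i. i < m * s \<and> i mod n = k - 1}" by simp
    qed
    finally have e: "{j. (j, k) \<in> G} = (\<lambda>q. Suc ((q * n + (k - 1)) div s)) ` {..<t}"
      by (simp add: image_image)
    have "inj_on (\<lambda>q. Suc ((q * n + (k - 1)) div s)) {..<t}"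
    proof (rule inj_onI)
      fix x y assume xy: "Suc ((x * n + (k - 1)) div s) = Suc ((y * n + (k - 1)) div s)"
      then have "f (x * n + (k - 1)) = f (y * n + (k - 1))" by (simp add: f_def)
      then show "x = y" using inj s by (simp add: inj_eq)
    qed
    then show "degV G k = t" unfolding degV_def e by (simp add: card_image)
  qed
  then show ?thesis by blast
qed

section \<open>Normalisation\<close>

lemma omega_centered:
  assumes "H \<subseteq> {1..J} \<times> {1..K}"
  shows "omega H l J K e = (\<Sum>j = 1..J. (\<Sum>k = 1..K. ent H j k - l) ^ e)"
  unfolding omega_def degU_eq_sum[OF assms] by (simp add: sum_subtractf mult.commute)

lemma omega'_centered:
  assumes "H \<subseteq> {1..J} \<times> {1..K}"
  shows "omega' H l J K e = (\<Sum>k = 1..K. (\<Sum>j = 1..J. ent H j k - l) ^ e)"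
  unfolding omega'_def degV_eq_sum[OF assms] by (simp add: sum_subtractf mult.commute)

lemma abs_cube_sum_le:
  fixes x :: "nat \<Rightarrow> real"
  assumes "\<And>i. i \<in> I \<Longrightarrow> \<bar>x i\<bar> \<le> c"
  shows "\<bar>\<Sum>i\<in>I. x i ^ 3\<bar> \<le> c * (\<Sum>i\<in>I. x i ^ 2)"
  unfolding sum_distrib_left
proof (rule order_trans[OF sum_abs sum_mono])
  fix i assume "i \<in> I"
  have "\<bar>x i ^ 3\<bar> = \<bar>x i\<bar> * x i ^ 2" by (simp add: power3_eq_cube power2_eq_square abs_mult)
  also have "\<dots> \<le> c * x i ^ 2" using assms[OF \<open>i \<in> I\<close>] by (intro mult_right_mono) auto
  finally show "\<bar>x i ^ 3\<bar> \<le> c * x i ^ 2" .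
qed

text \<open>The numerical conditions involve \<open>H\<close> only through its lying in the corner,
  so they are stated for the empty \<open>H\<close> and passed on to all others by
  \<open>bip_bounds_H\<close>.\<close>

locale bip_params =
  fixes m n s t J K :: nat and L :: real
  assumes bounds: "bip_bounds m n s t J K {} L" and big: "L ^ 26 \<le> real n"
    and nonempty: "bip_graphs m n s t \<noteq> {}"
begin

sublocale bip_bounds m n s t J K "{}" L by (rule bounds)

abbreviation U :: "(nat \<times> nat) set" where "U \<equiv> {1..J} \<times> {1..K}"
abbreviation NN :: "(nat \<times> nat) set \<Rightarrow> real" where "NN H \<equiv> real (card (bip_ext.Om m n s t J K H))"
abbreviation Q :: "(nat \<times> nat) set \<Rightarrow> real" where "Q H \<equiv> log_correction m n s J K H"
abbreviation BB :: real where "BB \<equiv> real (card (bip_graphs m n s t))"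
abbreviation step_error :: real where "step_error \<equiv> 56 * L ^ 3 * hh ^ 3"

lemma bip_bounds_H: "H \<subseteq> U \<Longrightarrow> bip_bounds m n s t J K H L"
  by unfold_locales (use J_less K_less ms L2 mL nL Jn Jm Kn Km vL bign bigm in auto)

lemma BB_pos: "0 < BB" using nonempty finite_bip_graphs by (simp add: card_gt_0_iff)

lemma card_U: "card U = J * K" by simp

text \<open>\<open>H\<close> is built edge by edge from the empty corner and the errors add up.
  Positivity is carried along because the logarithms of the successive ratios are
  telescoped.\<close>

lemma chain:
  assumes "H \<subseteq> U"
  shows "(0 < NN H \<longleftrightarrow> 0 < NN {}) \<and> (0 < NN {} \<longrightarrow>
    \<bar>ln (NN H / NN {}) - real (card H) * ln (lm / (1 - lm)) - (Q H - Q {})\<bar> \<le> real (card H) * step_error)"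
proof -
  have "finite H" using assms finite_subset by blast
  then show ?thesis using assms
  proof (induction H rule: finite_induct)
    case empty
    then show ?case by simp
  next
    case (insert x H)
    obtain j k where x: "x = (j, k)" by (cases x)
    have j: "j \<in> {1..J}" and k: "k \<in> {1..K}" and H: "H \<subseteq> U" using insert.prems x by auto
    have jk: "(j, k) \<notin> H" using insert.hyps x by simp
    interpret A: bip_bounds m n s t J K H L by (rule bip_bounds_H[OF H])
    note IH = insert.IH[OF H]
    note st = A.ratio_step[OF j k jk big]
    show ?case
    proof (intro conjI impI)
      show "0 < NN (insert x H) \<longleftrightarrow> 0 < NN {}" using IH st(1) x by simp
      assume N: "0 < NN {}"
      then have N1: "0 < NN H" using IH by simp
      then have N2: "0 < NN (insert x H)" using st(1) x by simp
      have "ln (NN (insert x H) / NN {}) = ln (NN (insert x H) / NN H) + ln (NN H / NN {})"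
        using N N1 N2 by (simp add: ln_div)
      moreover have "\<bar>ln (NN (insert x H) / NN H) - ln (lm / (1 - lm)) - (Q (insert x H) - Q H)\<bar> \<le> step_error"
        using st(2) N1 x by simp
      moreover have "\<bar>ln (NN H / NN {}) - real (card H) * ln (lm / (1 - lm)) - (Q H - Q {})\<bar> \<le> real (card H) * step_error"
        using IH N by simp
      moreover have "real (card (insert x H)) = real (card H) + 1" using insert.hyps by simp
      moreover have "\<bar>(a + b) - (c + 1) * f - (q2 - q0)\<bar> \<le> (c + 1) * e"
        if "\<bar>a - f - (q2 - q1)\<bar> \<le> e" "\<bar>b - c * f - (q1 - q0)\<bar> \<le> c * e" for a b c e f q0 q1 q2 :: real
        using that unfolding abs_le_iff by (simp add: algebra_simps)
      ultimately show "\<bar>ln (NN (insert x H) / NN {}) - real (card (insert x H)) * ln (lm / (1 - lm)) - (Q (insert x H) - Q {})\<bar>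
          \<le> real (card (insert x H)) * step_error"
        by presburger
    qed
  qed
qed

text \<open>Classifies the regular graphs by their corner, so that means over corners can be
  computed in the regular model itself.\<close>

lemma sum_NN: "(\<Sum>H\<in>Pow U. NN H * f H) = (\<Sum>G\<in>bip_graphs m n s t. f (induced G J K))"
proof -
  have "(\<Sum>G\<in>bip_graphs m n s t. f (induced G J K))
    = (\<Sum>H\<in>Pow U. \<Sum>G\<in>{G \<in> bip_graphs m n s t. induced G J K = H}. f (induced G J K))"
    by (rule sum.group[symmetric]) (auto simp: finite_bip_graphs induced_def)
  also have "\<dots> = (\<Sum>H\<in>Pow U. NN H * f H)"
  proof (rule sum.cong[OF refl])
    fix H assume "H \<in> Pow U"
    then interpret A: bip_bounds m n s t J K H L by (intro bip_bounds_H) auto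
    show "(\<Sum>G\<in>{G \<in> bip_graphs m n s t. induced G J K = H}. f (induced G J K)) = NN H * f H"
      unfolding A.Om_def by simp
  qed
  finally show ?thesis by simp
qed

text \<open>Some corner occurs because the model is not empty, and \<open>chain\<close> transports
  positivity from it to the empty corner and on to every other.\<close>

lemma NN_pos: assumes "H \<subseteq> U" shows "0 < NN H"
proof -
  have "(\<Sum>H\<in>Pow U. NN H) = BB" using sum_NN[of "\<lambda>_. 1"] by simp
  then have "(\<Sum>H\<in>Pow U. NN H) \<noteq> 0" using BB_pos by simp
  then obtain H' where "H' \<in> Pow U" "NN H' \<noteq> 0" by (metis (no_types, lifting) sum.neutral)
  then show ?thesis using chain[of H'] chain[OF assms] by auto
qed

text \<open>The logarithm of the true probability divided by its claimed approximation B exp(Q); the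
  whole estimate consists in showing that it is small.\<close>

definition logdev :: "(nat \<times> nat) set \<Rightarrow> real" where
  "logdev H = ln (NN H / BB) - ln (bern lm U H) - Q H"

lemma bern_pos: "0 < bern lm U H"
  unfolding bern_def using lm_pos lm_less_1 by simp

lemma exp_logdev: assumes "H \<subseteq> U" shows "NN H / BB = bern lm U H * exp (Q H) * exp (logdev H)"
proof -
  have "exp (logdev H) = (NN H / BB) / bern lm U H / exp (Q H)"
    unfolding logdev_def exp_diff using NN_pos[OF assms] BB_pos bern_pos by simp
  then show ?thesis using bern_pos[of H] by simp
qed

lemma step_error_nonneg: "0 \<le> step_error" using L2 by simp

text \<open>The Bernoulli weight gains the factor lambda/(1-lambda) with each edge, just as in
  \<open>chain\<close>. So \<open>logdev\<close> is almost constant, and it remains to bound it at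
  the empty corner.\<close>

lemma logdev_diff:
  assumes "H \<subseteq> U" shows "\<bar>logdev H - logdev {}\<bar> \<le> real (J * K) * step_error"
proof -
  have c: "card H \<le> J * K" using card_mono[OF _ assms] by simp
  have "ln (bern lm U H) = real (card H) * ln lm + (real (J * K) - real (card H)) * ln (1 - lm)"
    unfolding bern_def using lm_pos lm_less_1 c by (simp add: ln_mult ln_realpow of_nat_diff)
  moreover have "ln (bern lm U {}) = real (J * K) * ln (1 - lm)"
    unfolding bern_def using lm_less_1 by (simp add: ln_realpow)
  moreover have "ln (lm / (1 - lm)) = ln lm - ln (1 - lm)" using lm_pos lm_less_1 by (simp add: ln_div)
  moreover have "ln (NN H / BB) - ln (NN {} / BB) = ln (NN H / NN {})"
    using NN_pos[OF assms] NN_pos[of "{}"] BB_pos by (simp add: ln_div)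
  moreover have "(a - b - q) - (a0 - b0 - q0) = r - c * f - (q - q0)"
    if "b = c * x + (y - c) * z" "b0 = y * z" "f = x - z" "a - a0 = r" for a b q a0 b0 q0 r c f x y z :: real
    unfolding that(1-3) that(4)[symmetric] by (simp add: algebra_simps)
  ultimately have "logdev H - logdev {} = ln (NN H / NN {}) - real (card H) * ln (lm / (1 - lm)) - (Q H - Q {})"
    unfolding logdev_def by blast
  moreover have "\<bar>ln (NN H / NN {}) - real (card H) * ln (lm / (1 - lm)) - (Q H - Q {})\<bar> \<le> real (card H) * step_error"
    using chain[OF assms] NN_pos[of "{}"] by auto
  moreover have "real (card H) * step_error \<le> real (J * K) * step_error"
    by (rule mult_right_mono[OF of_nat_mono[OF c] step_error_nonneg])
  ultimately show ?thesis by linarith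
qed

abbreviation W1 :: "(nat \<times> nat) set \<Rightarrow> real" where "W1 H \<equiv> omega H lm J K 1"
abbreviation W2 :: "(nat \<times> nat) set \<Rightarrow> real" where "W2 H \<equiv> omega H lm J K 2"
abbreviation W2' :: "(nat \<times> nat) set \<Rightarrow> real" where "W2' H \<equiv> omega' H lm J K 2"

lemma m_pos: "0 < real m" using J_less by simp

text \<open>Degree deviations are at most K and J in absolute value, so the cubic sums are bounded
  by K and J times the quadratic ones. This removes third moments from the computation of the
  means.\<close>

lemma Q_approx:
  assumes H: "H \<subseteq> U"
  shows "\<bar>Q H - (real J * real K / 2 * (1 / real m + 1 / real n) + (1 - 2 * lm) / (2 * v) * (1 / real m + 1 / real n) * W1 H
      - 1 / (2 * v * real m * real n) * (W1 H)\<^sup>2 - (real n + real K) / (2 * v * (real n)\<^sup>2) * W2 H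
      - (real m + real J) / (2 * v * (real m)\<^sup>2) * W2' H)\<bar>
    \<le> real K / (6 * v\<^sup>2 * (real n)\<^sup>2) * W2 H + real J / (6 * v\<^sup>2 * (real m)\<^sup>2) * W2' H"
proof -
  interpret A: bip_bounds m n s t J K H L by (rule bip_bounds_H[OF H])
  have A: "4 * Acoef n s = 2 * v" "24 * (Acoef n s)\<^sup>2 = 6 * v\<^sup>2"
    by (simp_all add: Acoef_def power2_eq_square)
  have w3: "\<bar>omega H lm J K 3\<bar> \<le> real K * W2 H"
    unfolding omega_def by (rule abs_cube_sum_le) (use A.abs_deviation_le A.degU_le in simp)
  have w3': "\<bar>omega' H lm J K 3\<bar> \<le> real J * W2' H"
    unfolding omega'_def by (rule abs_cube_sum_le) (use A.abs_deviation_le A.degV_le in simp)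
  have l1: "\<bar>1 - 2 * lm\<bar> \<le> 1" using lm_pos lm_less_1 by (simp add: abs_le_iff)
  have part: "\<bar>(1 - 2 * lm) / (6 * v\<^sup>2) * (x / y)\<bar> \<le> c / (6 * v\<^sup>2 * y) * z"
    if "\<bar>x\<bar> \<le> c * z" "0 < y" for x y c z :: real
  proof -
    have "\<bar>(1 - 2 * lm) * x\<bar> \<le> 1 * (c * z)" by (rule abs_mult_le[OF l1 that(1)])
    then have "\<bar>(1 - 2 * lm) * x\<bar> / (6 * v\<^sup>2 * y) \<le> c * z / (6 * v\<^sup>2 * y)"
      using that v_pos by (intro divide_right_mono) auto
    moreover have "\<bar>(1 - 2 * lm) / (6 * v\<^sup>2) * (x / y)\<bar> = \<bar>(1 - 2 * lm) * x\<bar> / (6 * v\<^sup>2 * y)"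
      using that by (simp add: abs_mult)
    ultimately show ?thesis by (simp only: times_divide_eq_left)
  qed
  have "(0 :: real) < (real n)\<^sup>2" "(0 :: real) < (real m)\<^sup>2" using n_pos m_pos by simp_all
  note P = part[OF w3 this(1)] part[OF w3' this(2)]
  have eq: "Q H = (real J * real K / 2 * (1 / real m + 1 / real n) + (1 - 2 * lm) / (2 * v) * (1 / real m + 1 / real n) * W1 H
      - 1 / (2 * v * real m * real n) * (W1 H)\<^sup>2 - (real n + real K) / (2 * v * (real n)\<^sup>2) * W2 H
      - (real m + real J) / (2 * v * (real m)\<^sup>2) * W2' H)
    - ((1 - 2 * lm) / (6 * v\<^sup>2) * (omega H lm J K 3 / (real n)\<^sup>2) + (1 - 2 * lm) / (6 * v\<^sup>2) * (omega' H lm J K 3 / (real m)\<^sup>2))"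
    unfolding log_correction_def Let_def A
  proof -
    have 1: "(a / 2 + c * w / V) * i = a / 2 * i + c / V * i * w" for a c w V i :: real
      by (simp add: distrib_right)
    have 2: "x / y = 1 / y * x" for x y :: real by simp
    have 3: "c * w / V = c / V * w" for c w V :: real by simp
    show "(real J * real K / 2 + (1 - 2 * lm) * W1 H / (2 * v)) * (1 / real m + 1 / real n) - (W1 H)\<^sup>2 / (2 * v * real m * real n)
      - (real n + real K) * W2 H / (2 * v * (real n)\<^sup>2) - (real m + real J) * W2' H / (2 * v * (real m)\<^sup>2)
      - (1 - 2 * lm) / (6 * v\<^sup>2) * (omega H lm J K 3 / (real n)\<^sup>2 + omega' H lm J K 3 / (real m)\<^sup>2) =
      (real J * real K / 2 * (1 / real m + 1 / real n) + (1 - 2 * lm) / (2 * v) * (1 / real m + 1 / real n) * W1 H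
      - 1 / (2 * v * real m * real n) * (W1 H)\<^sup>2 - (real n + real K) / (2 * v * (real n)\<^sup>2) * W2 H
      - (real m + real J) / (2 * v * (real m)\<^sup>2) * W2' H)
    - ((1 - 2 * lm) / (6 * v\<^sup>2) * (omega H lm J K 3 / (real n)\<^sup>2) + (1 - 2 * lm) / (6 * v\<^sup>2) * (omega' H lm J K 3 / (real m)\<^sup>2))"
      unfolding 1 3[of "real n + real K"] 3[of "real m + real J"] 2[of "(W1 H)\<^sup>2"]
        distrib_left[of "(1 - 2 * lm) / (6 * v\<^sup>2)"] by (rule refl)
  qed
  have fin: "\<bar>(X - (x + y)) - X\<bar> \<le> a + b" if "\<bar>x\<bar> \<le> a" "\<bar>y\<bar> \<le> b" for X x y a b :: real
    using that by linarith
  show ?thesis unfolding eq by (rule fin[OF P])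
qed

end

context bip_params
begin

section \<open>Means of the exponent under the Bernoulli and the regular model\<close>

definition weighted :: "((nat \<times> nat) set \<Rightarrow> real) \<Rightarrow> ((nat \<times> nat) set \<Rightarrow> real) \<Rightarrow> real" where
  "weighted \<mu> f = (\<Sum>H\<in>Pow U. \<mu> H * f H)"

lemma weighted_mono:
  assumes "\<And>H. H \<subseteq> U \<Longrightarrow> 0 \<le> \<mu> H" "\<And>H. H \<subseteq> U \<Longrightarrow> f H \<le> g H"
  shows "weighted \<mu> f \<le> weighted \<mu> g"
  unfolding weighted_def using assms by (intro sum_mono mult_left_mono) auto

lemma weighted_linear:
  "weighted \<mu> (\<lambda>H. a + b * f1 H - c * f2 H - d * f3 H - e * f4 H)
   = a * weighted \<mu> (\<lambda>_. 1) + b * weighted \<mu> f1 - c * weighted \<mu> f2 - d * weighted \<mu> f3 - e * weighted \<mu> f4"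
  unfolding weighted_def
  by (simp add: algebra_simps sum.distrib sum_subtractf sum_distrib_left)

text \<open>The linear term has mean 0. For the upper bound the term with the square of
  \<open>W1\<close> is dropped on account of its sign, so the variance of the number of edges in the
  corner is asked for only in the Bernoulli model.\<close>

lemma weighted_Q_bounds:
  assumes \<mu>: "\<And>H. H \<subseteq> U \<Longrightarrow> 0 \<le> \<mu> H" and one: "weighted \<mu> (\<lambda>_. 1) = 1" and first: "weighted \<mu> W1 = 0"
  defines "q0 \<equiv> real J * real K / 2 * (1 / real m + 1 / real n)"
    and "c2 \<equiv> 1 / (2 * v * real m * real n)"
    and "c3 \<equiv> (real n + real K) / (2 * v * (real n)\<^sup>2)" and "c4 \<equiv> (real m + real J) / (2 * v * (real m)\<^sup>2)"
    and "d3 \<equiv> real K / (6 * v\<^sup>2 * (real n)\<^sup>2)" and "d4 \<equiv> real J / (6 * v\<^sup>2 * (real m)\<^sup>2)"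
  shows "q0 - c2 * weighted \<mu> (\<lambda>H. (W1 H)\<^sup>2) - (c3 + d3) * weighted \<mu> W2 - (c4 + d4) * weighted \<mu> W2' \<le> weighted \<mu> Q"
    and "weighted \<mu> Q \<le> q0 - (c3 - d3) * weighted \<mu> W2 - (c4 - d4) * weighted \<mu> W2'"
proof -
  define c1 where "c1 = (1 - 2 * lm) / (2 * v) * (1 / real m + 1 / real n)"
  have Q: "\<bar>Q H - (q0 + c1 * W1 H - c2 * (W1 H)\<^sup>2 - c3 * W2 H - c4 * W2' H)\<bar> \<le> d3 * W2 H + d4 * W2' H" if "H \<subseteq> U" for H
    using Q_approx[OF that] unfolding q0_def c1_def c2_def c3_def c4_def d3_def d4_def .
  have "weighted \<mu> (\<lambda>H. q0 + c1 * W1 H - c2 * (W1 H)\<^sup>2 - (c3 + d3) * W2 H - (c4 + d4) * W2' H) \<le> weighted \<mu> Q"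
  proof (rule weighted_mono[OF \<mu>])
    fix H assume "H \<subseteq> U"
    from Q[OF this] show "q0 + c1 * W1 H - c2 * (W1 H)\<^sup>2 - (c3 + d3) * W2 H - (c4 + d4) * W2' H \<le> Q H"
      unfolding abs_le_iff distrib_right by linarith
  qed
  then show "q0 - c2 * weighted \<mu> (\<lambda>H. (W1 H)\<^sup>2) - (c3 + d3) * weighted \<mu> W2 - (c4 + d4) * weighted \<mu> W2' \<le> weighted \<mu> Q"
    unfolding weighted_linear one first by simp
  have c2: "0 \<le> c2" unfolding c2_def using lm_pos lm_less_1 by simp
  have "weighted \<mu> Q \<le> weighted \<mu> (\<lambda>H. q0 + c1 * W1 H - 0 * (W1 H)\<^sup>2 - (c3 - d3) * W2 H - (c4 - d4) * W2' H)"
  proof (rule weighted_mono[OF \<mu>])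
    fix H assume "H \<subseteq> U"
    moreover have "0 \<le> c2 * (W1 H)\<^sup>2" using c2 by simp
    ultimately show "Q H \<le> q0 + c1 * W1 H - 0 * (W1 H)\<^sup>2 - (c3 - d3) * W2 H - (c4 - d4) * W2' H"
      using Q[of H] unfolding abs_le_iff left_diff_distrib by linarith
  qed
  then show "weighted \<mu> Q \<le> q0 - (c3 - d3) * weighted \<mu> W2 - (c4 - d4) * weighted \<mu> W2'"
    unfolding weighted_linear one first by simp
qed

lemma bern_moments:
  "weighted (bern lm U) (\<lambda>_. 1) = 1" "weighted (bern lm U) W1 = 0"
  "weighted (bern lm U) (\<lambda>H. (W1 H)\<^sup>2) = real J * real K * v"
  "weighted (bern lm U) W2 = real J * real K * v" "weighted (bern lm U) W2' = real J * real K * v"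
proof -
  have EB: "weighted (bern lm U) f = EB lm U f" for f by (simp add: weighted_def EB_def)
  have cong: "EB lm U f = EB lm U g" if "\<And>H. H \<subseteq> U \<Longrightarrow> f H = g H" for f g
    unfolding EB_def by (rule sum.cong) (use that in auto)
  have finU: "finite U" by simp
  show "weighted (bern lm U) (\<lambda>_. 1) = 1" unfolding EB by (rule EB_const[OF finU])
  have W1: "W1 H = (\<Sum>x\<in>U. of_bool (x \<in> H) - lm)" if "H \<subseteq> U" for H
    unfolding omega_centered[OF that] power_one_right sum.cartesian_product ent_def by (rule sum.cong) auto
  have "EB lm U W1 = EB lm U (\<lambda>H. \<Sum>x\<in>U. of_bool (x \<in> H) - lm)" by (rule cong[OF W1])
  then show "weighted (bern lm U) W1 = 0" unfolding EB using EB_sum_zero[OF finU order_refl] by simp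
  have "EB lm U (\<lambda>H. (W1 H)\<^sup>2) = EB lm U (\<lambda>H. (\<Sum>x\<in>U. of_bool (x \<in> H) - lm)\<^sup>2)" by (rule cong) (simp only: W1)
  then show "weighted (bern lm U) (\<lambda>H. (W1 H)\<^sup>2) = real J * real K * v"
    unfolding EB using EB_sum_square[OF finU order_refl] by simp
  have r: "(\<Sum>k = 1..K. ent H j k - lm) = (\<Sum>x\<in>{j} \<times> {1..K}. of_bool (x \<in> H) - lm)" for H j
    by (rule sum.reindex_bij_witness[of _ snd "Pair j"]) (auto simp: ent_def)
  have "EB lm U W2 = EB lm U (\<lambda>H. \<Sum>j = 1..J. (\<Sum>x\<in>{j} \<times> {1..K}. of_bool (x \<in> H) - lm)\<^sup>2)"
    by (rule cong) (simp only: omega_centered r)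
  also have "\<dots> = (\<Sum>j = 1..J. real (card ({j} \<times> {1..K})) * v)"
    unfolding EB_sum by (rule sum.cong[OF refl], rule EB_sum_square[OF finU]) auto
  finally show "weighted (bern lm U) W2 = real J * real K * v" unfolding EB by (simp add: card_cartesian_product)
  have c: "(\<Sum>j = 1..J. ent H j k - lm) = (\<Sum>x\<in>{1..J} \<times> {k}. of_bool (x \<in> H) - lm)" for H k
    by (rule sum.reindex_bij_witness[of _ fst "\<lambda>j. (j, k)"]) (auto simp: ent_def)
  have "EB lm U W2' = EB lm U (\<lambda>H. \<Sum>k = 1..K. (\<Sum>x\<in>{1..J} \<times> {k}. of_bool (x \<in> H) - lm)\<^sup>2)"
    by (rule cong) (simp only: omega'_centered c)
  also have "\<dots> = (\<Sum>k = 1..K. real (card ({1..J} \<times> {k})) * v)"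
    unfolding EB_sum by (rule sum.cong[OF refl], rule EB_sum_square[OF finU]) auto
  finally show "weighted (bern lm U) W2' = real J * real K * v" unfolding EB by (simp add: card_cartesian_product)
qed

abbreviation PP :: "(nat \<times> nat) set \<Rightarrow> real" where "PP H \<equiv> NN H / BB"

lemma weighted_PP: "weighted PP f = (\<Sum>G\<in>bip_graphs m n s t. f (induced G J K)) / BB"
  unfolding weighted_def by (simp add: sum_divide_distrib flip: sum_NN)

text \<open>Replaces the factor of sampling without replacement by bounds that combine well with the
  coefficients n + K and m + J.\<close>

lemma hypergeometric_factor:
  assumes "x \<le> y" "2 \<le> y"
  shows "real x * (1 - real x / real y) \<le> real x * (1 - (real x - 1) / (real y - 1))"
    and "real x * (1 - (real x - 1) / (real y - 1)) \<le> real x"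
proof -
  have y: "0 < real y - 1" "0 < real y" using assms by auto
  have "real y * (real x - 1) \<le> real x * (real y - 1)" using assms by (simp add: algebra_simps)
  then have "(real x - 1) / (real y - 1) \<le> real x / real y" using y by (simp add: frac_le_eq divide_le_eq field_simps)
  then show "real x * (1 - real x / real y) \<le> real x * (1 - (real x - 1) / (real y - 1))"
    by (intro mult_left_mono) auto
  show "real x * (1 - (real x - 1) / (real y - 1)) \<le> real x"
  proof (cases "x = 0")
    case False
    then have "0 \<le> (real x - 1) / (real y - 1)" using y by simp
    then show ?thesis by (simp add: mult_left_le)
  qed simp
qed

lemma lam_transposed: "lam m t = lm"
  using lm_t m_pos by (simp add: lam_def)

lemma PP_moments:
  "weighted PP (\<lambda>_. 1) = 1" "weighted PP W1 = 0"
  "real J * real K * v * (1 - real K / real n) \<le> weighted PP W2" "weighted PP W2 \<le> real J * real K * v"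
  "real J * real K * v * (1 - real J / real m) \<le> weighted PP W2'" "weighted PP W2' \<le> real J * real K * v"
proof -
  let ?B = "bip_graphs m n s t"
  have n2: "2 \<le> n" "2 \<le> m" using L_large by linarith+
  have sub: "induced G J K \<subseteq> U" for G by (auto simp: induced_def)
  have ent_ind: "ent (induced G J K) j k = ent G j k" if "j \<in> {1..J}" "k \<in> {1..K}" for G j k
    using that by (auto simp: ent_def induced_def)
  have W: "omega (induced G J K) lm J K e = (\<Sum>j = 1..J. (\<Sum>k = 1..K. ent G j k - lm) ^ e)" for G e
    unfolding omega_centered[OF sub] by (rule sum.cong) (simp_all add: ent_ind)
  have W': "omega' (induced G J K) lm J K e = (\<Sum>k = 1..K. (\<Sum>j = 1..J. ent G j k - lm) ^ e)" for G e
    unfolding omega'_centered[OF sub] by (rule sum.cong) (simp_all add: ent_ind)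
  show "weighted PP (\<lambda>_. 1) = 1" unfolding weighted_PP using BB_pos by simp
  have jm: "j \<in> {1..m}" if "j \<in> {1..J}" for j using that J_less by auto
  have kn: "k \<in> {1..n}" if "k \<in> {1..K}" for k using that K_less by auto
  have "(\<Sum>G\<in>?B. W1 (induced G J K)) = (\<Sum>j = 1..J. \<Sum>G\<in>?B. \<Sum>k = 1..K. ent G j k - lm)"
    unfolding W power_one_right by (rule sum.swap)
  also have "\<dots> = 0"
    by (rule sum.neutral) (use row_moments(1)[OF n2(1) jm less_imp_le[OF K_less]] in auto)
  finally show "weighted PP W1 = 0" unfolding weighted_PP by simp
  have "(\<Sum>G\<in>?B. W2 (induced G J K)) = (\<Sum>j = 1..J. \<Sum>G\<in>?B. (\<Sum>k = 1..K. ent G j k - lm)\<^sup>2)"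
    unfolding W by (rule sum.swap)
  also have "\<dots> = (\<Sum>j = 1..J. BB * v * (real K * (1 - (real K - 1) / (real n - 1))))"
    by (rule sum.cong[OF refl], rule row_moments(2)[OF n2(1) jm less_imp_le[OF K_less]])
  finally have S2: "weighted PP W2 = real J * v * (real K * (1 - (real K - 1) / (real n - 1)))"
    unfolding weighted_PP using BB_pos by simp
  have Jv: "0 \<le> real J * v" "0 \<le> real K * v" using v_pos by (simp_all only: mult_nonneg_nonneg of_nat_0_le_iff less_imp_le)
  note h = hypergeometric_factor[OF less_imp_le[OF K_less] n2(1)]
  show "real J * real K * v * (1 - real K / real n) \<le> weighted PP W2"
    using mult_left_mono[OF h(1) Jv(1)] unfolding S2 by (simp only: mult_ac)
  show "weighted PP W2 \<le> real J * real K * v"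
    using mult_left_mono[OF h(2) Jv(1)] unfolding S2 by (simp only: mult_ac)
  have conv: "?B = converse ` bip_graphs n m t s"
  proof (intro set_eqI iffI)
    fix G assume "G \<in> ?B"
    then have "G\<inverse> \<in> bip_graphs n m t s" by (simp add: bip_graphs_converse)
    then show "G \<in> converse ` bip_graphs n m t s" by (metis converse_converse imageI)
  qed (auto simp: bip_graphs_converse)
  have inj: "inj_on converse (bip_graphs n m t s)" by (simp add: inj_on_def)
  have BB': "real (card (bip_graphs n m t s)) = BB" unfolding conv using card_image[OF inj] by simp
  have "(\<Sum>G\<in>?B. W2' (induced G J K)) = (\<Sum>k = 1..K. \<Sum>G\<in>?B. (\<Sum>j = 1..J. ent G j k - lm)\<^sup>2)"
    unfolding W' by (rule sum.swap)
  also have "\<dots> = (\<Sum>k = 1..K. \<Sum>G\<in>bip_graphs n m t s. (\<Sum>j = 1..J. ent G k j - lam m t)\<^sup>2)"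
    unfolding conv sum.reindex[OF inj] lam_transposed by (simp add: ent_converse)
  also have "\<dots> = (\<Sum>k = 1..K. BB * v * (real J * (1 - (real J - 1) / (real m - 1))))"
    by (rule sum.cong[OF refl], subst row_moments(2)[OF n2(2) kn less_imp_le[OF J_less]])
       (simp_all only: BB' lam_transposed)
  finally have S2': "weighted PP W2' = real K * v * (real J * (1 - (real J - 1) / (real m - 1)))"
    unfolding weighted_PP using BB_pos by simp
  note h' = hypergeometric_factor[OF less_imp_le[OF J_less] n2(2)]
  show "real J * real K * v * (1 - real J / real m) \<le> weighted PP W2'"
    using mult_left_mono[OF h'(1) Jv(2)] unfolding S2' by (simp only: mult_ac)
  show "weighted PP W2' \<le> real J * real K * v"
    using mult_left_mono[OF h'(2) Jv(2)] unfolding S2' by (simp only: mult_ac)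
qed

text \<open>The left side is what the mean of \<open>Q\<close> retains, up to sign, after the
  leading terms have cancelled; both means will be compared with it. Its largest contributions, such
  as J (K/n)^2, are of order 1/sqrt n up to powers of \<open>L\<close>.\<close>

lemma error_le_hh:
  "real J * real K / (2 * real m * real n) + (1 / 2 + 1 / (6 * v)) * (real J * (real K / real n)\<^sup>2 + real K * (real J / real m)\<^sup>2) \<le> hh"
proof -
  let ?q = "sqrt (real n)"
  have q: "1 \<le> ?q" "?q * ?q = real n" using n_pos by auto
  have sqn: "x \<le> L * ?q" if "x\<^sup>2 \<le> L * real n" for x
  proof (rule power2_le_imp_le)
    have "L * 1 \<le> L * L" using L2 by (intro mult_left_mono) auto
    then have "L * real n \<le> L * L * real n" by (intro mult_right_mono) auto
    moreover have "(L * ?q)\<^sup>2 = L * L * real n" by (simp add: power_mult_distrib power2_eq_square[of L])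
    ultimately show "x\<^sup>2 \<le> (L * ?q)\<^sup>2" using that by linarith
  qed (use L2 in simp)
  have J: "real J \<le> L * ?q" and K: "real K \<le> L * ?q" using sqn Jn Kn by auto
  have a: "real J / real m \<le> L\<^sup>2 / ?q" by (rule J_over_m)
  have "L * 1 \<le> L * L" using L2 by (intro mult_left_mono) auto
  then have "L / ?q \<le> L\<^sup>2 / ?q" unfolding power2_eq_square by (intro divide_right_mono) auto
  then have b: "real K / real n \<le> L\<^sup>2 / ?q" using K_over_n by linarith
  have bnd: "x * y\<^sup>2 \<le> L ^ 5 / ?q" if "0 \<le> x" "x \<le> L * ?q" "0 \<le> y" "y \<le> L\<^sup>2 / ?q" for x y
  proof -
    have "x * y\<^sup>2 \<le> (L * ?q) * (L\<^sup>2 / ?q)\<^sup>2" using that L2 by (intro mult_mono power_mono) auto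
    also have "\<dots> = L ^ 5 / ?q"
    proof -
      have "(L * z) * (L\<^sup>2 / z)\<^sup>2 = L ^ 5 / z" if "z \<noteq> 0" for z
        using that power_add[of L 1 4] by (simp add: power2_eq_square power4_eq_xxxx power_divide field_simps)
      then show ?thesis using q by simp
    qed
    finally show ?thesis .
  qed
  have t1: "real J * (real K / real n)\<^sup>2 \<le> L ^ 5 / ?q" by (rule bnd) (use J b in auto)
  have t2: "real K * (real J / real m)\<^sup>2 \<le> L ^ 5 / ?q" by (rule bnd) (use K a in auto)
  have t3: "real J * real K / (2 * real m * real n) \<le> L ^ 4 / ?q"
  proof -
    have nn: "0 \<le> real J / real m * (real K / real n)" by simp
    have "real J * real K / (2 * real m * real n) = (real J / real m) * (real K / real n) / 2" by simp
    also have "\<dots> \<le> (real J / real m) * (real K / real n)"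
    proof -
      have "x / 2 \<le> x" if "0 \<le> x" for x :: real using that by simp
      then show ?thesis using nn .
    qed
    also have "\<dots> \<le> (L\<^sup>2 / ?q) * (L\<^sup>2 / ?q)" using a b L2 by (intro mult_mono) auto
    also have "\<dots> = L ^ 4 / ?q / ?q" by (simp flip: power_add)
    also have "\<dots> \<le> L ^ 4 / ?q / 1" using q L2 by (intro divide_left_mono) auto
    finally show ?thesis by simp
  qed
  have c: "1 / 2 + 1 / (6 * v) \<le> L"
  proof -
    have "1 / 2 + y / 6 \<le> L" if "y \<le> L" for y using that L2 by linarith
    moreover have "1 / (6 * x) = 1 / x / 6" for x :: real by simp
    ultimately show ?thesis using v_inv by (simp only:)
  qed
  have "(1 / 2 + 1 / (6 * v)) * (real J * (real K / real n)\<^sup>2 + real K * (real J / real m)\<^sup>2) \<le> L * (L ^ 5 / ?q + L ^ 5 / ?q)"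
    using c t1 t2 L2 by (intro mult_mono add_mono) auto
  also have "\<dots> = 2 * L ^ 6 / ?q" using power_add[of L 1 5] by simp
  finally have "real J * real K / (2 * real m * real n) + (1 / 2 + 1 / (6 * v)) * (real J * (real K / real n)\<^sup>2 + real K * (real J / real m)\<^sup>2)
    \<le> (L ^ 4 + 2 * L ^ 6) / ?q" using t3 by (simp add: add_divide_distrib)
  also have "\<dots> \<le> hh"
    using L_mono[of 4 8] L_absorb[of 1 6] L_mono[of 7 8] L_absorb[of 1 8] by (intro divide_right_mono) auto
  finally show ?thesis .
qed

end

lemma exp_minus_double_le:
  fixes x :: real
  assumes "0 \<le> x" "x \<le> 1 / 2"
  shows "exp (- 2 * x) \<le> 1 - x"
proof -
  have "x * x \<le> 1 / 2 * x" using assms by (intro mult_right_mono) auto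
  then have "- 2 * x \<le> - x - 2 * x\<^sup>2" by (simp add: power2_eq_square)
  also have "\<dots> \<le> ln (1 - x)" by (rule ln_one_minus_pos_lower_bound[OF assms])
  finally have "exp (- 2 * x) \<le> exp (ln (1 - x))" by simp
  then show ?thesis using assms by simp
qed

context bip_params
begin

abbreviation "XX \<equiv> real J * (real K / real n)\<^sup>2"
abbreviation "YY \<equiv> real K * (real J / real m)\<^sup>2"

text \<open>With mean J K v for \<open>W2\<close> and \<open>W2'\<close>, the quadratic terms cancel
  JK/2 (1/m + 1/n) and leave only the parts of the coefficients containing K/n^2 and J/m^2, the term
  JK/(2mn) and the cubic bounds.\<close>

lemma bern_mean_Q: "- hh \<le> weighted (bern lm U) Q"
proof -
  have "- (j * k / (2 * x * y) + (1 / 2 + 1 / (6 * V)) * (j * (k / y)\<^sup>2 + k * (j / x)\<^sup>2))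
    = j * k / 2 * (1 / x + 1 / y) - 1 / (2 * V * x * y) * (j * k * V)
      - ((y + k) / (2 * V * y\<^sup>2) + k / (6 * V\<^sup>2 * y\<^sup>2)) * (j * k * V)
      - ((x + j) / (2 * V * x\<^sup>2) + j / (6 * V\<^sup>2 * x\<^sup>2)) * (j * k * V)"
    if "x \<noteq> 0" "y \<noteq> 0" "V \<noteq> 0" for j k x y V :: real
    using that by (simp add: field_simps power2_eq_square)
  from this[OF less_imp_neq[OF m_pos, symmetric] less_imp_neq[OF n_pos, symmetric] less_imp_neq[OF v_pos, symmetric]]
  have "- (real J * real K / (2 * real m * real n) + (1 / 2 + 1 / (6 * v)) * (XX + YY)) \<le> weighted (bern lm U) Q"
    using weighted_Q_bounds(1)[of "bern lm U", OF less_imp_le[OF bern_pos] bern_moments(1,2)]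
    unfolding bern_moments(3-5) by metis
  then show ?thesis using error_le_hh by linarith
qed

text \<open>The factor n + K nearly compensates the loss 1 - K/n of sampling without replacement:
  their product is n(1 - K^2/n^2). The lower bound for the mean of \<open>W2\<close> is used with
  \<open>c3\<close> and the upper bound with \<open>d3\<close>; likewise for
  \<open>W2'\<close>.\<close>

lemma PP_mean_Q: "weighted PP Q \<le> hh"
proof -
  define c3 where "c3 = (real n + real K) / (2 * v * (real n)\<^sup>2)"
  define c4 where "c4 = (real m + real J) / (2 * v * (real m)\<^sup>2)"
  define d3 where "d3 = real K / (6 * v\<^sup>2 * (real n)\<^sup>2)"
  define d4 where "d4 = real J / (6 * v\<^sup>2 * (real m)\<^sup>2)"
  have nonneg: "0 \<le> c3" "0 \<le> c4" "0 \<le> d3" "0 \<le> d4"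
    unfolding c3_def c4_def d3_def d4_def using lm_pos lm_less_1 by auto
  have id: "j * k / 2 * (1 / x + 1 / y) - (y + k) / (2 * V * y\<^sup>2) * (j * k * V * (1 - k / y)) + k / (6 * V\<^sup>2 * y\<^sup>2) * (j * k * V)
      - (x + j) / (2 * V * x\<^sup>2) * (j * k * V * (1 - j / x)) + j / (6 * V\<^sup>2 * x\<^sup>2) * (j * k * V)
    = j * (k / y)\<^sup>2 * (k / y) / 2 + k * (j / x)\<^sup>2 * (j / x) / 2 + 1 / (6 * V) * (j * (k / y)\<^sup>2 + k * (j / x)\<^sup>2)"
    if "x \<noteq> 0" "y \<noteq> 0" "V \<noteq> 0" for j k x y V :: real
    using that by (simp add: field_simps power2_eq_square)
  have "weighted PP Q \<le> real J * real K / 2 * (1 / real m + 1 / real n) - (c3 - d3) * weighted PP W2 - (c4 - d4) * weighted PP W2'"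
    unfolding c3_def c4_def d3_def d4_def
    by (rule weighted_Q_bounds(2)) (use PP_moments BB_pos in auto)
  also have "\<dots> = real J * real K / 2 * (1 / real m + 1 / real n) - c3 * weighted PP W2 + d3 * weighted PP W2
      - c4 * weighted PP W2' + d4 * weighted PP W2'"
    by (simp add: left_diff_distrib)
  also have "\<dots> \<le> real J * real K / 2 * (1 / real m + 1 / real n) - c3 * (real J * real K * v * (1 - real K / real n))
      + d3 * (real J * real K * v) - c4 * (real J * real K * v * (1 - real J / real m)) + d4 * (real J * real K * v)"
    using nonneg PP_moments by (intro add_mono diff_mono mult_left_mono order_refl) auto
  also have "\<dots> = XX * (real K / real n) / 2 + YY * (real J / real m) / 2 + 1 / (6 * v) * (XX + YY)"
    unfolding c3_def c4_def d3_def d4_def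
    by (rule id[OF less_imp_neq[OF m_pos, symmetric] less_imp_neq[OF n_pos, symmetric] less_imp_neq[OF v_pos, symmetric]])
  also have "\<dots> \<le> XX * 1 / 2 + YY * 1 / 2 + 1 / (6 * v) * (XX + YY)"
  proof (intro add_mono divide_right_mono mult_left_mono)
    show "real K / real n \<le> 1" "real J / real m \<le> 1" using J_less K_less by simp_all
  qed (use v_pos in auto)
  also have "\<dots> = (1 / 2 + 1 / (6 * v)) * (XX + YY)" by (simp add: distrib_right distrib_left add_divide_distrib)
  also have "\<dots> \<le> hh"
  proof -
    have "0 \<le> real J * real K / (2 * real m * real n)" by simp
    then show ?thesis using error_le_hh by linarith
  qed
  finally show ?thesis .
qed

lemma hh_half: "0 \<le> hh" "hh \<le> 1 / 2"
proof -
  show "0 \<le> hh" using L2 by simp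
  have "2 * L ^ 9 \<le> L ^ 13" using L_absorb[of 1 9] L_mono[of 10 13] by simp
  also have "L ^ 13 \<le> sqrt (real n)"
    by (rule real_le_rsqrt) (use big in \<open>simp flip: power_mult\<close>)
  finally show "hh \<le> 1 / 2" using n_pos by (simp add: divide_le_eq)
qed

abbreviation "total_error \<equiv> real (J * K) * step_error"

text \<open>The true probabilities sum to 1 and exceed exp(\<open>logdev {} - total_error\<close>)
  times the sum of B(1 + Q), whose value is at least 1 - \<open>hh\<close> by
  \<open>bern_mean_Q\<close>.\<close>

lemma logdev_empty_upper: "logdev {} \<le> total_error + 2 * hh"
proof -
  have "exp (logdev {} - total_error) * (1 - hh) \<le> exp (logdev {} - total_error) * (weighted (bern lm U) (\<lambda>_. 1) + weighted (bern lm U) Q)"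
    unfolding bern_moments(1) using bern_mean_Q by (intro mult_left_mono) auto
  also have "\<dots> = (\<Sum>H\<in>Pow U. exp (logdev {} - total_error) * (bern lm U H * (1 + Q H)))"
    unfolding weighted_def by (simp only: distrib_left sum.distrib sum_distrib_left)
  also have "\<dots> \<le> (\<Sum>H\<in>Pow U. PP H)"
  proof (rule sum_mono)
    fix H assume "H \<in> Pow U"
    then have H: "H \<subseteq> U" by simp
    have "exp (logdev {} - total_error) * (bern lm U H * (1 + Q H)) \<le> exp (logdev {} - total_error) * (bern lm U H * exp (Q H))"
      using bern_pos[of H] exp_ge_add_one_self[of "Q H"] by (intro mult_left_mono) auto
    also have "\<dots> \<le> exp (logdev H) * (bern lm U H * exp (Q H))"
      using bern_pos[of H] logdev_diff[OF H] unfolding abs_le_iff by (intro mult_right_mono) auto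
    also have "\<dots> = PP H" unfolding exp_logdev[OF H] by (simp only: mult_ac)
    finally show "exp (logdev {} - total_error) * (bern lm U H * (1 + Q H)) \<le> PP H" .
  qed
  also have "\<dots> = 1" using PP_moments(1) unfolding weighted_def by (simp only: mult_1_right)
  finally have 1: "exp (logdev {} - total_error) * (1 - hh) \<le> 1" .
  have "exp (logdev {} - total_error + (- 2 * hh)) \<le> exp (logdev {} - total_error) * (1 - hh)"
    unfolding exp_add using exp_minus_double_le[OF hh_half] by (intro mult_left_mono) auto
  then have "exp (logdev {} - total_error + (- 2 * hh)) \<le> 1" using 1 by (rule order_trans)
  then show ?thesis unfolding exp_le_one_iff by linarith
qed

text \<open>The same argument with the roles exchanged: B equals the true probability times exp(-Q -
  \<open>logdev\<close>), the B sum to 1, and \<open>PP_mean_Q\<close> bounds the mean of Q from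
  above.\<close>

lemma logdev_empty_lower: "- logdev {} \<le> total_error + 2 * hh"
proof -
  have "exp (- logdev {} - total_error) * (1 - hh) \<le> exp (- logdev {} - total_error) * (weighted PP (\<lambda>_. 1) - weighted PP Q)"
    unfolding PP_moments(1) using PP_mean_Q by (intro mult_left_mono) auto
  also have "\<dots> = (\<Sum>H\<in>Pow U. exp (- logdev {} - total_error) * (PP H * (1 - Q H)))"
    unfolding weighted_def by (simp only: right_diff_distrib sum_subtractf sum_distrib_left)
  also have "\<dots> \<le> (\<Sum>H\<in>Pow U. bern lm U H)"
  proof (rule sum_mono)
    fix H assume "H \<in> Pow U"
    then have H: "H \<subseteq> U" by simp
    have P: "0 \<le> PP H" using BB_pos by simp
    have "exp (- logdev {} - total_error) * (PP H * (1 - Q H)) \<le> exp (- logdev {} - total_error) * (PP H * exp (- Q H))"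
      using P exp_ge_add_one_self[of "- Q H"] by (intro mult_left_mono) auto
    also have "\<dots> \<le> exp (- logdev H) * (PP H * exp (- Q H))"
      using P logdev_diff[OF H] unfolding abs_le_iff by (intro mult_right_mono) auto
    also have "\<dots> = bern lm U H" 
    proof -
      have *: "inverse x * (b * y * x * inverse y) = b" if "x \<noteq> 0" "y \<noteq> 0" for b x y :: real
        using that by (simp add: field_simps)
      show ?thesis unfolding exp_logdev[OF H] exp_minus by (rule *) simp_all
    qed
    finally show "exp (- logdev {} - total_error) * (PP H * (1 - Q H)) \<le> bern lm U H" .
  qed
  also have "\<dots> = 1" using bern_moments(1) unfolding weighted_def by (simp only: mult_1_right)
  finally have 1: "exp (- logdev {} - total_error) * (1 - hh) \<le> 1" .
  have "exp (- logdev {} - total_error + (- 2 * hh)) \<le> exp (- logdev {} - total_error) * (1 - hh)"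
    unfolding exp_add using exp_minus_double_le[OF hh_half] by (intro mult_left_mono) auto
  then have "exp (- logdev {} - total_error + (- 2 * hh)) \<le> 1" using 1 by (rule order_trans)
  then show ?thesis unfolding exp_le_one_iff by linarith
qed

text \<open>JK <= L n steps of error 56 L^30 / n^(3/2) each, and 56 is below 2^6.\<close>

lemma total_error_bound: "total_error \<le> L ^ 37 / sqrt (real n)"
proof -
  have "real J * real K \<le> L * real n"
    using sum_squares_bound[of "real J" "real K"] Jn Kn by linarith
  then have "total_error \<le> L * real n * step_error"
    unfolding of_nat_mult by (rule mult_right_mono[OF _ step_error_nonneg])
  also have "\<dots> = 56 * (L * L ^ 3 * (L ^ 9) ^ 3) * (real n / sqrt (real n) ^ 3)"
    by (simp add: power_divide)
  also have "L * L ^ 3 * (L ^ 9) ^ 3 = L ^ 31"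
  proof -
    have "L * L ^ 3 * (L ^ 9) ^ 3 = L ^ (1 + 3 + 9 * 3)" unfolding power_add power_mult by simp
    then show ?thesis by simp
  qed
  also have "real n / sqrt (real n) ^ 3 = 1 / sqrt (real n)"
  proof -
    have *: "x / y ^ 3 = 1 / y" if "y * y = x" "y \<noteq> 0" for x y :: real
      unfolding that(1)[symmetric] using that(2) by (simp add: power3_eq_cube)
    show ?thesis by (rule *) (use n_pos in auto)
  qed
  also have "56 * L ^ 31 * (1 / sqrt (real n)) \<le> L ^ 37 * (1 / sqrt (real n))"
    using L_absorb[of 6 31] L_ge_1[of 31] by (intro mult_right_mono) auto
  finally show ?thesis by simp
qed

theorem prob_induced_estimate:
  assumes H: "H \<subseteq> U"
  shows "\<exists>e. \<bar>e\<bar> \<le> L ^ 39 / sqrt (real n) \<and> prob_induced m n s t J K H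
    = lm ^ card H * (1 - lm) ^ (J * K - card H) * exp (Q H + e)"
proof (intro exI conjI)
  have "\<bar>logdev H\<bar> \<le> 2 * total_error + 2 * hh"
    using logdev_empty_upper logdev_empty_lower logdev_diff[OF H] unfolding abs_le_iff by linarith
  also have "\<dots> \<le> 2 * (L ^ 37 / sqrt (real n)) + 2 * (L ^ 9 / sqrt (real n))"
    using total_error_bound by linarith
  also have "\<dots> = (2 * L ^ 37 + 2 * L ^ 9) / sqrt (real n)" by (simp add: add_divide_distrib)
  also have "\<dots> \<le> L ^ 39 / sqrt (real n)"
    using L_mono[of 9 37] L_absorb[of 2 37] by (intro divide_right_mono) auto
  finally show "\<bar>logdev H\<bar> \<le> L ^ 39 / sqrt (real n)" .
  interpret A: bip_bounds m n s t J K H L by (rule bip_bounds_H[OF H])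
  have "induced H J K = H" using H by (auto simp: induced_def)
  then have "prob_induced m n s t J K H = PP H" by (simp add: prob_induced_def A.Om_def)
  also have "\<dots> = bern lm U H * (exp (Q H) * exp (logdev H))" unfolding exp_logdev[OF H] by (simp only: mult.assoc)
  finally show "prob_induced m n s t J K H = lm ^ card H * (1 - lm) ^ (J * K - card H) * exp (Q H + logdev H)"
    unfolding bern_def exp_add card_U .
qed

end

section \<open>Asymptotics\<close>

text \<open>The 5 in the exponent of \<open>L\<close>: J^2 is at most n^(1 + 3 eps), and comparing
  it with m instead of n costs another n^(3 eps/2), together n^(9 eps/2).\<close>

lemma bip_params_of_growth:
  fixes m n s t J K :: nat and \<epsilon> a C L :: real
  assumes eps: "0 < \<epsilon>" "\<epsilon> \<le> 1 / 400" and st: "0 < s" "s < n" "0 < t" "m * s = n * t"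
    and L: "L = real n powr (5 * \<epsilon>)" "2 \<le> L"
    and mn: "real m \<le> real n powr (1 + \<epsilon>)" and nm: "real n \<le> real m powr (1 + \<epsilon>)"
    and C: "0 \<le> C" "C\<^sup>2 \<le> real n powr \<epsilon>"
    and J: "real J \<le> C * real n powr (1 / 2 + \<epsilon>)" and K: "real K \<le> C * real n powr (1 / 2 + \<epsilon>)"
    and a: "4 + 4 * a * ln (real n) \<le> real n powr \<epsilon>"
    and lam: "(1 - 2 * lam n s)\<^sup>2 / (8 * Acoef n s) *
        (1 + 5 * real m / (6 * real n) + 5 * real n / (6 * real m)) \<le> a * ln (real n)"
  shows "bip_params m n s t J K L"
proof -
  let ?N = "real n"
  have n1: "1 \<le> ?N" and n0: "0 < ?N" using st by auto
  have m0: "0 < real m" using st by (cases m) auto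
  have powr_le: "?N powr x \<le> ?N powr y" if "x \<le> y" for x y using that n1 by (intro powr_mono) auto
  have split: "?N * ?N powr x = ?N powr (1 + x)" for x using n0 by (simp add: powr_add)
  have mL: "real m \<le> L * ?N"
    using mn powr_le[of "1 + \<epsilon>" "1 + 5 * \<epsilon>"] eps split[of "5 * \<epsilon>"] unfolding L by (simp add: mult.commute)
  \<comment> \<open>The hypothesis gives the surplus as m^eps; since m <= n^(1+eps), it is at most
    n^((1+eps) eps).\<close>
  have nm': "?N \<le> real m * ?N powr (3 / 2 * \<epsilon>)"
  proof -
    have "real m powr \<epsilon> \<le> (?N powr (1 + \<epsilon>)) powr \<epsilon>" using mn eps by (intro powr_mono2) auto
    also have "\<dots> = ?N powr ((1 + \<epsilon>) * \<epsilon>)" by (rule powr_powr)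
    also have "\<dots> \<le> ?N powr (3 / 2 * \<epsilon>)" using eps by (intro powr_le mult_right_mono) auto
    finally have "real m * real m powr \<epsilon> \<le> real m * ?N powr (3 / 2 * \<epsilon>)" by (intro mult_left_mono) auto
    moreover have "real m powr (1 + \<epsilon>) = real m * real m powr \<epsilon>" using m0 by (simp add: powr_add)
    ultimately show ?thesis using nm by linarith
  qed
  have nL: "?N \<le> L * real m"
  proof -
    have "real m * ?N powr (3 / 2 * \<epsilon>) \<le> real m * L" unfolding L using eps by (intro mult_left_mono powr_le) auto
    then show ?thesis using nm' by (simp add: mult.commute)
  qed
  have sq: "x\<^sup>2 \<le> L * ?N \<and> x\<^sup>2 \<le> L * real m" if x: "0 \<le> x" "x \<le> C * ?N powr (1 / 2 + \<epsilon>)" for x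
  proof -
    have "x\<^sup>2 \<le> (C * ?N powr (1 / 2 + \<epsilon>))\<^sup>2" using x by (intro power_mono) auto
    also have "\<dots> = C\<^sup>2 * (?N powr (1 / 2 + \<epsilon>) * ?N powr (1 / 2 + \<epsilon>))" by (simp add: power2_eq_square)
    also have "\<dots> = C\<^sup>2 * ?N powr (1 + 2 * \<epsilon>)" unfolding powr_add[symmetric] by simp
    also have "\<dots> \<le> ?N powr \<epsilon> * ?N powr (1 + 2 * \<epsilon>)" using C by (intro mult_right_mono) auto
    also have "\<dots> = ?N * ?N powr (3 * \<epsilon>)" unfolding split powr_add[symmetric] by (simp add: add_ac)
    finally have 1: "x\<^sup>2 \<le> ?N * ?N powr (3 * \<epsilon>)" .
    have "?N * ?N powr (3 * \<epsilon>) \<le> ?N * L" unfolding L using eps by (intro mult_left_mono powr_le) auto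
    moreover have "?N * ?N powr (3 * \<epsilon>) \<le> real m * L"
    proof -
      have "?N * ?N powr (3 * \<epsilon>) \<le> real m * ?N powr (3 / 2 * \<epsilon>) * ?N powr (3 * \<epsilon>)"
        using nm' by (intro mult_right_mono) auto
      also have "\<dots> = real m * ?N powr (3 / 2 * \<epsilon> + 3 * \<epsilon>)" by (simp only: powr_add mult.assoc)
      also have "\<dots> \<le> real m * L" unfolding L using eps by (intro mult_left_mono powr_le) auto
      finally show ?thesis .
    qed
    ultimately show ?thesis using 1 by (simp add: mult.commute)
  qed
  have L26: "L ^ 26 \<le> ?N"
  proof -
    have "L ^ 26 = ?N powr (130 * \<epsilon>)" unfolding L using n0 by (simp add: powr_power)
    also have "\<dots> \<le> ?N powr 1" using eps by (intro powr_le) auto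
    finally show ?thesis using n0 by simp
  qed
  have Lmono: "L ^ i \<le> L ^ j" if "i \<le> j" for i j using L(2) that by (intro power_increasing) auto
  have L25: "L ^ 25 \<le> real m"
  proof -
    have "L * L ^ 25 = L ^ 26" using power_add[of L 1 25] by simp
    then have "L * L ^ 25 \<le> L * real m" using L26 nL by linarith
    then show ?thesis using L(2) by simp
  qed
  have L16: "16 * L \<le> L ^ 5"
  proof -
    have "2 ^ 4 \<le> L ^ 4" using L(2) by (intro power_mono) auto
    then have "2 ^ 4 * L \<le> L ^ 4 * L" using L(2) by (intro mult_right_mono) auto
    then show ?thesis using power_add[of L 4 1] by simp
  qed
  have less: "x < y" if "x\<^sup>2 \<le> L * y" "L ^ 5 \<le> y" "0 < y" for x y
  proof (rule power2_less_imp_less)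
    have "16 * (L * y) \<le> y\<^sup>2" using that L16 mult_right_mono[of "16 * L" y y] by (simp add: power2_eq_square)
    moreover have "0 < L * y" using that L(2) by simp
    ultimately show "x\<^sup>2 < y\<^sup>2" using that by linarith
  qed (use that in simp)
  have l: "0 < lam n s" "lam n s < 1" using st by (auto simp: lam_def)
  define v where "v = lam n s * (1 - lam n s)"
  have v0: "0 < v" unfolding v_def using l by simp
  have vL: "1 \<le> L * v"
  proof -
    \<comment> \<open>With v = lambda(1-lambda) the quotient is (1-4v)/(4v), and the bracket in the
      hypothesis is at least 1; hence 1/v <= 4 + 4a log n.\<close>
    define x where "x = (1 - 2 * lam n s)\<^sup>2 / (8 * Acoef n s)"
    have "(1 - 2 * lam n s)\<^sup>2 = 1 - 4 * v"
      unfolding v_def by (simp add: power2_eq_square algebra_simps)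
    moreover have "8 * Acoef n s = 4 * v" unfolding v_def Acoef_def by simp
    ultimately have x: "x = (1 - 4 * v) / (4 * v)" by (simp only: x_def)
    have "0 \<le> x" unfolding x_def using v0 by (simp add: Acoef_def v_def)
    then have "x * 1 \<le> x * (1 + 5 * real m / (6 * real n) + 5 * real n / (6 * real m))"
      by (intro mult_left_mono) auto
    also have "\<dots> \<le> a * ln ?N" using lam unfolding x_def .
    finally have "(1 - 4 * v) / (4 * v) \<le> a * ln ?N" unfolding x by simp
    then have "1 - 4 * v \<le> a * ln ?N * (4 * v)" using v0 by (simp only: pos_divide_le_eq mult_pos_pos zero_less_numeral)
    then have "1 \<le> (4 + 4 * a * ln ?N) * v" by (simp add: algebra_simps)
    also have "\<dots> \<le> ?N powr \<epsilon> * v" using a v0 by (intro mult_right_mono) auto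
    also have "\<dots> \<le> L * v" unfolding L using eps v0 by (intro mult_right_mono powr_le) auto
    finally show ?thesis .
  qed
  have J2: "(real J)\<^sup>2 \<le> L * ?N" "(real J)\<^sup>2 \<le> L * real m" and K2: "(real K)\<^sup>2 \<le> L * ?N" "(real K)\<^sup>2 \<le> L * real m"
    using sq[OF _ J] sq[OF _ K] by auto
  have L5: "L ^ 5 \<le> ?N" "L ^ 5 \<le> real m" using Lmono[of 5 26] Lmono[of 5 25] L26 L25 by auto
  have JK: "J < m" "K < n" using less[OF J2(2) L5(2) m0] less[OF K2(1) L5(1) n0] by auto
  have "bip_bounds m n s t J K {} L"
    by unfold_locales (use JK st(4) L(2) mL nL J2 K2 vL L5 in \<open>auto simp: v_def\<close>)
  then show ?thesis
    using L26 bip_graphs_nonempty[OF st(2,1,4)] by (simp add: bip_params_def)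
qed

lemma powr_at_top:
  fixes \<delta> :: real
  assumes "filterlim N at_top F" "0 < \<delta>"
  shows "filterlim (\<lambda>i. N i powr \<delta>) at_top F"
proof -
  have ev: "eventually (\<lambda>i. 0 < N i) F" using assms(1) by (simp add: filterlim_at_top_dense)
  have "filterlim (\<lambda>i. exp (\<delta> * ln (N i))) at_top F"
    using assms
    by (intro filterlim_compose[OF exp_at_top] filterlim_tendsto_pos_mult_at_top[OF tendsto_const]
        filterlim_compose[OF ln_at_top]) auto
  then show ?thesis
    by (rule filterlim_mono_eventually) (use ev in \<open>auto simp: powr_def elim: eventually_mono\<close>)
qed

theorem theorem2p5:
  fixes a b :: real
  assumes "a > 0" and "b > 0" and "a + b < 1/2"
  shows "\<exists>\<epsilon>0>0. \<forall>\<epsilon>::real. 0 < \<epsilon> \<and> \<epsilon> < \<epsilon>0 \<longrightarrow>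
    (\<forall>(m::nat \<Rightarrow> nat) (n::nat \<Rightarrow> nat) (s::nat \<Rightarrow> nat) (t::nat \<Rightarrow> nat)
       (J::nat \<Rightarrow> nat) (K::nat \<Rightarrow> nat) (H::nat \<Rightarrow> (nat \<times> nat) set).
      filterlim m at_top sequentially \<and> filterlim n at_top sequentially \<and>
      (\<forall>i. 0 < s i \<and> s i < n i \<and> 0 < t i \<and> m i * s i = n i * t i) \<and>
      (\<forall>i. J i \<le> m i \<and> K i \<le> n i \<and> H i \<subseteq> {1..J i} \<times> {1..K i}) \<and>
      (\<exists>C. \<forall>\<^sub>F i in sequentially.
          (\<forall>j\<in>{1..m i}. real (degU (H i) j) \<le> C * real (n i) powr (1/2 + \<epsilon>)) \<and>
          (\<forall>k\<in>{1..n i}. real (degV (H i) k) \<le> C * real (n i) powr (1/2 + \<epsilon>))) \<and>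
      (\<lambda>i. real (card (H i))) \<in> O(\<lambda>i. real (n i) powr (1 + 2 * \<epsilon>)) \<and>
      (\<lambda>i. real (J i)) \<in> O(\<lambda>i. real (n i) powr (1/2 + \<epsilon>)) \<and>
      (\<lambda>i. real (K i)) \<in> O(\<lambda>i. real (n i) powr (1/2 + \<epsilon>)) \<and>
      (\<lambda>i. real (n i)) \<in> o(\<lambda>i. real (m i) powr (1 + \<epsilon>)) \<and>
      (\<lambda>i. real (m i)) \<in> o(\<lambda>i. real (n i) powr (1 + \<epsilon>)) \<and>
      (\<forall>\<^sub>F i in sequentially.
          (1 - 2 * lam (n i) (s i))\<^sup>2 / (8 * Acoef (n i) (s i)) *
            (1 + 5 * real (m i) / (6 * real (n i)) + 5 * real (n i) / (6 * real (m i)))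
          \<le> a * ln (real (n i)))
      \<longrightarrow>
      (\<exists>E :: nat \<Rightarrow> real. E \<in> O(\<lambda>i. real (n i) powr (- b)) \<and>
        (\<forall>\<^sub>F i in sequentially.
          (let mm = real (m i); nn = real (n i); JJ = real (J i); KK = real (K i);
               l = lam (n i) (s i); A = Acoef (n i) (s i); X = card (H i);
               w1 = omega (H i) l (J i) (K i) 1; w2 = omega (H i) l (J i) (K i) 2;
               w3 = omega (H i) l (J i) (K i) 3;
               w2' = omega' (H i) l (J i) (K i) 2; w3' = omega' (H i) l (J i) (K i) 3
           in prob_induced (m i) (n i) (s i) (t i) (J i) (K i) (H i) =
              l ^ X * (1 - l) ^ (J i * K i - X) *
              exp ((JJ * KK / 2 + (1 - 2 * l) * w1 / (4 * A)) * (1 / mm + 1 / nn)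
                   - w1\<^sup>2 / (4 * A * mm * nn)
                   - (nn + KK) * w2 / (4 * A * nn\<^sup>2)
                   - (mm + JJ) * w2' / (4 * A * mm\<^sup>2)
                   - (1 - 2 * l) / (24 * A\<^sup>2) * (w3 / nn\<^sup>2 + w3' / mm\<^sup>2)
                   + E i)))))"
proof (rule exI[of _ "(1 / 2 - b) / 200"], intro conjI allI impI, goal_cases)
  case 1
  then show ?case using assms by simp
next
  case (2 \<epsilon> m n s t J K H)
  let ?N = "\<lambda>i. real (n i)"
  \<comment> \<open>The final error L^39 / sqrt n is n^(195 eps - 1/2), at most n^(-b) because 200
    eps < 1/2 - b. As b > 0 this also gives eps < 1/400, which ensures L^26 <= n.\<close>
  have eps: "0 < \<epsilon>" "\<epsilon> < (1 / 2 - b) / 200" using 2(1) by auto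
  then have eps': "\<epsilon> \<le> 1 / 400" using assms by simp
  have "filterlim n at_top sequentially" using 2(2) by blast
  then have n_top: "filterlim ?N at_top sequentially"
    by (rule filterlim_compose[OF filterlim_real_sequentially])
  have st: "0 < s i" "s i < n i" "0 < t i" "m i * s i = n i * t i" for i using 2(2) by blast+
  have H: "H i \<subseteq> {1..J i} \<times> {1..K i}" for i using 2(2) by blast
  have "(\<lambda>i. real (J i)) \<in> O(\<lambda>i. ?N i powr (1 / 2 + \<epsilon>))" using 2(2) by blast
  then obtain CJ where "CJ > 0" and CJ: "\<forall>\<^sub>F i in sequentially. real (J i) \<le> CJ * ?N i powr (1 / 2 + \<epsilon>)"
    by (elim landau_o.bigE) auto
  have "(\<lambda>i. real (K i)) \<in> O(\<lambda>i. ?N i powr (1 / 2 + \<epsilon>))" using 2(2) by blast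
  then obtain CK where "CK > 0" and CK: "\<forall>\<^sub>F i in sequentially. real (K i) \<le> CK * ?N i powr (1 / 2 + \<epsilon>)"
    by (elim landau_o.bigE) auto
  define C where "C = max CJ CK"
  have "C > 0" using \<open>CJ > 0\<close> by (simp add: C_def)
  have ev_nm: "\<forall>\<^sub>F i in sequentially. ?N i \<le> real (m i) powr (1 + \<epsilon>)"
  proof -
    have "?N \<in> o(\<lambda>i. real (m i) powr (1 + \<epsilon>))" using 2(2) by blast
    from landau_o.smallD[OF this, of 1] show ?thesis by simp
  qed
  have ev_mn: "\<forall>\<^sub>F i in sequentially. real (m i) \<le> ?N i powr (1 + \<epsilon>)"
  proof -
    have "(\<lambda>i. real (m i)) \<in> o(\<lambda>i. ?N i powr (1 + \<epsilon>))" using 2(2) by blast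
    from landau_o.smallD[OF this, of 1] show ?thesis by simp
  qed
  have ev_lam: "\<forall>\<^sub>F i in sequentially. (1 - 2 * lam (n i) (s i))\<^sup>2 / (8 * Acoef (n i) (s i)) *
      (1 + 5 * real (m i) / (6 * ?N i) + 5 * ?N i / (6 * real (m i))) \<le> a * ln (?N i)"
    using 2(2) by blast
  have large: "\<forall>\<^sub>F i in sequentially. c \<le> ?N i powr \<delta>" if "0 < \<delta>" for c \<delta> :: real
    using powr_at_top[OF n_top that] by (simp add: filterlim_at_top)
  have eps2: "0 < \<epsilon> / 2" using eps by simp
  have ev_ln: "\<forall>\<^sub>F i in sequentially. 4 + 4 * a * ln (?N i) \<le> ?N i powr \<epsilon>"
    using large[OF eps2, of "4 + 8 * a / \<epsilon>"]
  proof (rule eventually_mono)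
    fix i assume y: "4 + 8 * a / \<epsilon> \<le> ?N i powr (\<epsilon> / 2)"
    \<comment> \<open>Half of the exponent dominates the logarithm, which is at most 2/eps times y;
      the other half then absorbs the constant 4 + 8a/eps.\<close>
    define y where "y = ?N i powr (\<epsilon> / 2)"
    have n1: "1 \<le> ?N i" using st(2)[of i] by linarith
    have y1: "1 \<le> y" unfolding y_def using n1 eps by (intro ge_one_powr_ge_zero) auto
    have "ln (?N i) \<le> y / (\<epsilon> / 2)" unfolding y_def using n1 eps by (intro ln_powr_bound) auto
    then have "4 * a * ln (?N i) \<le> 4 * a * (y / (\<epsilon> / 2))" using assms by (intro mult_left_mono) auto
    then have "4 + 4 * a * ln (?N i) \<le> 4 * y + 8 * a / \<epsilon> * y" using y1 by (simp add: mult_ac)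
    also have "\<dots> = (4 + 8 * a / \<epsilon>) * y" by (simp add: distrib_right)
    also have "\<dots> \<le> y * y" using y y1 unfolding y_def[symmetric] by (intro mult_right_mono) auto
    also have "\<dots> = ?N i powr \<epsilon>" unfolding y_def powr_add[symmetric] by simp
    finally show "4 + 4 * a * ln (?N i) \<le> ?N i powr \<epsilon>" .
  qed
  have eps5: "0 < 5 * \<epsilon>" using eps by simp
  define L where "L i = ?N i powr (5 * \<epsilon>)" for i
  have params: "\<forall>\<^sub>F i in sequentially. bip_params (m i) (n i) (s i) (t i) (J i) (K i) (L i)"
    using CJ CK ev_nm ev_mn ev_lam ev_ln large[OF eps(1), of "C\<^sup>2"] large[OF eps5, of 2]
  proof eventually_elim
    case (elim i)
    have "CJ * ?N i powr (1 / 2 + \<epsilon>) \<le> C * ?N i powr (1 / 2 + \<epsilon>)"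
      "CK * ?N i powr (1 / 2 + \<epsilon>) \<le> C * ?N i powr (1 / 2 + \<epsilon>)"
      by (auto simp: C_def intro!: mult_right_mono)
    then have "real (J i) \<le> C * ?N i powr (1 / 2 + \<epsilon>)" "real (K i) \<le> C * ?N i powr (1 / 2 + \<epsilon>)"
      using elim(1,2) by linarith+
    then show ?case
      by (intro bip_params_of_growth[OF eps(1) eps' st L_def _ elim(4,3) less_imp_le[OF \<open>C > 0\<close>] elim(7) _ _ elim(6,5)])
         (use elim(8) in \<open>simp_all add: L_def\<close>)
  qed
  define P where "P i e \<longleftrightarrow> \<bar>e\<bar> \<le> L i ^ 39 / sqrt (?N i) \<and> prob_induced (m i) (n i) (s i) (t i) (J i) (K i) (H i)
    = lam (n i) (s i) ^ card (H i) * (1 - lam (n i) (s i)) ^ (J i * K i - card (H i)) *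
      exp (log_correction (m i) (n i) (s i) (J i) (K i) (H i) + e)" for i e
  \<comment> \<open>The estimate holds only eventually; at the remaining indices the chosen value is
    arbitrary, which affects neither the O-bound nor the eventual equation.\<close>
  define E where "E i = (SOME e. P i e)" for i
  have PE: "\<forall>\<^sub>F i in sequentially. P i (E i)"
    using params
  proof eventually_elim
    case (elim i)
    have "\<exists>e. P i e" unfolding P_def by (rule bip_params.prob_induced_estimate[OF elim H])
    then show ?case unfolding E_def by (rule someI_ex)
  qed
  have "E \<in> O(\<lambda>i. ?N i powr (- b))"
  proof (rule landau_o.bigI[of 1])
    show "\<forall>\<^sub>F i in sequentially. norm (E i) \<le> 1 * norm (?N i powr (- b))"
      using PE
    proof eventually_elim
      case (elim i)
      have n1: "1 \<le> ?N i" using st(2)[of i] by linarith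
      have "\<bar>E i\<bar> \<le> L i ^ 39 / sqrt (?N i)" using elim unfolding P_def by blast
      also have "\<dots> = ?N i powr (195 * \<epsilon> - 1 / 2)"
        unfolding L_def using n1 by (simp add: powr_power powr_diff powr_half_sqrt)
      also have "\<dots> \<le> ?N i powr (- b)" using eps n1 by (intro powr_mono) auto
      finally show ?case by simp
    qed
  qed simp
  moreover have "\<forall>\<^sub>F i in sequentially. (let mm = real (m i); nn = real (n i); JJ = real (J i); KK = real (K i);
               l = lam (n i) (s i); A = Acoef (n i) (s i); X = card (H i);
               w1 = omega (H i) l (J i) (K i) 1; w2 = omega (H i) l (J i) (K i) 2;
               w3 = omega (H i) l (J i) (K i) 3;
               w2' = omega' (H i) l (J i) (K i) 2; w3' = omega' (H i) l (J i) (K i) 3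
           in prob_induced (m i) (n i) (s i) (t i) (J i) (K i) (H i) =
              l ^ X * (1 - l) ^ (J i * K i - X) *
              exp ((JJ * KK / 2 + (1 - 2 * l) * w1 / (4 * A)) * (1 / mm + 1 / nn)
                   - w1\<^sup>2 / (4 * A * mm * nn)
                   - (nn + KK) * w2 / (4 * A * nn\<^sup>2)
                   - (mm + JJ) * w2' / (4 * A * mm\<^sup>2)
                   - (1 - 2 * l) / (24 * A\<^sup>2) * (w3 / nn\<^sup>2 + w3' / mm\<^sup>2)
                   + E i))"
    using PE unfolding P_def log_correction_def Let_def by (rule eventually_mono) blast
  ultimately show ?case by blast
qed

end
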